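(* Let $x_0\in\Omega$ and $r>0$ be such that $\mathbb D^2(x_0,2r)\subset\Omega$. There exists a radius $r_0\in(r,2r)$ such that $\mathfrak S_\star\cap\overline{\mathbb D^2(x_0,r_0)}$ is a finite union of path-connected components.
   Context: Let $k\ge 1$ and let $V:\mathbb R^k\to\mathbb R$ be smooth with $\inf V=0$ and satisfying: (1) $\Sigma:=\{y\in\mathbb R^k: V(y)=0\}=\{\sigma_1,\dots,\sigma_q\}$ is finite with $q\ge2$; (2) the Hessian $\nabla^2V(\sigma_i)$ is positive definite for every $i$; (3) there are constants $\alpha_\infty>0$, $R_\infty>0$ such that $y\cdot\nabla V(y)\ge\alpha_\infty|y|^2$ if $|y|>R_\infty$, and $V(y)\to+\infty$ as $|y|\to+\infty$. For $\varepsilon>0$, $e_\varepsilon(u)=\varepsilon\frac{|\nabla u|^2}{2}+\frac1\varepsilon V(u)$. $\mathbb D^2(x,r)$ is the open disc of center $x$ and radius $r$ in $\mathbb R^2$. Let $\Omega\subset\mathbb R^2$ be a smooth bounded domain, $M_0>0$, $(\varepsilon_n)\subset(0,1]$ a decreasing sequence tending to $0$, and $u_{\varepsilon_n}:\Omega\to\mathbb R^k$ smooth solutions of $-\Delta u_{\varepsilon_n}=-\varepsilon_n^{-2}\nabla V(u_{\varepsilon_n})$ in $\Omega$ with $\int_\Omega e_{\varepsilon_n}(u_{\varepsilon_n})\,dx\le M_0$, such that the measures $e_{\varepsilon_n}(u_{\varepsilon_n})\,dx$ converge in the sense of measures on $\Omega$ (against continuous functions with compact support in $\Omega$) to a measure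 $\nu_\star$. There is a constant $\eta_0>0$ depending only on $V$ with the clearing-out property: if $\mathbb D^2(x,r)\subset\Omega$ and $\nu_\star(\overline{\mathbb D^2(x,r)})<\eta_0 r$, then $\nu_\star(\overline{\mathbb D^2(x,r/2)})=0$. Fix such an $\eta_0$ and define $\theta_\star(x)=\liminf_{r\to0}\frac{\nu_\star(\overline{\mathbb D^2(x,r)})}{r}$ for $x\in\Omega$ and $\mathfrak S_\star=\{x\in\Omega:\theta_\star(x)\ge\eta_0\}$. *)

theory Defs
  imports "HOL-Analysis.Analysis"
begin

section \<open>Differential notions\<close>

text \<open>Class $C^m$ and $C^\infty$ on a set; only used for open sets of finite-dimensional spaces,
  where the recursion through directional derivatives gives the usual notions.\<close>

primrec Ck_on :: "nat \<Rightarrow> 'a::real_normed_vector set \<Rightarrow> ('a \<Rightarrow> 'b::real_normed_vector) \<Rightarrow> bool"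
where
  "Ck_on 0 S f \<longleftrightarrow> continuous_on S f"
| "Ck_on (Suc m) S f \<longleftrightarrow> (\<forall>x\<in>S. f differentiable (at x)) \<and>
     (\<forall>v. Ck_on m S (\<lambda>x. frechet_derivative f (at x) v))"

definition smooth_on :: "'a::real_normed_vector set \<Rightarrow> ('a \<Rightarrow> 'b::real_normed_vector) \<Rightarrow> bool" where
  "smooth_on S f \<longleftrightarrow> (\<forall>m. Ck_on m S f)"

definition partial_deriv :: "'n::finite \<Rightarrow> (real^'n \<Rightarrow> 'b::real_normed_vector) \<Rightarrow> real^'n \<Rightarrow> 'b" where
  "partial_deriv i f x = frechet_derivative f (at x) (axis i 1)"

definition gradient :: "(real^'n \<Rightarrow> real) \<Rightarrow> real^'n \<Rightarrow> real^'n" where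
  "gradient f x = (\<chi> i. partial_deriv i f x)"

definition hessian :: "(real^'n \<Rightarrow> real) \<Rightarrow> real^'n \<Rightarrow> real^'n^'n" where
  "hessian f x = (\<chi> i j. partial_deriv i (partial_deriv j f) x)"

definition positive_definite :: "real^'n^'n \<Rightarrow> bool" where
  "positive_definite A \<longleftrightarrow> (\<forall>v. v \<noteq> 0 \<longrightarrow> v \<bullet> (A *v v) > 0)"

definition laplacian :: "(real^'n \<Rightarrow> 'b::real_normed_vector) \<Rightarrow> real^'n \<Rightarrow> 'b" where
  "laplacian u x = (\<Sum>i\<in>UNIV. partial_deriv i (partial_deriv i u) x)"

text \<open>The boundary is smooth if locally the set is the sublevel set of a smooth defining function
  with nonvanishing gradient; in particular the set lies locally on one side of its boundary.\<close>

definition smooth_bounded_domain :: "(real^2) set \<Rightarrow> bool" where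
  "smooth_bounded_domain \<Omega> \<longleftrightarrow>
     open \<Omega> \<and> connected \<Omega> \<and> \<Omega> \<noteq> {} \<and> bounded \<Omega> \<and>
     (\<forall>p\<in>frontier \<Omega>. \<exists>U \<rho>. open U \<and> p \<in> U \<and> smooth_on U (\<rho> :: real^2 \<Rightarrow> real) \<and>
        gradient \<rho> p \<noteq> 0 \<and> \<Omega> \<inter> U = {x\<in>U. \<rho> x < 0})"

section \<open>The potential and the energy\<close>

definition potential :: "(real^'k \<Rightarrow> real) \<Rightarrow> bool" where
  "potential V \<longleftrightarrow>
     smooth_on UNIV V \<and>
     bdd_below (range V) \<and> (INF y. V y) = 0 \<and>
     finite {y. V y = 0} \<and> card {y. V y = 0} \<ge> 2 \<and>
     (\<forall>\<sigma>. V \<sigma> = 0 \<longrightarrow> positive_definite (hessian V \<sigma>)) \<and>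
     (\<exists>\<alpha>>0. \<exists>R>0. \<forall>y. norm y > R \<longrightarrow> y \<bullet> gradient V y \<ge> \<alpha> * (norm y)\<^sup>2) \<and>
     filterlim V at_top at_infinity"

definition energy_density ::
  "(real^'k \<Rightarrow> real) \<Rightarrow> real \<Rightarrow> (real^2 \<Rightarrow> real^'k) \<Rightarrow> real^2 \<Rightarrow> real" where
  "energy_density V \<epsilon> u x =
     \<epsilon> * (\<Sum>i\<in>UNIV. (norm (partial_deriv i u x))\<^sup>2) / 2 + V (u x) / \<epsilon>"

definition energy_measure ::
  "(real^'k \<Rightarrow> real) \<Rightarrow> (real^2) set \<Rightarrow> real \<Rightarrow> (real^2 \<Rightarrow> real^'k) \<Rightarrow> (real^2) measure" where
  "energy_measure V \<Omega> \<epsilon> u =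
     density (restrict_space lborel \<Omega>) (\<lambda>x. ennreal (energy_density V \<epsilon> u x))"

definition radon_measure_on :: "(real^2) set \<Rightarrow> (real^2) measure \<Rightarrow> bool" where
  "radon_measure_on \<Omega> \<nu> \<longleftrightarrow> sets \<nu> = sets (restrict_space borel \<Omega>) \<and>
     (\<forall>K. compact K \<and> K \<subseteq> \<Omega> \<longrightarrow> emeasure \<nu> K < \<infinity>)"

definition measures_converge_on ::
  "(real^2) set \<Rightarrow> (nat \<Rightarrow> (real^2) measure) \<Rightarrow> (real^2) measure \<Rightarrow> bool" where
  "measures_converge_on \<Omega> \<mu> \<nu> \<longleftrightarrow>
     (\<forall>\<phi> :: real^2 \<Rightarrow> real. continuous_on UNIV \<phi> \<and>
        compact (closure {x. \<phi> x \<noteq> 0}) \<and> closure {x. \<phi> x \<noteq> 0} \<subseteq> \<Omega> \<longrightarrow>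
        (\<lambda>n. integral\<^sup>L (\<mu> n) \<phi>) \<longlonglongrightarrow> integral\<^sup>L \<nu> \<phi>)"

definition limit_measure_setting ::
  "(real^'k \<Rightarrow> real) \<Rightarrow> (real^2) set \<Rightarrow> real \<Rightarrow> (nat \<Rightarrow> real) \<Rightarrow> (nat \<Rightarrow> real^2 \<Rightarrow> real^'k)
     \<Rightarrow> (real^2) measure \<Rightarrow> bool" where
  "limit_measure_setting V \<Omega> M \<epsilon> u \<nu> \<longleftrightarrow>
     smooth_bounded_domain \<Omega> \<and> M > 0 \<and>
     (\<forall>n. 0 < \<epsilon> n \<and> \<epsilon> n \<le> 1) \<and> decseq \<epsilon> \<and> \<epsilon> \<longlonglongrightarrow> 0 \<and>
     (\<forall>n. smooth_on \<Omega> (u n)) \<and>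
     (\<forall>n. \<forall>x\<in>\<Omega>. - laplacian (u n) x = - (1 / (\<epsilon> n)\<^sup>2) *\<^sub>R gradient V (u n x)) \<and>
     (\<forall>n. emeasure (energy_measure V \<Omega> (\<epsilon> n) (u n)) \<Omega> \<le> ennreal M) \<and>
     radon_measure_on \<Omega> \<nu> \<and>
     measures_converge_on \<Omega> (\<lambda>n. energy_measure V \<Omega> (\<epsilon> n) (u n)) \<nu>"

section \<open>Clearing-out and the concentration set\<close>

text \<open>As \<open>\<nu>\<close> is a measure on \<open>\<Omega>\<close> only, closed discs are intersected with \<open>\<Omega>\<close>:
  \<open>emeasure\<close> vanishes by convention on sets that are not measurable for \<open>\<nu>\<close>, and an open
  disc may be contained in \<open>\<Omega>\<close> without its closure being so.

  The clearing-out constant depends only on \<open>V\<close>: the same \<open>\<eta>\<close> serves all domains, energy bounds,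
  sequences of solutions and limit measures.\<close>

definition clearing_out_constant :: "(real^'k \<Rightarrow> real) \<Rightarrow> real \<Rightarrow> bool" where
  "clearing_out_constant V \<eta> \<longleftrightarrow> \<eta> > 0 \<and>
     (\<forall>\<Omega> M \<epsilon> u \<nu>. limit_measure_setting V \<Omega> M \<epsilon> u \<nu> \<longrightarrow>
        (\<forall>x r. r > 0 \<and> ball x r \<subseteq> \<Omega> \<and> emeasure \<nu> (cball x r \<inter> \<Omega>) < ennreal (\<eta> * r) \<longrightarrow>
           emeasure \<nu> (cball x (r/2) \<inter> \<Omega>) = 0))"

definition lower_density :: "(real^2) set \<Rightarrow> (real^2) measure \<Rightarrow> real^2 \<Rightarrow> ennreal" where
  "lower_density \<Omega> \<nu> x = Liminf (at_right 0) (\<lambda>r. emeasure \<nu> (cball x r \<inter> \<Omega>) / ennreal r)"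

definition concentration_set :: "(real^2) set \<Rightarrow> (real^2) measure \<Rightarrow> real \<Rightarrow> (real^2) set" where
  "concentration_set \<Omega> \<nu> \<eta> = {x\<in>\<Omega>. lower_density \<Omega> \<nu> x \<ge> ennreal \<eta>}"

end

theory Submission
  imports Defs "HOL-Complex_Analysis.Great_Picard"
begin

text \<open>The concentration set has a lower density bound, so it is relatively closed, carries the
  measure, and admits at most \<open>C / h\<close> points at mutual distance \<open>h\<close>. Hence some circle meets it in
  finitely many points, and each connected component of its part in the closed disc, being a
  continuum with a linear packing bound, is path-connected. It remains to see that every component
  reaches the circle. A component that does not lies in a compact relatively open piece, and such an
  isolated piece has measure zero: the Pohozaev identity makes the potential part of the energy
  vanish in the limit. For the gradient part, test the equation with \<open>\<nabla>V(u)\<close>: near the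
  wells the Hessian is positive, and away from them \<open>\<epsilon> |\<nabla>u|\<^sup>2 \<le> C V(u) / \<epsilon>\<close> because
  \<open>\<epsilon> |\<nabla>u|\<close> is bounded, by mean value estimates at scale \<open>\<epsilon>\<close>.\<close>

section \<open>Continua with a linear packing bound\<close>

text \<open>Clearing-out enters through two consequences: a disc of radius \<open>h\<close> inside
  the domain and centred in the concentration set has mass at least \<open>\<eta> * h\<close>, and
  every other point of the domain has a null disc around it. The first makes a null isolated piece
  contradictory, so the difficulty is to show that such a piece is null. In dimension two the
  gradient part of the stress-energy tensor has trace zero, so the Pohozaev identity controls the
  potential and says nothing about the Dirichlet energy. The second test closes this gap, and here
  the nondegeneracy of the wells is used; its cutoff terms carry a factor
  \<open>\<epsilon>\<^sup>2\<close> and disappear although second derivatives of the cutoff are not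
  small. Convergence of measures is tested on continuous functions, so cutoffs of class C^2 suffice;
  they are built from powers of positive parts, with explicit derivatives. Path-connectedness needs
  no rectifiability theory: the packing bound limits the length of shortest chains, and limits of
  such chains are Lipschitz paths.\<close>

definition is_chain :: "'a::metric_space set \<Rightarrow> real \<Rightarrow> 'a \<Rightarrow> 'a \<Rightarrow> nat \<Rightarrow> (nat \<Rightarrow> 'a) \<Rightarrow> bool" where
  "is_chain C \<delta> x y N p \<longleftrightarrow> p 0 = x \<and> p N = y \<and> (\<forall>i\<le>N. p i \<in> C) \<and> (\<forall>i<N. dist (p i) (p (Suc i)) < \<delta>)"

lemma is_chain_snoc:
  assumes "is_chain C \<delta> x y N p" "z \<in> C" "dist y z < \<delta>"
  shows "is_chain C \<delta> x z (Suc N) (p(Suc N := z))"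
  using assms by (auto simp: is_chain_def less_Suc_eq le_Suc_eq)

text \<open>The points of \<open>C\<close> reachable from \<open>x\<close> form a clopen subset:
  adding one link shows that this subset, and likewise its complement, contains with each of its
  points all points of \<open>C\<close> closer than \<open>\<delta>\<close>.\<close>

lemma is_chain_exists:
  fixes C :: "'a::metric_space set"
  assumes C: "connected C" and \<delta>: "\<delta> > 0" and x: "x \<in> C" and y: "y \<in> C"
  shows "\<exists>N p. is_chain C \<delta> x y N p"
proof -
  define A where "A = {z\<in>C. \<exists>N p. is_chain C \<delta> x z N p}"
  have xA: "x \<in> A"
    using x by (auto simp: A_def is_chain_def intro!: exI[of _ 0] exI[of _ "\<lambda>_. x"])
  have step: "z \<in> A" if "w \<in> A" "z \<in> C" "dist w z < \<delta>" for w z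
    using that is_chain_snoc unfolding A_def by blast
  have "openin (top_of_set C) A"
    unfolding openin_contains_ball
  proof (intro conjI ballI)
    show "A \<subseteq> C" by (auto simp: A_def)
    fix w assume "w \<in> A"
    then show "\<exists>e>0. ball w e \<inter> C \<subseteq> A" using \<delta> step by (intro exI[of _ \<delta>]) auto
  qed
  moreover have "openin (top_of_set C) (C - A)"
    unfolding openin_contains_ball
  proof (intro conjI ballI)
    show "C - A \<subseteq> C" by auto
    fix w assume "w \<in> C - A"
    then show "\<exists>e>0. ball w e \<inter> C \<subseteq> C - A" using \<delta> step[of _ w]
      by (intro exI[of _ \<delta>]) (auto simp: dist_commute)
  qed
  ultimately have "A = {} \<or> A = C"
    using C unfolding connected_clopen closedin_def
    by (metis openin_imp_subset topspace_euclidean_subtopology)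
  with xA y show ?thesis by (auto simp: A_def)
qed

text \<open>A chain with the least number of links has no two far apart indices with nearby points,
  so its points of even index are separated.\<close>

lemma is_chain_short:
  fixes C :: "'a::metric_space set"
  assumes C: "connected C" and \<delta>: "\<delta> > 0" and x: "x \<in> C" and y: "y \<in> C"
    and pack: "\<And>F. F \<subseteq> C \<Longrightarrow> finite F \<Longrightarrow> (\<And>a b. a \<in> F \<Longrightarrow> b \<in> F \<Longrightarrow> a \<noteq> b \<Longrightarrow> \<delta> \<le> dist a b)
      \<Longrightarrow> real (card F) * \<delta> \<le> L"
  shows "\<exists>N p. is_chain C \<delta> x y N p \<and> real N * \<delta> \<le> 2 * L"
proof -
  define N where "N = (LEAST N. \<exists>p. is_chain C \<delta> x y N p)"
  from is_chain_exists[OF C \<delta> x y] have "\<exists>p. is_chain C \<delta> x y N p"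
    unfolding N_def by (rule LeastI_ex)
  then obtain p where p: "is_chain C \<delta> x y N p" by blast
  have far: "\<delta> \<le> dist (p i) (p j)" if ij: "i + 2 \<le> j" "j \<le> N" for i j
  proof (rule ccontr)
    assume "\<not> ?thesis"
    then have near: "dist (p i) (p j) < \<delta>" by simp
    \<comment> \<open>The number of indices skipped by jumping from \<open>p i\<close> straight to
      \<open>p j\<close>; the shortened chain contradicts minimality.\<close>
    define c where "c = j - i - 1"
    define q where "q k = (if k \<le> i then p k else p (k + c))" for k
    have "is_chain C \<delta> x y (N - c) q"
      unfolding is_chain_def
    proof (intro conjI allI impI)
      show "q 0 = x" using p by (simp add: q_def is_chain_def)
      have "\<not> N - c \<le> i" "N - c + c = N" using ij unfolding c_def by linarith+
      then show "q (N - c) = y" using p by (simp add: q_def is_chain_def)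
      show "q k \<in> C" if "k \<le> N - c" for k
        using that p ij by (auto simp: q_def is_chain_def c_def)
      show "dist (q k) (q (Suc k)) < \<delta>" if k: "k < N - c" for k
      proof (cases "k = i")
        case True
        have "Suc (i + c) = j" using ij unfolding c_def by linarith
        then show ?thesis using True near by (simp add: q_def)
      next
        case False
        have "k < N" "k + c < N" using k by linarith+
        then show ?thesis using p False by (auto simp: q_def is_chain_def)
      qed
    qed
    then have "N \<le> N - c" unfolding N_def by (intro Least_le) blast
    then show False using ij unfolding c_def by linarith
  qed
  define F where "F = (\<lambda>k. p (2 * k)) ` {..N div 2}"
  have sep: "\<delta> \<le> dist (p (2*k)) (p (2*l))" if "k \<le> N div 2" "l \<le> N div 2" "k \<noteq> l" for k l
  proof -
    have "2*k \<le> N" "2*l \<le> N" using that(1,2) by linarith+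
    moreover have "2*k + 2 \<le> 2*l \<or> 2*l + 2 \<le> 2*k" using that(3) by linarith
    ultimately show ?thesis using far[of "2*k" "2*l"] far[of "2*l" "2*k"] by (auto simp: dist_commute)
  qed
  have "inj_on (\<lambda>k. p (2 * k)) {..N div 2}"
    using sep \<delta> by (intro inj_onI) (metis atMost_iff dist_self not_le)
  then have card: "card F = N div 2 + 1" unfolding F_def by (simp add: card_image)
  have "real (card F) * \<delta> \<le> L"
  proof (rule pack)
    show "F \<subseteq> C" using p by (auto simp: F_def is_chain_def)
  qed (use sep in \<open>auto simp: F_def\<close>)
  moreover have "N \<le> 2 * card F" unfolding card by presburger
  then have "real N \<le> 2 * real (card F)" by linarith
  then have "real N * \<delta> \<le> 2 * real (card F) * \<delta>" using \<delta> by (intro mult_right_mono) auto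
  ultimately have "real N * \<delta> \<le> 2 * L" by linarith
  with p show ?thesis by blast
qed

text \<open>A short chain is traversed with \<open>N\<close> links per unit of time. Rounding the
  parameter down to whole links costs at most one link, which accounts for the additive
  \<open>\<delta>\<close>.\<close>

lemma almost_Lipschitz_step_map:
  fixes C :: "'a::metric_space set"
  assumes C: "connected C" and \<delta>: "\<delta> > 0" and x: "x \<in> C" and y: "y \<in> C"
    and pack: "\<And>F. F \<subseteq> C \<Longrightarrow> finite F \<Longrightarrow> (\<And>a b. a \<in> F \<Longrightarrow> b \<in> F \<Longrightarrow> a \<noteq> b \<Longrightarrow> \<delta> \<le> dist a b)
      \<Longrightarrow> real (card F) * \<delta> \<le> L"
  shows "\<exists>f. f 0 = x \<and> f 1 = y \<and> f ` {0..1} \<subseteq> C \<and>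
    (\<forall>s\<in>{0..1}. \<forall>t\<in>{0..1}. dist (f s) (f t) \<le> 2 * L * \<bar>s - t\<bar> + \<delta>)"
proof -
  obtain N p where p: "is_chain C \<delta> x y N p" and N: "real N * \<delta> \<le> 2 * L"
    using is_chain_short[OF C \<delta> x y pack] by blast
  define f where "f t = p (nat \<lfloor>t * real N\<rfloor>)" for t
  have dp: "dist (p i) (p (i + k)) \<le> real k * \<delta>" if "i + k \<le> N" for i k
    using that
  proof (induction k)
    case (Suc k)
    have "dist (p (i + k)) (p (Suc (i + k))) < \<delta>" using p Suc.prems by (auto simp: is_chain_def)
    with Suc dist_triangle[of "p i" "p (i + Suc k)" "p (i + k)"] show ?case
      by (simp add: algebra_simps)
  qed simp
  have idx: "nat \<lfloor>t * real N\<rfloor> \<le> N" if "t \<in> {0..1}" for t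
  proof -
    have "t * real N \<le> 1 * real N" using that by (intro mult_right_mono) auto
    then show ?thesis by linarith
  qed
  have le: "dist (f s) (f t) \<le> 2 * L * \<bar>s - t\<bar> + \<delta>" if st: "s \<in> {0..1}" "t \<in> {0..1}" "s \<le> t" for s t
  proof -
    define i where "i = nat \<lfloor>s * real N\<rfloor>"
    define j where "j = nat \<lfloor>t * real N\<rfloor>"
    have m: "s * real N \<le> t * real N" using st by (intro mult_right_mono) auto
    then have ij: "i \<le> j" unfolding i_def j_def by (intro nat_mono floor_mono)
    have "0 \<le> s * real N" using st by auto
    then have "real (j - i) \<le> t * real N - s * real N + 1"
      using ij m unfolding i_def j_def by linarith
    then have "real (j - i) * \<delta> \<le> (t * real N - s * real N + 1) * \<delta>"
      using \<delta> by (intro mult_right_mono) auto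
    also have "\<dots> = (t - s) * (real N * \<delta>) + \<delta>" by (simp add: algebra_simps)
    also have "\<dots> \<le> (t - s) * (2 * L) + \<delta>" using N st by (intro add_mono mult_left_mono) auto
    finally have "real (j - i) * \<delta> \<le> 2 * L * \<bar>s - t\<bar> + \<delta>" using st by (simp add: mult.commute)
    moreover have "dist (p i) (p j) \<le> real (j - i) * \<delta>"
      using dp[of i "j - i"] ij idx[OF st(2)] by (simp add: j_def)
    ultimately show ?thesis by (simp add: f_def i_def j_def)
  qed
  have lip: "dist (f s) (f t) \<le> 2 * L * \<bar>s - t\<bar> + \<delta>" if "s \<in> {0..1}" "t \<in> {0..1}" for s t
  proof (cases "s \<le> t")
    case True then show ?thesis using le that by blast
  next
    case False
    then have "dist (f t) (f s) \<le> 2 * L * \<bar>t - s\<bar> + \<delta>" using le[of t s] that by simp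
    then show ?thesis by (simp add: dist_commute abs_minus_commute)
  qed
  have ends: "f 0 = x" "f 1 = y" using p by (auto simp: f_def is_chain_def)
  have img: "f ` {0..1} \<subseteq> C" using p idx by (auto simp: f_def is_chain_def)
  show ?thesis using lip ends img by (intro exI[of _ f] conjI ballI) simp_all
qed

text \<open>An Arzela-Ascoli argument for maps that are Lipschitz only up to
  \<open>\<delta> n\<close>: a diagonal subsequence converges at all rational times, the error
  disappears in the limit, and the Lipschitz limit extends from the rationals to the
  interval.\<close>

lemma path_connected_if_packing_bound:
  fixes C :: "'a::euclidean_space set"
  assumes C: "compact C" "connected C" and \<delta>0: "\<delta>0 > 0"
    and pack: "\<And>\<delta> F. 0 < \<delta> \<Longrightarrow> \<delta> < \<delta>0 \<Longrightarrow> F \<subseteq> C \<Longrightarrow> finite F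
      \<Longrightarrow> (\<And>a b. a \<in> F \<Longrightarrow> b \<in> F \<Longrightarrow> a \<noteq> b \<Longrightarrow> \<delta> \<le> dist a b) \<Longrightarrow> real (card F) * \<delta> \<le> L"
  shows "path_connected C"
  unfolding path_connected_component
proof (intro ballI)
  fix x y assume x: "x \<in> C" and y: "y \<in> C"
  have L: "0 \<le> L" using pack[of "\<delta>0/2" "{}"] \<delta>0 by simp
  \<comment> \<open>The shift by two keeps \<open>\<delta> n\<close> strictly below
    \<open>\<delta>0\<close> already for \<open>n = 0\<close>.\<close>
  define \<delta> where "\<delta> n = \<delta>0 / real (n + 2)" for n
  have \<delta>: "0 < \<delta> n" "\<delta> n < \<delta>0" for n using \<delta>0 by (auto simp: \<delta>_def field_simps intro: add_pos_nonneg)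
  have \<delta>lim: "\<delta> \<longlonglongrightarrow> 0" 
    unfolding \<delta>_def using LIMSEQ_ignore_initial_segment[OF lim_const_over_n[of \<delta>0], of 2] by simp
  have "\<exists>f. f 0 = x \<and> f 1 = y \<and> f ` {0..1} \<subseteq> C \<and>
    (\<forall>s\<in>{0..1}. \<forall>t\<in>{0..1}. dist (f s) (f t) \<le> 2 * L * \<bar>s - t\<bar> + \<delta> n)" for n
  proof (rule almost_Lipschitz_step_map[OF C(2) \<delta>(1) x y])
    fix F assume F: "F \<subseteq> C" "finite F" "\<And>a b. a \<in> F \<Longrightarrow> b \<in> F \<Longrightarrow> a \<noteq> b \<Longrightarrow> \<delta> n \<le> dist a b"
    show "real (card F) * \<delta> n \<le> L" by (rule pack[OF \<delta> F])
  qed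
  then obtain f where f: "\<And>n. f n 0 = x" "\<And>n. f n 1 = y" "\<And>n. f n ` {0..1} \<subseteq> C"
    and fL: "\<And>n s t. s\<in>{0..1} \<Longrightarrow> t\<in>{0..1} \<Longrightarrow> dist (f n s) (f n t) \<le> 2 * L * \<bar>s - t\<bar> + \<delta> n"
    by metis
  define Q where "Q = \<rat> \<inter> {0..1::real}"
  have Q: "Q \<subseteq> {0..1}" by (auto simp: Q_def)
  have cQ: "countable Q" unfolding Q_def by (intro countable_Int1 countable_rat)
  obtain M where M: "\<And>z. z \<in> C \<Longrightarrow> norm z \<le> M"
    using compact_imp_bounded[OF C(1)] by (auto simp: bounded_iff)
  obtain k :: "nat \<Rightarrow> nat" where k: "strict_mono k" and kl: "\<And>t. t \<in> Q \<Longrightarrow> \<exists>l. (\<lambda>n. f (k n) t) \<longlonglongrightarrow> l"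
    using function_convergent_subsequence[OF cQ, of f M] f(3) Q M by blast
  define g where "g t = (SOME l. (\<lambda>n. f (k n) t) \<longlonglongrightarrow> l)" for t
  have g: "(\<lambda>n. f (k n) t) \<longlonglongrightarrow> g t" if "t \<in> Q" for t
    unfolding g_def by (rule someI_ex[OF kl[OF that]])
  have gL: "dist (g s) (g t) \<le> 2 * L * \<bar>s - t\<bar>" if "s \<in> Q" "t \<in> Q" for s t
  proof (rule LIMSEQ_le)
    show "(\<lambda>n. dist (f (k n) s) (f (k n) t)) \<longlonglongrightarrow> dist (g s) (g t)"
      using g that by (intro tendsto_intros) auto
    have "(\<lambda>n. \<delta> (k n)) \<longlonglongrightarrow> 0" using LIMSEQ_subseq_LIMSEQ[OF \<delta>lim k] by (simp add: o_def)
    then show "(\<lambda>n. 2 * L * \<bar>s - t\<bar> + \<delta> (k n)) \<longlonglongrightarrow> 2 * L * \<bar>s - t\<bar>"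
      using tendsto_add[OF tendsto_const[of "2 * L * \<bar>s - t\<bar>"], of "\<lambda>n. \<delta> (k n)" 0] by simp
    show "\<exists>N. \<forall>n\<ge>N. dist (f (k n) s) (f (k n) t) \<le> 2 * L * \<bar>s - t\<bar> + \<delta> (k n)"
      using that Q by (intro exI[of _ 0] allI impI fL) auto
  qed
  have lip: "(2*L)-lipschitz_on Q g" using gL L by (auto simp: lipschitz_on_def dist_real_def)
  have clQ: "closure Q = {0..1}"
  proof -
    have "{0<..<1} \<subseteq> closure ({0<..<1::real} \<inter> \<rat>)"
      using open_Int_closure_subset[of "{0<..<1::real}" \<rat>] by (simp add: Rats_closure_real)
    also have "\<dots> \<subseteq> closure Q" unfolding Q_def by (intro closure_mono) auto
    finally have "closure {0<..<1} \<subseteq> closure Q" by (rule closure_minimal) (rule closed_closure)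
    moreover have "closure Q \<subseteq> {0..1}" using Q by (intro closure_minimal) auto
    ultimately show ?thesis by simp
  qed
  obtain h where h: "(2*L)-lipschitz_on (closure Q) h" "\<And>t. t \<in> Q \<Longrightarrow> h t = g t"
    using lipschitz_extend_closure[OF lip] by blast
  have gC: "g t \<in> C" if "t \<in> Q" for t
  proof (rule closed_sequentially[OF compact_imp_closed[OF C(1)] _ g[OF that]])
    show "f (k n) t \<in> C" for n using f(3)[of "k n"] that Q by blast
  qed
  have ch: "continuous_on {0..1} h" using lipschitz_on_continuous_on[OF h(1)] clQ by simp
  have "h ` closure Q \<subseteq> closure (h ` Q)"
    using ch clQ by (intro image_closure_subset) (auto intro: closure_subset[THEN subsetD])
  also have "\<dots> \<subseteq> C" using gC h(2) compact_imp_closed[OF C(1)] by (intro closure_minimal) auto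
  finally have hC: "h ` {0..1} \<subseteq> C" unfolding clQ .
  have Q01: "0 \<in> Q" "1 \<in> Q" by (auto simp: Q_def)
  have "g 0 = x" using LIMSEQ_unique[OF g[OF Q01(1)], of x] f(1) by simp
  moreover have "g 1 = y" using LIMSEQ_unique[OF g[OF Q01(2)], of y] f(2) by simp
  ultimately show "path_component C x y"
    unfolding path_component_def using ch hC h(2)[OF Q01(1)] h(2)[OF Q01(2)]
    by (intro exI[of _ h]) (auto simp: path_def path_image_def pathstart_def pathfinish_def)
qed

section \<open>Partial derivatives and integration by parts\<close>

text \<open>A relation along one line rather than a value of \<open>frechet_derivative\<close>: it
  asks for no total differentiability, and its calculus is that of one real variable.\<close>

definition has_pd :: "'n::finite \<Rightarrow> (real^'n \<Rightarrow> real) \<Rightarrow> real \<Rightarrow> real^'n \<Rightarrow> bool" where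
  "has_pd i f D x \<longleftrightarrow> ((\<lambda>t. f (x + t *\<^sub>R axis i 1)) has_real_derivative D) (at 0)"

lemma has_pd_along_line:
  "has_pd i f D (x + s *\<^sub>R axis i 1) \<longleftrightarrow>
     ((\<lambda>t. f (x + t *\<^sub>R axis i 1)) has_real_derivative D) (at s)"
  using DERIV_shift[of "\<lambda>t. f (x + t *\<^sub>R axis i 1)" D 0 s]
  by (simp add: has_pd_def algebra_simps)

lemma has_pd_const: "has_pd i (\<lambda>x. c) 0 x"
  by (simp add: has_pd_def)

lemma has_pd_add: "has_pd i f D x \<Longrightarrow> has_pd i g E x \<Longrightarrow> has_pd i (\<lambda>x. f x + g x) (D + E) x"
  unfolding has_pd_def by (rule DERIV_add)

lemma has_pd_diff: "has_pd i f D x \<Longrightarrow> has_pd i g E x \<Longrightarrow> has_pd i (\<lambda>x. f x - g x) (D - E) x"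
  unfolding has_pd_def by (rule DERIV_diff)

lemma has_pd_mult:
  "has_pd i f D x \<Longrightarrow> has_pd i g E x \<Longrightarrow> has_pd i (\<lambda>x. f x * g x) (D * g x + f x * E) x"
  unfolding has_pd_def by (drule (1) DERIV_mult) (simp add: algebra_simps)

lemma has_pd_cmult: "has_pd i f D x \<Longrightarrow> has_pd i (\<lambda>x. c * f x) (c * D) x"
  unfolding has_pd_def by (rule DERIV_cmult)

lemma has_pd_sum:
  "(\<And>a. a \<in> A \<Longrightarrow> has_pd i (f a) (D a) x) \<Longrightarrow> has_pd i (\<lambda>x. \<Sum>a\<in>A. f a x) (\<Sum>a\<in>A. D a) x"
  unfolding has_pd_def by (rule DERIV_sum)

lemma has_pd_chain:
  "(h has_real_derivative h') (at (f x)) \<Longrightarrow> has_pd i f D x \<Longrightarrow> has_pd i (\<lambda>x. h (f x)) (h' * D) x"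
  unfolding has_pd_def using DERIV_chain2[of h h' "\<lambda>t. f (x + t *\<^sub>R axis i 1)" 0 D UNIV] by simp

lemma has_pd_coord: "has_pd i (\<lambda>x. x $ j) (if i = j then 1 else 0) x"
  unfolding has_pd_def by (auto simp: axis_def intro!: derivative_eq_intros)

lemma has_pd_inner_self: "has_pd i (\<lambda>z. z \<bullet> z) (2 * x $ i) x"
proof -
  have *: "(\<lambda>t. (x + t *\<^sub>R axis i 1) \<bullet> (x + t *\<^sub>R axis i 1)) = (\<lambda>t. x \<bullet> x + 2 * x $ i * t + t\<^sup>2)"
    by (auto simp: inner_add_left inner_add_right inner_axis inner_axis' power2_eq_square algebra_simps)
  show ?thesis unfolding has_pd_def * by (auto intro!: derivative_eq_intros)
qed

lemma has_pd_affine: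
  "has_pd i f D (x + \<delta> *\<^sub>R z) \<Longrightarrow> has_pd i (\<lambda>z. f (x + \<delta> *\<^sub>R z)) (\<delta> * D) z"
  unfolding has_pd_def
  using DERIV_chain2[of "\<lambda>t. f (x + \<delta> *\<^sub>R z + t *\<^sub>R axis i 1)" D "\<lambda>t. t * \<delta>" 0 \<delta> UNIV]
    DERIV_cmult_right[OF DERIV_ident, of \<delta> 0 UNIV]
  by (simp add: algebra_simps)

lemma has_pd_cong:
  assumes "open S" "x \<in> S" "\<And>y. y \<in> S \<Longrightarrow> f y = g y" "has_pd i f D x"
  shows "has_pd i g D x"
proof -
  have "isCont (\<lambda>t. x + t *\<^sub>R axis i 1) 0" by (intro continuous_intros)
  then have "\<forall>\<^sub>F t in nhds 0. x + t *\<^sub>R axis i (1::real) \<in> S"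
    using assms(1,2) by (auto simp: isCont_def eventually_nhds_conv_at dest: topological_tendstoD)
  then have "\<forall>\<^sub>F t in nhds 0. f (x + t *\<^sub>R axis i 1) = g (x + t *\<^sub>R axis i 1)"
    by eventually_elim (rule assms(3))
  from DERIV_cong_ev[OF refl this refl] assms(4) show ?thesis by (simp add: has_pd_def)
qed

lemma has_pd_unique: "has_pd i f D x \<Longrightarrow> has_pd i f E x \<Longrightarrow> D = E"
  unfolding has_pd_def by (rule DERIV_unique)

lemma has_pd_vanishing:
  assumes "closed K" "x \<notin> K" "\<And>y. y \<notin> K \<Longrightarrow> f y = 0"
  shows "has_pd i f 0 x"
  using has_pd_cong[of "- K" x "\<lambda>_. 0" f i 0] assms by (auto intro: has_pd_const)

lemma has_derivative_imp_has_pd: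
  assumes "(f has_derivative f') (at x)"
  shows "has_pd i f (f' (axis i 1)) x"
proof -
  have "((\<lambda>t. x + t *\<^sub>R axis i 1) has_derivative (\<lambda>t. t *\<^sub>R axis i (1::real))) (at 0)"
    by (auto intro!: derivative_eq_intros)
  from has_derivative_compose[OF this, of f f'] assms
  have "((\<lambda>t. f (x + t *\<^sub>R axis i 1)) has_derivative (\<lambda>t. f' (t *\<^sub>R axis i 1))) (at 0)" by simp
  moreover have "f' (t *\<^sub>R axis i 1) = t * f' (axis i 1)" for t
    using linear_cmul[OF has_derivative_linear[OF assms]] by simp
  ultimately show ?thesis
    by (simp add: has_pd_def has_field_derivative_def mult_commute_abs)
qed

text \<open>Only \<open>t = 0\<close> is delicate: an exponent of at least two leaves a positive
  power of \<open>max 0 h\<close> in the difference quotient. Kernels, ramp and cutoffs all draw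
  their regularity from this.\<close>

lemma has_real_derivative_pos_part_power:
  "((\<lambda>t. (max 0 t) ^ Suc (Suc n)) has_real_derivative real (Suc (Suc n)) * (max 0 t) ^ Suc n) (at t)"
proof -
  consider "t < 0" | "t > 0" | "t = 0" by linarith
  then show ?thesis
  proof cases
    case 1
    then have "\<forall>\<^sub>F s in nhds t. (max 0 s) ^ Suc (Suc n) = (0::real)"
      by (intro eventually_mono[OF eventually_nhds_in_open[of "{..<0}"]]) auto
    from DERIV_cong_ev[OF refl this refl] show ?thesis using 1 by simp
  next
    case 2
    then have "\<forall>\<^sub>F s in nhds t. (max 0 s) ^ Suc (Suc n) = s ^ Suc (Suc n)"
      by (intro eventually_mono[OF eventually_nhds_in_open[of "{0<..}"]]) auto
    from DERIV_cong_ev[OF refl this refl] DERIV_pow[of "Suc (Suc n)" t] show ?thesis using 2 by simp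
  next
    case 3
    have "((\<lambda>h. (max 0 h) ^ Suc (Suc n) / h) \<longlongrightarrow> 0) (at (0::real))"
    proof (rule tendsto_0_le[where K = 1])
      show "((\<lambda>h. (max 0 h) ^ Suc n) \<longlongrightarrow> 0) (at (0::real))"
        by (rule tendsto_eq_intros | simp)+
      have le: "norm ((max 0 h) ^ Suc (Suc n) / h) \<le> norm ((max 0 h) ^ Suc n)" for h :: real
        by (cases "h > 0") (simp_all add: max_def abs_mult)
      show "\<forall>\<^sub>F h in at (0::real). norm ((max 0 h) ^ Suc (Suc n) / h) \<le> norm ((max 0 h) ^ Suc n) * (1::real)"
        unfolding mult_1_right by (intro always_eventually allI le)
    qed
    then show ?thesis using 3 by (simp add: DERIV_def)
  qed
qed

section \<open>Integration by parts for functions of compact support\<close>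

lemma
  fixes h :: "'a::euclidean_space \<Rightarrow> real"
  assumes "compact K" "continuous_on K h" "\<And>x. x \<notin> K \<Longrightarrow> h x = 0"
  shows integrable_compact_support: "integrable lborel h"
    and integral_compact_support: "integral\<^sup>L lborel h = integral K h"
proof -
  have *: "(\<lambda>x. indicator K x *\<^sub>R h x) = h"
    using assms(3) by (auto simp: indicator_def fun_eq_iff)
  show "integrable lborel h" using borel_integrable_compact[OF assms(1,2)] unfolding * .
  then have "set_integrable lborel K h" unfolding set_integrable_def * .
  from set_borel_integral_eq_integral(2)[OF this]
  show "integral\<^sup>L lborel h = integral K h" unfolding set_lebesgue_integral_def * .
qed

lemma continuous_on_zero_extension:
  fixes h :: "'a::topological_space \<Rightarrow> 'b::real_normed_vector"
  assumes "open S" "closed K" "K \<subseteq> S" "continuous_on S h" "\<And>x. x \<notin> K \<Longrightarrow> h x = 0"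
  shows "continuous_on UNIV h"
proof -
  have "continuous_on (- K) h" using assms(5) by (subst continuous_on_cong[OF refl, where g = "\<lambda>_. 0"]) auto
  then have "continuous_on (S \<union> - K) h" using assms by (intro continuous_on_open_Un) auto
  moreover have "S \<union> - K = UNIV" using assms(3) by auto
  ultimately show ?thesis by simp
qed

text \<open>By translation invariance the integral of \<open>f (x + t e)\<close> does not depend on \<open>t\<close>;
  differentiate under the integral sign.\<close>

lemma integral_has_pd_eq_0:
  fixes f f' :: "real^'n \<Rightarrow> real"
  assumes cf: "continuous_on UNIV f" and cf': "continuous_on UNIV f'"
    and pd: "\<And>x. has_pd i f (f' x) x" and K: "compact K" "\<And>x. x \<notin> K \<Longrightarrow> f x = 0"
  shows "integral\<^sup>L lborel f' = 0"
proof -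
  let ?e = "axis i 1 :: real^'n"
  have f'0: "f' x = 0" if "x \<notin> K" for x
    using has_pd_unique[OF pd has_pd_vanishing[OF compact_imp_closed[OF K(1)] that K(2)]] .
  obtain B where B: "\<And>x. x \<in> K \<Longrightarrow> norm x \<le> B" using compact_imp_bounded[OF K(1)] by (auto simp: bounded_iff)
  \<comment> \<open>The margin of one unit absorbs the translations by \<open>t\<close> in
    \<open>{-1..1}\<close>, so that one box contains the supports of all translates.\<close>
  obtain a :: "real^'n" where a: "cball 0 (B + 1) \<subseteq> cbox (- a) a"
    using bounded_subset_cbox_symmetric[OF bounded_cball] by blast
  have out: "f (x + t *\<^sub>R ?e) = 0" "f' x = 0" if "x \<notin> cbox (- a) a" "t \<in> {-1..1}" for x t
  proof -
    have nx: "norm x > B + 1" using that(1) a by (meson in_mono linorder_not_le mem_cball_0)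
    then show "f' x = 0" using B f'0 by force
    have "norm (t *\<^sub>R ?e) \<le> 1" using that by (auto simp: norm_axis_1)
    then have "norm (x + t *\<^sub>R ?e) > B" using nx norm_triangle_ineq2[of x "- (t *\<^sub>R ?e)"] by simp
    then show "f (x + t *\<^sub>R ?e) = 0" using B K(2) by force
  qed
  define F where "F t = integral (cbox (- a) a) (\<lambda>x. f (x + t *\<^sub>R ?e))" for t
  have const: "F t = integral\<^sup>L lborel f" if "t \<in> {-1..1}" for t
  proof -
    have "F t = integral\<^sup>L lborel (\<lambda>x. f (x + t *\<^sub>R ?e))" unfolding F_def
      using out that by (intro integral_compact_support[symmetric])
        (auto intro!: continuous_intros continuous_on_compose2[OF cf])
    also have "\<dots> = integral\<^sup>L (distr lborel borel ((+) (t *\<^sub>R ?e))) f"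
      using cf by (subst integral_distr) (auto simp: add.commute borel_measurable_continuous_onI)
    finally show ?thesis by (simp add: lborel_distr_plus)
  qed
  have "(F has_field_derivative integral (cbox (- a) a) (\<lambda>x. f' (x + 0 *\<^sub>R ?e))) (at 0 within {-1..1})"
    unfolding F_def
  proof (rule leibniz_rule_field_derivative)
    show "((\<lambda>t. f (x + t *\<^sub>R ?e)) has_real_derivative f' (x + t *\<^sub>R ?e)) (at t within {-1..1})" for t x
      using pd has_pd_along_line has_field_derivative_at_within by blast
    show "(\<lambda>x. f (x + t *\<^sub>R ?e)) integrable_on cbox (- a) a" for t
      by (intro integrable_continuous continuous_intros continuous_on_compose2[OF cf]) auto
    show "continuous_on ({- 1..1} \<times> cbox (- a) a) (\<lambda>(t, x). f' (x + t *\<^sub>R ?e))"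
      by (auto simp: split_beta intro!: continuous_intros continuous_on_compose2[OF cf'])
  qed auto
  then have "(F has_field_derivative integral (cbox (- a) a) f') (at 0 within {-1..1})" by simp
  moreover have "(F has_field_derivative 0) (at 0 within {-1..1})"
    using has_field_derivative_transform_within[OF DERIV_const[of "integral\<^sup>L lborel f"] zero_less_one, of 0 "{-1..1}" F]
      const by auto
  moreover have "at (0::real) within {-1..1} = at 0" by (rule at_within_interior) simp
  ultimately have "integral (cbox (- a) a) f' = 0" using DERIV_unique by metis
  moreover have "integral\<^sup>L lborel f' = integral (cbox (- a) a) f'"
    using out(2)[of _ 0] by (intro integral_compact_support) (auto intro: continuous_on_subset[OF cf'])
  ultimately show ?thesis by simp
qed

text \<open>Nothing is known about \<open>f\<close> outside \<open>S\<close>, but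
  \<open>\<phi>\<close> vanishes off a compact subset of \<open>S\<close>. The product therefore has
  a continuous partial derivative on the whole space, and the integral of that derivative is
  zero.\<close>

lemma
  fixes \<phi> \<phi>' f f' :: "real^'n \<Rightarrow> real"
  assumes S: "open S" "compact K" "K \<subseteq> S"
    and \<phi>: "continuous_on S \<phi>" "continuous_on S \<phi>'" "\<And>x. x \<in> S \<Longrightarrow> has_pd i \<phi> (\<phi>' x) x"
      "\<And>x. x \<notin> K \<Longrightarrow> \<phi> x = 0" "\<And>x. x \<notin> K \<Longrightarrow> \<phi>' x = 0"
    and f: "continuous_on S f" "continuous_on S f'" "\<And>x. x \<in> S \<Longrightarrow> has_pd i f (f' x) x"
  shows integral_by_parts: "(LINT x|lborel. \<phi> x * f' x) = - (LINT x|lborel. \<phi>' x * f x)"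
proof -
  have K: "closed K" using S compact_imp_closed by blast
  have c1: "continuous_on UNIV (\<lambda>x. \<phi> x * f x)" "continuous_on UNIV (\<lambda>x. \<phi>' x * f x)"
       "continuous_on UNIV (\<lambda>x. \<phi> x * f' x)"
    using \<phi> f by (simp_all add: continuous_on_zero_extension[OF S(1) K S(3)] continuous_on_mult)
  have i: "integrable lborel (\<lambda>x. \<phi>' x * f x)" "integrable lborel (\<lambda>x. \<phi> x * f' x)"
    using \<phi> c1 by (auto intro!: integrable_compact_support[OF S(2)] intro: continuous_on_subset)
  have "(LINT x|lborel. \<phi>' x * f x + \<phi> x * f' x) = 0"
  proof (rule integral_has_pd_eq_0[OF c1(1) _ _ S(2)])
    show "continuous_on UNIV (\<lambda>x. \<phi>' x * f x + \<phi> x * f' x)" using c1 by (intro continuous_on_add)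
    show "has_pd i (\<lambda>x. \<phi> x * f x) (\<phi>' x * f x + \<phi> x * f' x) x" for x
    proof (cases "x \<in> S")
      case False
      then have x: "x \<notin> K" using S(3) by auto
      then have "has_pd i (\<lambda>x. \<phi> x * f x) 0 x" using \<phi>(4) by (intro has_pd_vanishing[OF K]) auto
      then show ?thesis using \<phi>(4,5)[OF x] by simp
    qed (rule has_pd_mult[OF \<phi>(3) f(3)])
  qed (use \<phi> in auto)
  then show ?thesis using i by simp
qed

section \<open>Symmetry of mixed partial derivatives\<close>

lemma mixed_difference_quotient:
  fixes f fi fij :: "real^'n \<Rightarrow> real"
  assumes pi: "\<And>y. y \<in> ball x r \<Longrightarrow> has_pd i f (fi y) y"
    and pij: "\<And>y. y \<in> ball x r \<Longrightarrow> has_pd j fi (fij y) y" and h: "0 < h" "3 * h \<le> r"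
  shows "\<exists>y\<in>ball x r. f (x + h *\<^sub>R axis i 1 + h *\<^sub>R axis j 1) - f (x + h *\<^sub>R axis i 1)
            - f (x + h *\<^sub>R axis j 1) + f x = h * h * fij y"
proof -
  let ?e = "axis i 1 :: real^'n" and ?k = "axis j 1 :: real^'n"
  have inb: "x + s *\<^sub>R ?e + t *\<^sub>R ?k \<in> ball x r" if "0 \<le> s" "s \<le> h" "0 \<le> t" "t \<le> h" for s t
  proof -
    have "norm (s *\<^sub>R ?e + t *\<^sub>R ?k) \<le> norm (s *\<^sub>R ?e) + norm (t *\<^sub>R ?k)" by (rule norm_triangle_ineq)
    also have "\<dots> = s + t" using that by (simp add: norm_axis_1)
    also have "\<dots> < r" using that h by linarith
    finally show ?thesis by (metis add.assoc dist_add_cancel2 dist_0_norm dist_commute mem_ball add.right_neutral dist_norm add_diff_cancel_left')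
  qed
  have d1: "((\<lambda>s. f (x + t *\<^sub>R ?k + s *\<^sub>R ?e)) has_real_derivative fi (x + t *\<^sub>R ?k + s *\<^sub>R ?e)) (at s)"
    if "0 \<le> s" "s \<le> h" "0 \<le> t" "t \<le> h" for s t
    using pi[OF inb[OF that]] has_pd_along_line[of i f "fi (x + t *\<^sub>R ?k + s *\<^sub>R ?e)" "x + t *\<^sub>R ?k" s]
    by (simp add: add_ac)
  \<comment> \<open>The mean value theorem in direction \<open>i\<close>, for the difference of
    \<open>f\<close> in direction \<open>j\<close>; it is applied once more below, to
    \<open>fi\<close> in direction \<open>j\<close>.\<close>
  have "\<exists>s>0. s < h \<and> (f (x + h *\<^sub>R ?k + h *\<^sub>R ?e) - f (x + 0 *\<^sub>R ?k + h *\<^sub>R ?e))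
       - (f (x + h *\<^sub>R ?k + 0 *\<^sub>R ?e) - f (x + 0 *\<^sub>R ?k + 0 *\<^sub>R ?e))
     = (h - 0) * (fi (x + h *\<^sub>R ?k + s *\<^sub>R ?e) - fi (x + 0 *\<^sub>R ?k + s *\<^sub>R ?e))"
    using h by (intro MVT2 DERIV_diff d1) auto
  then obtain s where s: "0 < s" "s < h"
    and 1: "f (x + h *\<^sub>R ?e + h *\<^sub>R ?k) - f (x + h *\<^sub>R ?e) - f (x + h *\<^sub>R ?k) + f x
         = h * (fi (x + s *\<^sub>R ?e + h *\<^sub>R ?k) - fi (x + s *\<^sub>R ?e + 0 *\<^sub>R ?k))"
    by (auto simp: algebra_simps)
  have "\<exists>t>0. t < h \<and> fi (x + s *\<^sub>R ?e + h *\<^sub>R ?k) - fi (x + s *\<^sub>R ?e + 0 *\<^sub>R ?k)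
     = (h - 0) * fij (x + s *\<^sub>R ?e + t *\<^sub>R ?k)"
    using h s by (intro MVT2 has_pd_along_line[THEN iffD1] pij inb) auto
  then obtain t where t: "0 < t" "t < h"
    and 2: "fi (x + s *\<^sub>R ?e + h *\<^sub>R ?k) - fi (x + s *\<^sub>R ?e + 0 *\<^sub>R ?k) = h * fij (x + s *\<^sub>R ?e + t *\<^sub>R ?k)"
    by auto
  show ?thesis using 1 2 inb[of s t] s t by (intro bexI[of _ "x + s *\<^sub>R ?e + t *\<^sub>R ?k"]) auto
qed

text \<open>The mixed second difference is symmetric in the two directions, so the two mixed
  derivatives agree when taken at suitable points near \<open>x\<close>; continuity at
  \<open>x\<close> concludes.\<close>

lemma mixed_pd_eq:
  fixes f fi fj fij fji :: "real^'n \<Rightarrow> real"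
  assumes S: "open S" "x \<in> S"
    and pi: "\<And>y. y \<in> S \<Longrightarrow> has_pd i f (fi y) y" and pj: "\<And>y. y \<in> S \<Longrightarrow> has_pd j f (fj y) y"
    and pij: "\<And>y. y \<in> S \<Longrightarrow> has_pd j fi (fij y) y" and pji: "\<And>y. y \<in> S \<Longrightarrow> has_pd i fj (fji y) y"
    and c: "continuous_on S fij" "continuous_on S fji"
  shows "fij x = fji x"
proof -
  have "\<bar>fij x - fji x\<bar> \<le> e" if e: "e > 0" for e
  proof -
    have "isCont fij x" "isCont fji x" using c S by (simp_all add: continuous_on_eq_continuous_at)
    moreover have "e/2 > 0" using e by simp
    ultimately obtain d1 d2 where d: "d1 > 0" "d2 > 0" "\<And>y. dist y x < d1 \<Longrightarrow> dist (fij y) (fij x) < e/2"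
      "\<And>y. dist y x < d2 \<Longrightarrow> dist (fji y) (fji x) < e/2"
      unfolding continuous_at_eps_delta by blast
    obtain d3 where d3: "d3 > 0" "ball x d3 \<subseteq> S" using S openE by blast
    define r where "r = min d1 (min d2 d3)"
    have r: "r > 0" "ball x r \<subseteq> S" using d d3 by (auto simp: r_def)
    have h: "0 < r/3" "3 * (r/3) \<le> r" using r by auto
    obtain y where y: "y \<in> ball x r" "f (x + (r/3) *\<^sub>R axis i 1 + (r/3) *\<^sub>R axis j 1) - f (x + (r/3) *\<^sub>R axis i 1)
            - f (x + (r/3) *\<^sub>R axis j 1) + f x = (r/3) * (r/3) * fij y"
      using mixed_difference_quotient[OF _ _ h, of x i f fi j fij] pi pij r(2) by blast
    obtain z where z: "z \<in> ball x r" "f (x + (r/3) *\<^sub>R axis j 1 + (r/3) *\<^sub>R axis i 1) - f (x + (r/3) *\<^sub>R axis j 1)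
            - f (x + (r/3) *\<^sub>R axis i 1) + f x = (r/3) * (r/3) * fji z"
      using mixed_difference_quotient[OF _ _ h, of x j f fj i fji] pj pji r(2) by blast
    have "f (x + (r/3) *\<^sub>R axis i 1 + (r/3) *\<^sub>R axis j 1) = f (x + (r/3) *\<^sub>R axis j 1 + (r/3) *\<^sub>R axis i 1)"
      by (simp add: add_ac)
    then have "(r/3) * (r/3) * fij y = (r/3) * (r/3) * fji z" using y(2) z(2) by linarith
    then have "fij y = fji z" using r(1) by simp
    moreover have "dist y x < d1" "dist z x < d2" using y(1) z(1) by (auto simp: r_def dist_commute)
    ultimately show ?thesis using d(3)[of y] d(4)[of z] unfolding dist_real_def by linarith
  qed
  from field_le_epsilon[of "\<bar>fij x - fji x\<bar>" 0] this show ?thesis by simp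
qed

section \<open>Mean value estimates\<close>

text \<open>Polynomial weights on the unit disc, instead of its indicator, avoid boundary integrals.
  The gradient of \<open>kernel3\<close> is \<open>-6 z kernel2\<close> and that of
  \<open>kernel2\<close> is \<open>-4 z kernel1\<close>, so integration by parts links the
  three.\<close>

definition kernel3 :: "real^2 \<Rightarrow> real" where "kernel3 z = (max 0 (1 - z \<bullet> z)) ^ 3"
definition kernel2 :: "real^2 \<Rightarrow> real" where "kernel2 z = (max 0 (1 - z \<bullet> z)) ^ 2"
definition kernel1 :: "real^2 \<Rightarrow> real" where "kernel1 z = max 0 (1 - z \<bullet> z)"

lemma has_pd_kernel3: "has_pd i kernel3 (- 6 * z $ i * kernel2 z) z"
proof -
  have "has_pd i (\<lambda>z. 1 - z \<bullet> z) (0 - 2 * z $ i) z"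
    by (intro has_pd_diff has_pd_const has_pd_inner_self)
  from has_pd_chain[OF has_real_derivative_pos_part_power[of 1] this]
  show ?thesis by (simp add: kernel3_def[abs_def] kernel2_def numeral_3_eq_3 numeral_2_eq_2 algebra_simps)
qed

lemma has_pd_kernel2: "has_pd i kernel2 (- 4 * z $ i * kernel1 z) z"
proof -
  have "has_pd i (\<lambda>z. 1 - z \<bullet> z) (0 - 2 * z $ i) z"
    by (intro has_pd_diff has_pd_const has_pd_inner_self)
  from has_pd_chain[OF has_real_derivative_pos_part_power[of 0] this]
  show ?thesis by (simp add: kernel2_def[abs_def] kernel1_def numeral_2_eq_2 algebra_simps)
qed

lemma continuous_on_kernels [continuous_intros]:
  "continuous_on S kernel3" "continuous_on S kernel2" "continuous_on S kernel1"
  unfolding kernel3_def kernel2_def kernel1_def by (intro continuous_intros)+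

lemma kernel_eq_0:
  assumes "z \<notin> cball 0 1"
  shows "kernel3 z = 0" "kernel2 z = 0" "kernel1 z = 0"
proof -
  have "1 < norm z" using assms by simp
  then have "1 < (norm z)\<^sup>2" by simp
  then have "1 - z \<bullet> z < 0" by (simp add: power2_norm_eq_inner)
  then show "kernel3 z = 0" "kernel2 z = 0" "kernel1 z = 0"
    by (simp_all add: kernel3_def kernel2_def kernel1_def)
qed

lemma kernel_bounds: "0 \<le> kernel3 z" "0 \<le> kernel2 z" "kernel2 z \<le> 1" "0 \<le> kernel1 z" "kernel1 z \<le> 1"
  by (auto simp: kernel3_def kernel2_def kernel1_def intro!: power_le_one)

lemma kernel2_mass_pos: "0 < (LINT z|lborel. kernel2 z)"
proof -
  \<comment> \<open>On the disc of half radius \<open>kernel2\<close> is at least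
    \<open>(3/4)\<^sup>2\<close>, so the constant \<open>1/2\<close> lies below it there.\<close>
  have m: "(LINT z|lborel. indicator (cball (0::real^2) (1/2)) z *\<^sub>R (1/2::real)) \<le> (LINT z|lborel. kernel2 z)"
  proof (rule integral_mono)
    show "integrable lborel (\<lambda>z::real^2. indicator (cball 0 (1/2)) z *\<^sub>R (1/2::real))"
      by (intro borel_integrable_compact) auto
    show "integrable lborel kernel2"
      by (intro integrable_compact_support[of "cball 0 1"] continuous_intros kernel_eq_0) auto
    fix z :: "real^2"
    show "indicator (cball 0 (1/2)) z *\<^sub>R (1/2) \<le> kernel2 z"
    proof (cases "z \<in> cball 0 (1/2)")
      case True
      then have "(norm z)\<^sup>2 \<le> (1/2)\<^sup>2" by (intro power_mono) auto
      then have "z \<bullet> z \<le> 1/4" by (simp add: power2_norm_eq_inner power2_eq_square[of "1/2::real"])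
      then have "3/4 \<le> max 0 (1 - z \<bullet> z)" by simp
      then have "(3/4)\<^sup>2 \<le> kernel2 z" unfolding kernel2_def by (rule power_mono) simp
      then show ?thesis using True by (simp add: power2_eq_square)
    qed (simp add: kernel_bounds)
  qed
  have "0 < measure lborel (cball (0::real^2) (1/2))"
    using content_ball_pos[of "1/2" "0::real^2"] by (simp add: content_cball content_ball measure_completion)
  moreover have "measure lborel (cball (0::real^2) (1/2)) \<le> 2 * (LINT z|lborel. kernel2 z)" using m by simp
  ultimately show ?thesis by linarith
qed

text \<open>The radius \<open>2 d\<close> leaves room for the square circumscribed to the disc of radius \<open>d\<close>.\<close>

lemma cbox_image_subset:
  fixes x :: "real^2"
  assumes "cball x (2 * d) \<subseteq> S" "\<delta> \<in> {0..d}" "z \<in> cbox (- 1) 1"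
  shows "x + \<delta> *\<^sub>R z \<in> S"
proof -
  have "norm z \<le> (\<Sum>i\<in>UNIV. \<bar>z $ i\<bar>)" by (rule norm_le_l1_cart)
  also have "\<dots> \<le> (\<Sum>i\<in>(UNIV::2 set). 1)"
    using assms(3) by (intro sum_mono) (auto simp: mem_box_cart abs_le_iff neg_le_iff_le minus_le_iff)
  finally have "norm z \<le> 2" by simp
  then have "norm (\<delta> *\<^sub>R z) \<le> d * 2" using assms(2) by (auto intro!: mult_mono)
  then have "x + \<delta> *\<^sub>R z \<in> cball x (2 * d)" by (simp add: dist_norm)
  then show ?thesis using assms(1) by blast
qed

lemma not_in_cbox_kernel: "z \<notin> cbox (- 1) 1 \<Longrightarrow> z \<notin> cball (0::real^2) 1"
proof
  assume "z \<notin> cbox (- 1) 1" "z \<in> cball (0::real^2) 1"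
  then obtain i where "\<not> (- 1 \<le> z $ i \<and> z $ i \<le> 1)" by (auto simp: mem_box_cart)
  then have "\<bar>z $ i\<bar> > 1" by linarith
  with component_le_norm_cart[of z i] \<open>z \<in> cball 0 1\<close> show False by simp
qed

text \<open>A smooth substitute for the mean over the disc of radius \<open>\<delta>\<close>, left
  unnormalised. In the rescaled variable the radius \<open>\<delta> = 0\<close> is allowed and
  returns \<open>f x\<close> times the mass of the kernel.\<close>

definition weighted_mean :: "(real^2 \<Rightarrow> real) \<Rightarrow> real^2 \<Rightarrow> real \<Rightarrow> real" where
  "weighted_mean f x \<delta> = (LINT z|lborel. f (x + \<delta> *\<^sub>R z) * kernel2 z)"

text \<open>The Leibniz rule is available for integrals over a box, whereas integration by parts and
  changes of variables use Lebesgue measure on the plane; these facts pass between the two.\<close>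

lemma
  fixes f :: "real^2 \<Rightarrow> real"
  assumes "cball x (2 * d) \<subseteq> S" "\<delta> \<in> {0..d}" and f: "continuous_on S f"
    and k: "continuous_on (cbox (-1) 1) k" "\<And>z. z \<notin> cball 0 1 \<Longrightarrow> k z = 0"
  shows integrable_dilated: "integrable lborel (\<lambda>z. f (x + \<delta> *\<^sub>R z) * k z)"
    and integral_dilated: "(LINT z|lborel. f (x + \<delta> *\<^sub>R z) * k z) = integral (cbox (-1) 1) (\<lambda>z. f (x + \<delta> *\<^sub>R z) * k z)"
    and continuous_on_dilated: "continuous_on (cbox (-1) 1) (\<lambda>z. f (x + \<delta> *\<^sub>R z) * k z)"
proof -
  show c: "continuous_on (cbox (-1) 1) (\<lambda>z. f (x + \<delta> *\<^sub>R z) * k z)"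
    using cbox_image_subset[OF assms(1,2)]
    by (intro continuous_intros k continuous_on_compose2[OF f]) auto
  show "integrable lborel (\<lambda>z. f (x + \<delta> *\<^sub>R z) * k z)"
     "(LINT z|lborel. f (x + \<delta> *\<^sub>R z) * k z) = integral (cbox (-1) 1) (\<lambda>z. f (x + \<delta> *\<^sub>R z) * k z)"
    by (rule integrable_compact_support[OF _ c] integral_compact_support[OF _ c];
        simp add: k(2)[OF not_in_cbox_kernel])+
qed

lemma weighted_mean_0: "weighted_mean f x 0 = f x * (LINT z|lborel. kernel2 z)"
  by (simp add: weighted_mean_def)

text \<open>The radial derivative of \<open>f\<close> produces the factor \<open>z\<close>, and \<open>z kernel2\<close> is a multiple of the
  gradient of \<open>kernel3\<close>: integrating by parts gives the Laplacian.\<close>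

lemma has_derivative_weighted_mean:
  fixes f :: "real^2 \<Rightarrow> real"
  assumes S: "open S" "cball x (2 * d) \<subseteq> S" "\<delta> \<in> {0..d}"
    and f: "\<And>y. y \<in> S \<Longrightarrow> (f has_derivative (\<lambda>v. \<Sum>i\<in>UNIV. v $ i * fg i y)) (at y)"
    and fg: "\<And>i. continuous_on S (fg i)"
    and fl: "\<And>i y. y \<in> S \<Longrightarrow> has_pd i (fg i) (fl i y) y" "\<And>i. continuous_on S (fl i)"
  shows "(weighted_mean f x has_real_derivative
      (\<delta> / 6) * (LINT z|lborel. (\<Sum>i\<in>UNIV. fl i (x + \<delta> *\<^sub>R z)) * kernel3 z)) (at \<delta> within {0..d})"
proof -
  have cf: "continuous_on S f" by (rule has_derivative_continuous_on) (rule has_derivative_at_withinI[OF f])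
  let ?D = "\<lambda>t z. (\<Sum>i\<in>UNIV. z $ i * fg i (x + t *\<^sub>R z)) * kernel2 z"
  have "((\<lambda>t. integral (cbox (-1) 1) (\<lambda>z. f (x + t *\<^sub>R z) * kernel2 z)) has_field_derivative
      integral (cbox (-1) 1) (?D \<delta>)) (at \<delta> within {0..d})"
  proof (rule leibniz_rule_field_derivative)
    fix t :: real and z :: "real^2" assume tz: "t \<in> {0..d}" "z \<in> cbox (-1) 1"
    have "((\<lambda>t. x + t *\<^sub>R z) has_derivative (\<lambda>s. s *\<^sub>R z)) (at t within {0..d})"
      by (auto intro!: derivative_eq_intros)
    note has_derivative_compose[OF this f[OF cbox_image_subset[OF S(2) tz]]]
    moreover have "(\<lambda>s. \<Sum>i\<in>UNIV. (s *\<^sub>R z) $ i * fg i (x + t *\<^sub>R z)) = (*) (\<Sum>i\<in>UNIV. z $ i * fg i (x + t *\<^sub>R z))"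
      by (auto simp: fun_eq_iff sum_distrib_right sum_distrib_left mult_ac)
    ultimately have "((\<lambda>t. f (x + t *\<^sub>R z)) has_real_derivative (\<Sum>i\<in>UNIV. z $ i * fg i (x + t *\<^sub>R z))) (at t within {0..d})"
      unfolding has_field_derivative_def by (rule subst[rotated])
    then show "((\<lambda>t. f (x + t *\<^sub>R z) * kernel2 z) has_real_derivative ?D t z) (at t within {0..d})"
      by (rule DERIV_cmult_right)
  next
    fix t assume "t \<in> {0..d}"
    then show "(\<lambda>z. f (x + t *\<^sub>R z) * kernel2 z) integrable_on cbox (-1) 1"
      using S(2) by (intro integrable_continuous continuous_on_dilated[OF _ _ cf] continuous_intros kernel_eq_0) auto
  next
    show "continuous_on ({0..d} \<times> cbox (-1) 1) (\<lambda>(t, z). ?D t z)"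
      unfolding split_beta using cbox_image_subset[OF S(2)]
      by (intro continuous_intros continuous_on_compose2[OF fg]
          continuous_on_compose2[OF continuous_on_kernels(2)[of UNIV]]) auto
  qed (use S(3) in auto)
  moreover have "integral (cbox (-1) 1) (?D \<delta>) = (\<delta> / 6) * (LINT z|lborel. (\<Sum>i\<in>UNIV. fl i (x + \<delta> *\<^sub>R z)) * kernel3 z)"
  proof -
    have ints: "integrable lborel (\<lambda>z. fg i (x + \<delta> *\<^sub>R z) * (z $ i * kernel2 z))"
        "integrable lborel (\<lambda>z. fl i (x + \<delta> *\<^sub>R z) * kernel3 z)" for i
      using kernel_eq_0 by (auto intro!: integrable_dilated[OF S(2,3)] fg fl continuous_intros)
    have parts: "(LINT z|lborel. kernel3 z * (\<delta> * fl i (x + \<delta> *\<^sub>R z)))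
        = - (LINT z|lborel. (- 6 * z $ i * kernel2 z) * fg i (x + \<delta> *\<^sub>R z))" for i
    proof (rule integral_by_parts)
      let ?S = "(\<lambda>z. x + \<delta> *\<^sub>R z) -` S"
      show "open ?S" by (intro open_vimage S continuous_intros)
      show "compact (cball (0::real^2) 1)" by simp
      show "cball 0 1 \<subseteq> ?S"
        using cbox_image_subset[OF S(2,3)] not_in_cbox_kernel by blast
      show "continuous_on ?S kernel3" "continuous_on ?S (\<lambda>z. - 6 * z $ i * kernel2 z)"
        by (intro continuous_intros)+
      show "continuous_on ?S (\<lambda>z. fg i (x + \<delta> *\<^sub>R z))" "continuous_on ?S (\<lambda>z. \<delta> * fl i (x + \<delta> *\<^sub>R z))"
        by (auto intro!: continuous_intros continuous_on_compose2[OF fg] continuous_on_compose2[OF fl(2)])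
      show "has_pd i (\<lambda>z. fg i (x + \<delta> *\<^sub>R z)) (\<delta> * fl i (x + \<delta> *\<^sub>R z)) z" if "z \<in> ?S" for z
        using that by (intro has_pd_affine fl) auto
    qed (use has_pd_kernel3 kernel_eq_0 in auto)
    have "integral (cbox (-1) 1) (?D \<delta>) = (LINT z|lborel. ?D \<delta> z)"
    proof (rule integral_compact_support[symmetric])
      show "continuous_on (cbox (-1) 1) (?D \<delta>)"
        using cbox_image_subset[OF S(2,3)]
        by (intro continuous_intros continuous_on_compose2[OF fg]) auto
    qed (use not_in_cbox_kernel kernel_eq_0 in auto)
    also have "\<dots> = (LINT z|lborel. (\<Sum>i\<in>UNIV. fg i (x + \<delta> *\<^sub>R z) * (z $ i * kernel2 z)))"
      by (simp add: sum_distrib_right sum_distrib_left mult_ac)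
    also have "\<dots> = (\<Sum>i\<in>UNIV. LINT z|lborel. fg i (x + \<delta> *\<^sub>R z) * (z $ i * kernel2 z))"
      using ints by (intro Bochner_Integration.integral_sum)
    also have "\<dots> = (\<Sum>i\<in>UNIV. (\<delta> / 6) * (LINT z|lborel. fl i (x + \<delta> *\<^sub>R z) * kernel3 z))"
    proof (rule sum.cong[OF refl])
      fix i :: 2
      have a: "(LINT z|lborel. kernel3 z * (\<delta> * fl i (x + \<delta> *\<^sub>R z))) = \<delta> * (LINT z|lborel. fl i (x + \<delta> *\<^sub>R z) * kernel3 z)"
        by (subst integral_mult_right_zero[symmetric]) (simp add: mult_ac)
      have b: "(LINT z|lborel. (- 6 * z $ i * kernel2 z) * fg i (x + \<delta> *\<^sub>R z))
         = - 6 * (LINT z|lborel. fg i (x + \<delta> *\<^sub>R z) * (z $ i * kernel2 z))"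
        by (subst integral_mult_right_zero[symmetric]) (simp add: mult_ac)
      show "(LINT z|lborel. fg i (x + \<delta> *\<^sub>R z) * (z $ i * kernel2 z))
          = (\<delta> / 6) * (LINT z|lborel. fl i (x + \<delta> *\<^sub>R z) * kernel3 z)"
        using parts[of i] unfolding a b by simp
    qed
    also have "\<dots> = (\<delta> / 6) * (\<Sum>i\<in>UNIV. LINT z|lborel. fl i (x + \<delta> *\<^sub>R z) * kernel3 z)"
      by (rule sum_distrib_left[symmetric])
    also have "(\<Sum>i\<in>UNIV. LINT z|lborel. fl i (x + \<delta> *\<^sub>R z) * kernel3 z)
        = (LINT z|lborel. (\<Sum>i\<in>UNIV. fl i (x + \<delta> *\<^sub>R z)) * kernel3 z)"
      using ints by (subst Bochner_Integration.integral_sum[symmetric]) (auto simp: sum_distrib_right)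
    finally show ?thesis .
  qed
  ultimately have "((\<lambda>t. integral (cbox (-1) 1) (\<lambda>z. f (x + t *\<^sub>R z) * kernel2 z)) has_field_derivative
      (\<delta> / 6) * (LINT z|lborel. (\<Sum>i\<in>UNIV. fl i (x + \<delta> *\<^sub>R z)) * kernel3 z)) (at \<delta> within {0..d})"
    by simp
  moreover have "integral (cbox (-1) 1) (\<lambda>z. f (x + t *\<^sub>R z) * kernel2 z) = weighted_mean f x t" if "t \<in> {0..d}" for t
    unfolding weighted_mean_def using that
    by (intro integral_dilated[OF S(2) _ cf, symmetric] continuous_intros kernel_eq_0) auto
  ultimately show ?thesis
    by (rule has_field_derivative_transform_within[OF _ zero_less_one S(3)])
qed

text \<open>By \<open>has_derivative_weighted_mean\<close> the derivative in the radius is a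
  nonnegative multiple of the Laplacian integrated against the nonnegative \<open>kernel3\<close>,
  so the mean does not fall below its value at radius zero.\<close>

lemma subharmonic_mean_value:
  fixes f :: "real^2 \<Rightarrow> real"
  assumes S: "open S" "cball x (2 * d) \<subseteq> S" "0 \<le> d"
    and f: "\<And>y. y \<in> S \<Longrightarrow> (f has_derivative (\<lambda>v. \<Sum>i\<in>UNIV. v $ i * fg i y)) (at y)"
    and fg: "\<And>i. continuous_on S (fg i)"
    and fl: "\<And>i y. y \<in> S \<Longrightarrow> has_pd i (fg i) (fl i y) y" "\<And>i. continuous_on S (fl i)"
    and sub: "\<And>y. y \<in> S \<Longrightarrow> 0 \<le> (\<Sum>i\<in>UNIV. fl i y)"
  shows "f x * (LINT z|lborel. kernel2 z) \<le> weighted_mean f x d"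
proof -
  have "weighted_mean f x 0 \<le> weighted_mean f x d"
  proof (rule DERIV_nonneg_imp_increasing_open[OF S(3)])
    show "\<exists>y. (weighted_mean f x has_real_derivative y) (at t) \<and> 0 \<le> y" if t: "0 < t" "t < d" for t
    proof -
      have td: "t \<in> {0..d}" using t by simp
      let ?D = "(t / 6) * (LINT z|lborel. (\<Sum>i\<in>UNIV. fl i (x + t *\<^sub>R z)) * kernel3 z)"
      have "at t within {0..d} = at t" using t by (intro at_within_interior) simp
      then have D: "(weighted_mean f x has_real_derivative ?D) (at t)"
        using has_derivative_weighted_mean[OF S(1,2) td f fg fl] by simp
      have "0 \<le> (\<Sum>i\<in>UNIV. fl i (x + t *\<^sub>R z)) * kernel3 z" for z
        using sub[OF cbox_image_subset[OF S(2) td]] not_in_cbox_kernel[of z] kernel_eq_0[of z] kernel_bounds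
        by (cases "z \<in> cbox (-1) 1") (auto intro!: mult_nonneg_nonneg)
      then have "0 \<le> (LINT z|lborel. (\<Sum>i\<in>UNIV. fl i (x + t *\<^sub>R z)) * kernel3 z)"
        by (rule Bochner_Integration.integral_nonneg)
      then have "0 \<le> ?D" using t by simp
      with D show ?thesis by blast
    qed
    show "continuous_on {0..d} (weighted_mean f x)"
    proof (rule DERIV_continuous_on)
      fix t assume t: "t \<in> {0..d}"
      show "(weighted_mean f x has_real_derivative
          (t / 6) * (LINT z|lborel. (\<Sum>i\<in>UNIV. fl i (x + t *\<^sub>R z)) * kernel3 z)) (at t within {0..d})"
        by (rule has_derivative_weighted_mean[OF S(1,2) t f fg fl])
    qed
  qed
  then show ?thesis by (simp add: weighted_mean_0)
qed

text \<open>Applied with \<open>f\<close> a partial derivative of \<open>u\<close> and \<open>q\<close> the Laplacian of \<open>u\<close>: both the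
  mean and its derivative lose the derivative in direction \<open>j\<close> by integration by parts.\<close>

lemma gradient_mean_value:
  fixes f u q :: "real^2 \<Rightarrow> real"
  assumes S: "open S" "cball x (2 * d) \<subseteq> S" "0 < d"
    and f: "\<And>y. y \<in> S \<Longrightarrow> (f has_derivative (\<lambda>v. \<Sum>i\<in>UNIV. v $ i * fg i y)) (at y)"
    and fg: "\<And>i. continuous_on S (fg i)"
    and fl: "\<And>i y. y \<in> S \<Longrightarrow> has_pd i (fg i) (fl i y) y" "\<And>i. continuous_on S (fl i)"
    and u: "continuous_on S u" "\<And>y. y \<in> S \<Longrightarrow> has_pd j u (f y) y" "\<And>y. y \<in> S \<Longrightarrow> \<bar>u y\<bar> \<le> B"
    and q: "continuous_on S q" "\<And>y. y \<in> S \<Longrightarrow> has_pd j q (\<Sum>i\<in>UNIV. fl i y) y" "\<And>y. y \<in> S \<Longrightarrow> \<bar>q y\<bar> \<le> Q"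
  shows "\<bar>f x\<bar> * (LINT z|lborel. kernel2 z) \<le> 16 * (B / d + d * Q)"
proof -
  have cf: "continuous_on S f" by (rule has_derivative_continuous_on) (rule has_derivative_at_withinI[OF f])
  \<comment> \<open>The factor 4 is the area of the square \<open>cbox (-1) 1\<close> containing the
    unit disc.\<close>
  have bound: "\<bar>LINT z|lborel. g (x + t *\<^sub>R z) * k z\<bar> \<le> 4 * (A * C)"
    if t: "t \<in> {0..d}" and g: "continuous_on S g" "\<And>y. y \<in> S \<Longrightarrow> \<bar>g y\<bar> \<le> A"
      and k: "continuous_on (cbox (-1) 1) k" "\<And>z. z \<notin> cball 0 1 \<Longrightarrow> k z = 0" "\<And>z. \<bar>k z\<bar> \<le> C"
    for t A C :: real and g k :: "real^2 \<Rightarrow> real"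
  proof -
    have "norm (integral (cbox (-1) 1) (\<lambda>z. g (x + t *\<^sub>R z) * k z)) \<le> (A * C) * measure lborel (cbox (-1) (1::real^2))"
    proof (rule has_integral_bound)
      show "norm (g (x + t *\<^sub>R z) * k z) \<le> A * C" if "z \<in> cbox (-1) 1" for z
        using g(2)[OF cbox_image_subset[OF S(2) t that]] k(3)[of z] by (simp add: abs_mult mult_mono')
      have "x \<in> S" using S(2,3) by force
      then show "0 \<le> A * C" using g(2)[of x] k(3)[of 0] by (intro mult_nonneg_nonneg) linarith+
      show "((\<lambda>z. g (x + t *\<^sub>R z) * k z) has_integral
          integral (cbox (-1) 1) (\<lambda>z. g (x + t *\<^sub>R z) * k z)) (cbox (-1) 1)"
        by (intro integrable_integral integrable_continuous continuous_on_dilated[OF S(2) t g(1) k(1,2)])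
    qed
    also have "measure lborel (cbox (-1) (1::real^2)) = 4" by (subst content_cbox_cart) (auto simp: interval_eq_empty_cart UNIV_2)
    finally show ?thesis using integral_dilated[OF S(2) t g(1) k(1,2)] by simp
  qed
  have parts: "(LINT z|lborel. k z * (t * D (x + t *\<^sub>R z))) = - (LINT z|lborel. k' z * g (x + t *\<^sub>R z))"
    if t: "t \<in> {0..d}" and g: "continuous_on S g" "continuous_on S D" "\<And>y. y \<in> S \<Longrightarrow> has_pd j g (D y) y"
      and k: "continuous_on UNIV k" "continuous_on UNIV k'" "\<And>z. has_pd j k (k' z) z"
        "\<And>z. z \<notin> cball 0 1 \<Longrightarrow> k z = 0" "\<And>z. z \<notin> cball 0 1 \<Longrightarrow> k' z = 0" for t g D k k'
  proof (rule integral_by_parts)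
    let ?S = "(\<lambda>z. x + t *\<^sub>R z) -` S"
    show "open ?S" by (intro open_vimage S continuous_intros)
    show "compact (cball (0::real^2) 1)" by simp
    show "cball 0 1 \<subseteq> ?S" using cbox_image_subset[OF S(2) t] not_in_cbox_kernel by blast
    show "continuous_on ?S k" "continuous_on ?S k'" using k continuous_on_subset by blast+
    show "continuous_on ?S (\<lambda>z. g (x + t *\<^sub>R z))" "continuous_on ?S (\<lambda>z. t * D (x + t *\<^sub>R z))"
      by (auto intro!: continuous_intros continuous_on_compose2[OF g(1)] continuous_on_compose2[OF g(2)])
    show "has_pd j (\<lambda>z. g (x + t *\<^sub>R z)) (t * D (x + t *\<^sub>R z)) z" if "z \<in> ?S" for z
      using that by (intro has_pd_affine g) auto
  qed (use k in auto)
  have comp: "\<bar>z $ j * kernel1 z\<bar> \<le> 1" "\<bar>z $ j * kernel2 z\<bar> \<le> 1" for z :: "real^2"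
  proof -
    have "\<bar>z $ j\<bar> \<le> 1" if "z \<in> cball 0 1" using component_le_norm_cart[of z j] that by simp
    then show "\<bar>z $ j * kernel1 z\<bar> \<le> 1" "\<bar>z $ j * kernel2 z\<bar> \<le> 1"
      using kernel_bounds[of z] kernel_eq_0[of z]
      by (cases "z \<in> cball 0 1"; simp add: abs_mult mult_le_one)+
  qed
  have d: "d \<in> {0..d}" using S(3) by simp
  \<comment> \<open>By the chain rule \<open>d * f\<close> is the derivative of \<open>u\<close> in
    the rescaled variable, so integration by parts moves it onto \<open>kernel2\<close>.\<close>
  have "d * weighted_mean f x d = (LINT z|lborel. kernel2 z * (d * f (x + d *\<^sub>R z)))"
    unfolding weighted_mean_def by (subst integral_mult_right_zero[symmetric]) (simp add: mult_ac)
  also have "\<dots> = - (LINT z|lborel. (- 4 * z $ j * kernel1 z) * u (x + d *\<^sub>R z))"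
    by (rule parts[OF d u(1) cf u(2) _ _ has_pd_kernel2]) (auto intro!: continuous_intros simp: kernel_eq_0)
  also have "\<dots> = (LINT z|lborel. u (x + d *\<^sub>R z) * (4 * (z $ j * kernel1 z)))"
    by (subst Bochner_Integration.integral_minus[symmetric]) (simp add: mult_ac)
  also have "\<bar>\<dots>\<bar> \<le> 4 * (B * 4)"
    by (rule bound[OF d u(1,3)]) (use comp in \<open>auto intro!: continuous_intros simp: kernel_eq_0 abs_mult\<close>)
  finally have "\<bar>d * weighted_mean f x d\<bar> \<le> 16 * B" by simp
  then have at_d: "\<bar>weighted_mean f x d\<bar> \<le> 16 * B / d" using S(3) by (simp add: abs_mult field_simps)
  have deriv: "(weighted_mean f x has_real_derivative (LINT z|lborel. q (x + t *\<^sub>R z) * (z $ j * kernel2 z))) (at t within {0..d})"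
    if t: "t \<in> {0..d}" for t
  proof -
    have "(t / 6) * (LINT z|lborel. (\<Sum>i\<in>UNIV. fl i (x + t *\<^sub>R z)) * kernel3 z)
       = (1 / 6) * (LINT z|lborel. kernel3 z * (t * (\<Sum>i\<in>UNIV. fl i (x + t *\<^sub>R z))))"
      by (subst (1 2) integral_mult_right_zero[symmetric]) (simp add: mult_ac)
    also have "\<dots> = (1 / 6) * - (LINT z|lborel. (- 6 * z $ j * kernel2 z) * q (x + t *\<^sub>R z))"
      by (subst parts[OF t q(1) _ q(2) _ _ has_pd_kernel3])
        (auto intro!: continuous_intros fl simp: kernel_eq_0)
    also have "\<dots> = (LINT z|lborel. q (x + t *\<^sub>R z) * (z $ j * kernel2 z))"
      by (subst Bochner_Integration.integral_minus[symmetric], subst integral_mult_right_zero[symmetric])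
        (simp add: mult_ac)
    finally show ?thesis using has_derivative_weighted_mean[OF S(1,2) t f fg fl] by (simp only:)
  qed
  \<comment> \<open>From radius zero to radius \<open>d\<close> the mean changes by at most
    \<open>4 * Q * d\<close>; the conclusion relaxes this to the common factor 16.\<close>
  have "norm (weighted_mean f x d - weighted_mean f x 0) \<le> (4 * (Q * 1)) * norm (d - 0)"
  proof (rule field_differentiable_bound[OF _ deriv])
    fix t assume "t \<in> {0..d}"
    then show "norm (LINT z|lborel. q (x + t *\<^sub>R z) * (z $ j * kernel2 z)) \<le> 4 * (Q * 1)"
      unfolding real_norm_def
      by (intro bound q) (use comp in \<open>auto intro!: continuous_intros simp: kernel_eq_0\<close>)
  qed (use S(3) in auto)
  then have "\<bar>weighted_mean f x 0\<bar> \<le> 16 * B / d + 4 * Q * d" using at_d S(3) by (simp add: abs_le_iff)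
  moreover have "0 \<le> Q * d" using q(3)[of x] S by (intro mult_nonneg_nonneg) force+
  ultimately show ?thesis using kernel2_mass_pos by (simp add: weighted_mean_0 abs_mult algebra_simps)
qed

section \<open>The elliptic system\<close>

lemma smooth_on_imp_differentiable: "smooth_on S f \<Longrightarrow> x \<in> S \<Longrightarrow> f differentiable (at x)"
  unfolding smooth_on_def by (metis Ck_on.simps(2))

lemma smooth_on_imp_continuous_on: "smooth_on S f \<Longrightarrow> continuous_on S f"
  unfolding smooth_on_def by (metis Ck_on.simps(1))

lemma smooth_on_partial_deriv:
  assumes "smooth_on S f" shows "smooth_on S (partial_deriv i f)"
  unfolding smooth_on_def
proof
  fix m
  have "Ck_on (Suc m) S f" using assms unfolding smooth_on_def by blast
  then show "Ck_on m S (partial_deriv i f)" unfolding partial_deriv_def[abs_def] by simp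
qed

lemma has_derivative_partial_deriv:
  fixes f :: "real^'n \<Rightarrow> 'b::real_normed_vector"
  assumes "f differentiable (at x)"
  shows "(f has_derivative (\<lambda>v. \<Sum>i\<in>UNIV. v $ i *\<^sub>R partial_deriv i f x)) (at x)"
proof -
  let ?D = "frechet_derivative f (at x)"
  have D: "(f has_derivative ?D) (at x)" using assms frechet_derivative_works by blast
  interpret linear ?D by (rule has_derivative_linear[OF D])
  have "?D v = (\<Sum>i\<in>UNIV. v $ i *\<^sub>R partial_deriv i f x)" for v
  proof -
    have "?D v = ?D (\<Sum>i\<in>UNIV. v $ i *\<^sub>R axis i 1)"
      using basis_expansion[of v] by (simp add: scalar_mult_eq_scaleR)
    then show ?thesis by (simp add: sum scale partial_deriv_def)
  qed
  then have "?D = (\<lambda>v. \<Sum>i\<in>UNIV. v $ i *\<^sub>R partial_deriv i f x)" by blast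
  with D show ?thesis by simp
qed

lemma has_derivative_component:
  fixes f :: "real^'n \<Rightarrow> real^'k"
  assumes "f differentiable (at x)"
  shows "((\<lambda>x. f x $ a) has_derivative (\<lambda>v. \<Sum>i\<in>UNIV. v $ i * partial_deriv i f x $ a)) (at x)"
  using bounded_linear.has_derivative[OF bounded_linear_vec_nth has_derivative_partial_deriv[OF assms], of a]
  by simp

lemma sum_axis_mult: "(\<Sum>i\<in>UNIV. axis j (1::real) $ i * c i) = c (j::'n::finite)"
  by (simp add: axis_def if_distrib[where f = "\<lambda>x. x * _"] cong: if_cong)

lemma has_pd_component:
  fixes f :: "real^'n \<Rightarrow> real^'k"
  assumes "f differentiable (at x)"
  shows "has_pd i (\<lambda>x. f x $ a) (partial_deriv i f x $ a) x"
  using has_derivative_imp_has_pd[OF has_derivative_component[OF assms], of i a] by (simp only: sum_axis_mult)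

lemma has_pd_inner:
  fixes f g :: "real^'n \<Rightarrow> real^'k"
  assumes "f differentiable (at x)" "g differentiable (at x)"
  shows "has_pd i (\<lambda>x. f x \<bullet> g x) (partial_deriv i f x \<bullet> g x + f x \<bullet> partial_deriv i g x) x"
  unfolding inner_vec_def sum.distrib[symmetric] inner_real_def
  by (intro has_pd_sum has_pd_mult has_pd_component assms)

lemma has_pd_compose:
  fixes F :: "real^'k \<Rightarrow> real" and f :: "real^'n \<Rightarrow> real^'k"
  assumes F: "F differentiable (at (f x))" and f: "f differentiable (at x)"
  shows "has_pd i (\<lambda>x. F (f x)) (\<Sum>b\<in>UNIV. partial_deriv b F (f x) * partial_deriv i f x $ b) x"
proof -
  have "((\<lambda>x. F (f x)) has_derivative (\<lambda>v. \<Sum>b\<in>UNIV. (\<Sum>i\<in>UNIV. v $ i *\<^sub>R partial_deriv i f x) $ b *\<^sub>R partial_deriv b F (f x))) (at x)"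
    by (rule has_derivative_compose[OF has_derivative_partial_deriv[OF f] has_derivative_partial_deriv[OF F]])
  from has_derivative_imp_has_pd[OF this, of i] show ?thesis
    by (simp add: sum_axis_mult mult.commute)
qed

lemma partial_deriv_commute:
  fixes f :: "real^'n \<Rightarrow> real^'k"
  assumes f: "smooth_on S f" and S: "open S" "x \<in> S"
  shows "partial_deriv i (partial_deriv j f) x = partial_deriv j (partial_deriv i f) x"
proof (rule vec_eq_iff[THEN iffD2], rule allI)
  fix a
  note sm = smooth_on_partial_deriv[OF f] smooth_on_partial_deriv[OF smooth_on_partial_deriv[OF f]]
  show "partial_deriv i (partial_deriv j f) x $ a = partial_deriv j (partial_deriv i f) x $ a"
  proof (rule mixed_pd_eq[OF S])
    show "has_pd j (\<lambda>x. f x $ a) (partial_deriv j f y $ a) y" if "y \<in> S" for y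
      by (intro has_pd_component smooth_on_imp_differentiable[OF f that])
    show "has_pd i (\<lambda>x. f x $ a) (partial_deriv i f y $ a) y" if "y \<in> S" for y
      by (intro has_pd_component smooth_on_imp_differentiable[OF f that])
    show "has_pd i (\<lambda>x. partial_deriv j f x $ a) (partial_deriv i (partial_deriv j f) y $ a) y" if "y \<in> S" for y
      by (intro has_pd_component smooth_on_imp_differentiable[OF sm(1) that])
    show "has_pd j (\<lambda>x. partial_deriv i f x $ a) (partial_deriv j (partial_deriv i f) y $ a) y" if "y \<in> S" for y
      by (intro has_pd_component smooth_on_imp_differentiable[OF sm(1) that])
  qed (intro continuous_intros smooth_on_imp_continuous_on sm)+
qed

text \<open>Direction \<open>j\<close> is moved past the two directions \<open>i\<close> one at a
  time. One of the exchanges happens under a further derivative, which is legitimate because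
  symmetry holds on all of the open set \<open>S\<close>.\<close>

lemma laplacian_partial_deriv_commute:
  fixes f :: "real^'n \<Rightarrow> real^'k"
  assumes f: "smooth_on S f" and S: "open S" "x \<in> S"
  shows "has_pd j (\<lambda>x. laplacian f x $ a) (laplacian (partial_deriv j f) x $ a) x"
proof -
  note sm = smooth_on_partial_deriv[OF f] smooth_on_partial_deriv[OF smooth_on_partial_deriv[OF f]]
  have "has_pd j (\<lambda>x. laplacian f x $ a) (\<Sum>i\<in>UNIV. partial_deriv j (partial_deriv i (partial_deriv i f)) x $ a) x"
    unfolding laplacian_def sum_component
    by (intro has_pd_sum has_pd_component smooth_on_imp_differentiable[OF sm(2)] S)
  moreover have "partial_deriv j (partial_deriv i (partial_deriv i f)) x $ a = partial_deriv i (partial_deriv i (partial_deriv j f)) x $ a" for i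
  proof (rule has_pd_unique)
    have "has_pd i (\<lambda>x. partial_deriv j (partial_deriv i f) x $ a) (partial_deriv i (partial_deriv j (partial_deriv i f)) x $ a) x"
      by (intro has_pd_component smooth_on_imp_differentiable[OF sm(2)] S)
    moreover have "partial_deriv i (partial_deriv j (partial_deriv i f)) x = partial_deriv j (partial_deriv i (partial_deriv i f)) x"
      by (rule partial_deriv_commute[OF smooth_on_partial_deriv[OF f] S])
    ultimately have "has_pd i (\<lambda>x. partial_deriv j (partial_deriv i f) x $ a) (partial_deriv j (partial_deriv i (partial_deriv i f)) x $ a) x"
      by simp
    then show "has_pd i (\<lambda>x. partial_deriv i (partial_deriv j f) x $ a) (partial_deriv j (partial_deriv i (partial_deriv i f)) x $ a) x"
    proof (rule has_pd_cong[OF S, rotated])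
      show "partial_deriv j (partial_deriv i f) y $ a = partial_deriv i (partial_deriv j f) y $ a" if "y \<in> S" for y
        by (simp only: partial_deriv_commute[OF f S(1) that, of j i])
    qed
    show "has_pd i (\<lambda>x. partial_deriv i (partial_deriv j f) x $ a) (partial_deriv i (partial_deriv i (partial_deriv j f)) x $ a) x"
      by (intro has_pd_component smooth_on_imp_differentiable[OF sm(2)] S)
  qed
  ultimately show ?thesis by (simp add: laplacian_def sum_component)
qed

section \<open>A single solution: energy, stress-energy tensor and integral identities\<close>

locale allen_cahn =
  fixes V :: "real^'k \<Rightarrow> real" and \<Omega> :: "(real^2) set" and \<epsilon> :: real and u :: "real^2 \<Rightarrow> real^'k"
  assumes open_domain: "open \<Omega>" and eps_pos: "0 < \<epsilon>"
    and smooth_V: "smooth_on UNIV V" and V_nonneg: "0 \<le> V y" and smooth_u: "smooth_on \<Omega> u"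
    and equation: "x \<in> \<Omega> \<Longrightarrow> laplacian u x = (1 / \<epsilon>\<^sup>2) *\<^sub>R gradient V (u x)"
begin

abbreviation e :: "real^2 \<Rightarrow> real" where "e \<equiv> energy_density V \<epsilon> u"
abbreviation p :: "2 \<Rightarrow> real^2 \<Rightarrow> real^'k" where "p i \<equiv> partial_deriv i u"
abbreviation h :: "2 \<Rightarrow> 2 \<Rightarrow> real^2 \<Rightarrow> real^'k" where "h i j \<equiv> partial_deriv i (partial_deriv j u)"

lemma differentiable:
  assumes "x \<in> \<Omega>"
  shows "u differentiable (at x)" "p i differentiable (at x)" "h i j differentiable (at x)"
  using smooth_on_imp_differentiable[OF _ assms] smooth_u smooth_on_partial_deriv by blast+

lemma differentiable_V: "V differentiable (at y)" "partial_deriv b V differentiable (at y)"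
  using smooth_on_imp_differentiable[OF _ UNIV_I] smooth_V smooth_on_partial_deriv by blast+

lemma continuous:
  "continuous_on \<Omega> u" "continuous_on \<Omega> (p i)" "continuous_on \<Omega> (h i j)"
  by (intro smooth_on_imp_continuous_on smooth_on_partial_deriv smooth_u)+

lemma continuous_V:
  "continuous_on UNIV V" "continuous_on UNIV (partial_deriv b V)"
  "continuous_on UNIV (partial_deriv b (partial_deriv c V))"
  by (intro smooth_on_imp_continuous_on smooth_on_partial_deriv smooth_V)+

lemma continuous_comp:
  "continuous_on \<Omega> (\<lambda>x. V (u x))" "continuous_on \<Omega> (\<lambda>x. partial_deriv b V (u x))"
  "continuous_on \<Omega> (\<lambda>x. partial_deriv b (partial_deriv c V) (u x))" "continuous_on \<Omega> (\<lambda>x. gradient V (u x))"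
  unfolding gradient_def
  by (intro continuous_on_vec_lambda continuous_on_compose2[OF continuous_V(1)]
    continuous_on_compose2[OF continuous_V(2)] continuous_on_compose2[OF continuous_V(3)] continuous; simp)+

lemma energy_density_eq: "e x = \<epsilon> * (p 1 x \<bullet> p 1 x + p 2 x \<bullet> p 2 x) / 2 + V (u x) / \<epsilon>"
  by (simp add: energy_density_def sum_2 power2_norm_eq_inner)

lemma continuous_energy: "continuous_on \<Omega> e"
  unfolding energy_density_eq[abs_def] by (intro continuous_intros continuous continuous_comp) (use eps_pos in auto)

lemma energy_bounds:
  "0 \<le> e x" "V (u x) / \<epsilon> \<le> e x" "\<epsilon> * (norm (p i x))\<^sup>2 \<le> 2 * e x" "\<epsilon> * \<bar>p i x \<bullet> p j x\<bar> \<le> 2 * e x"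
proof -
  have V: "0 \<le> V (u x) / \<epsilon>" using V_nonneg eps_pos by simp
  have e: "e x = \<epsilon> * ((norm (p 1 x))\<^sup>2 + (norm (p 2 x))\<^sup>2) / 2 + V (u x) / \<epsilon>"
    by (simp add: energy_density_def sum_2)
  have sq: "0 \<le> \<epsilon> * (norm (p i x))\<^sup>2" for i using eps_pos by simp
  show "0 \<le> e x" "V (u x) / \<epsilon> \<le> e x"
    using V sq[of 1] sq[of 2] unfolding e distrib_left by simp_all
  have i: "\<epsilon> * (norm (p i x))\<^sup>2 \<le> 2 * e x" for i
  proof -
    have "\<epsilon> * (norm (p i x))\<^sup>2 \<le> \<epsilon> * (norm (p 1 x))\<^sup>2 + \<epsilon> * (norm (p 2 x))\<^sup>2"
      using sq[of 1] sq[of 2] exhaust_2[of i] by auto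
    moreover have "\<epsilon> * (norm (p 1 x))\<^sup>2 + \<epsilon> * (norm (p 2 x))\<^sup>2 = 2 * (e x - V (u x) / \<epsilon>)"
      unfolding e by (simp add: distrib_left)
    ultimately show ?thesis using V by (simp only: right_diff_distrib)
  qed
  then show "\<epsilon> * (norm (p i x))\<^sup>2 \<le> 2 * e x" .
  have "\<bar>p i x \<bullet> p j x\<bar> \<le> norm (p i x) * norm (p j x)" by (rule Cauchy_Schwarz_ineq2)
  also have "\<dots> \<le> ((norm (p i x))\<^sup>2 + (norm (p j x))\<^sup>2) / 2"
    using sum_squares_bound[of "norm (p i x)" "norm (p j x)"] by simp
  finally have "\<epsilon> * \<bar>p i x \<bullet> p j x\<bar> \<le> \<epsilon> * (((norm (p i x))\<^sup>2 + (norm (p j x))\<^sup>2) / 2)"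
    using eps_pos by (intro mult_left_mono) auto
  also have "\<dots> \<le> 2 * e x" using i[of i] i[of j] by (simp add: algebra_simps)
  finally show "\<epsilon> * \<bar>p i x \<bullet> p j x\<bar> \<le> 2 * e x" .
qed

lemma has_pd_V: "x \<in> \<Omega> \<Longrightarrow> has_pd i (\<lambda>x. V (u x)) (gradient V (u x) \<bullet> p i x) x"
  using has_pd_compose[OF differentiable_V(1) differentiable(1), of x i]
  by (simp add: gradient_def inner_vec_def)

lemma has_pd_energy:
  assumes "x \<in> \<Omega>"
  shows "has_pd i e (\<epsilon> * (p 1 x \<bullet> h i 1 x + p 2 x \<bullet> h i 2 x) + gradient V (u x) \<bullet> p i x / \<epsilon>) x"
proof -
  note d = differentiable[OF assms]
  have "has_pd i (\<lambda>x. (\<epsilon> / 2) * (p 1 x \<bullet> p 1 x + p 2 x \<bullet> p 2 x) + (1 / \<epsilon>) * V (u x))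
    ((\<epsilon> / 2) * ((h i 1 x \<bullet> p 1 x + p 1 x \<bullet> h i 1 x) + (h i 2 x \<bullet> p 2 x + p 2 x \<bullet> h i 2 x)) + (1 / \<epsilon>) * (gradient V (u x) \<bullet> p i x)) x"
    by (intro has_pd_add has_pd_cmult has_pd_inner has_pd_V assms d)
  moreover have "e = (\<lambda>x. (\<epsilon> / 2) * (p 1 x \<bullet> p 1 x + p 2 x \<bullet> p 2 x) + (1 / \<epsilon>) * V (u x))"
    by (simp add: energy_density_eq fun_eq_iff)
  ultimately show ?thesis by (simp add: inner_commute algebra_simps)
qed

text \<open>The divergence of the stress-energy tensor \<open>e \<delta>\<^sub>i\<^sub>j - \<epsilon> u\<^sub>i \<bullet> u\<^sub>j\<close> vanishes, so that of its
  product \<open>stress i\<close> with the position vector is the trace, which in dimension two is \<open>2 V / \<epsilon>\<close>.\<close>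

definition stress :: "2 \<Rightarrow> real^2 \<Rightarrow> real" where
  "stress i x = x $ i * e x - \<epsilon> * (\<Sum>j\<in>UNIV. x $ j * (p i x \<bullet> p j x))"

definition stress_pd :: "2 \<Rightarrow> real^2 \<Rightarrow> real" where
  "stress_pd i x = e x + x $ i * (\<epsilon> * (p 1 x \<bullet> h i 1 x + p 2 x \<bullet> h i 2 x) + gradient V (u x) \<bullet> p i x / \<epsilon>)
    - \<epsilon> * (\<Sum>j\<in>UNIV. (if i = j then 1 else 0) * (p i x \<bullet> p j x) + x $ j * (h i i x \<bullet> p j x + p i x \<bullet> h i j x))"

lemma has_pd_stress:
  assumes "x \<in> \<Omega>" shows "has_pd i (stress i) (stress_pd i x) x"
proof -
  have c: "has_pd i (\<lambda>x. x $ i) 1 x" using has_pd_coord[of i i x] by simp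
  have "has_pd i (\<lambda>x. x $ i * e x - \<epsilon> * (\<Sum>j\<in>UNIV. x $ j * (p i x \<bullet> p j x)))
    ((1 * e x + x $ i * (\<epsilon> * (p 1 x \<bullet> h i 1 x + p 2 x \<bullet> h i 2 x) + gradient V (u x) \<bullet> p i x / \<epsilon>))
    - \<epsilon> * (\<Sum>j\<in>UNIV. (if i = j then 1 else 0) * (p i x \<bullet> p j x) + x $ j * (h i i x \<bullet> p j x + p i x \<bullet> h i j x))) x"
    by (intro has_pd_diff has_pd_mult has_pd_cmult has_pd_sum has_pd_inner has_pd_energy has_pd_coord c
        differentiable assms)
  then show ?thesis by (simp add: stress_def[abs_def] stress_pd_def)
qed

lemma sum_stress_pd:
  assumes "x \<in> \<Omega>" shows "(\<Sum>i\<in>UNIV. stress_pd i x) = 2 * V (u x) / \<epsilon>"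
proof -
  have "h 1 1 x + h 2 2 x = (1 / \<epsilon>\<^sup>2) *\<^sub>R gradient V (u x)"
    using equation[OF assms] by (simp add: laplacian_def sum_2)
  then have "(h 1 1 x + h 2 2 x) \<bullet> v = (1 / \<epsilon>\<^sup>2) * (gradient V (u x) \<bullet> v)" for v by simp
  \<comment> \<open>The equation trades the gradient of \<open>V\<close> for the Laplacian of
    \<open>u\<close>; by symmetry of \<open>h\<close> all terms with second derivatives then
    cancel.\<close>
  then have G: "gradient V (u x) \<bullet> v / \<epsilon> = \<epsilon> * (h 1 1 x \<bullet> v + h 2 2 x \<bullet> v)" for v
    using eps_pos by (simp add: inner_add_left field_simps power2_eq_square)
  have s: "h 2 1 x = h 1 2 x" by (rule partial_deriv_commute[OF smooth_u open_domain assms])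
  show ?thesis
    unfolding stress_pd_def sum_2 G s energy_density_eq
    by (simp add: inner_commute algebra_simps diff_divide_distrib add_divide_distrib)
qed

lemma continuous_stress: "continuous_on \<Omega> (stress i)" "continuous_on \<Omega> (stress_pd i)"
  unfolding stress_def stress_pd_def
  by (intro continuous_intros continuous continuous_comp continuous_energy; use eps_pos in simp)+

text \<open>The first term contributes \<open>R * e x\<close>, and each of the two summands with
  inner products at most \<open>2 * R * e x\<close> by \<open>energy_bounds\<close>.\<close>

lemma abs_stress_le:
  assumes "\<And>j. \<bar>x $ j\<bar> \<le> R"
  shows "\<bar>stress i x\<bar> \<le> 5 * R * e x"
proof -
  have t: "\<bar>\<epsilon> * (x $ j * (p i x \<bullet> p j x))\<bar> \<le> R * (2 * e x)" for j
  proof -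
    have "\<bar>\<epsilon> * (x $ j * (p i x \<bullet> p j x))\<bar> = \<bar>x $ j\<bar> * (\<epsilon> * \<bar>p i x \<bullet> p j x\<bar>)"
      using eps_pos by (simp add: abs_mult)
    also have "\<dots> \<le> R * (2 * e x)"
      by (rule mult_mono[OF assms energy_bounds(4)]) (use assms[of j] eps_pos in auto)
    finally show ?thesis .
  qed
  have "\<bar>x $ i * e x\<bar> \<le> R * e x" using assms[of i] energy_bounds(1)[of x] by (simp add: abs_mult mult_right_mono)
  then show ?thesis using t[of 1] t[of 2] unfolding stress_def sum_2 distrib_left by linarith
qed

text \<open>The divergence identity for \<open>stress\<close> is integrated against
  \<open>\<phi>\<close>. The derivative falls on the cutoff, so the right-hand side sees the energy
  only where some derivative of \<open>\<phi>\<close> is nonzero.\<close>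

lemma pohozaev:
  assumes K: "compact K" "K \<subseteq> \<Omega>"
    and \<phi>: "continuous_on UNIV \<phi>" "\<And>i. continuous_on UNIV (\<phi>' i)" "\<And>i x. has_pd i \<phi> (\<phi>' i x) x"
      "\<And>x. x \<notin> K \<Longrightarrow> \<phi> x = 0" "\<And>i x. x \<notin> K \<Longrightarrow> \<phi>' i x = 0"
    and R: "\<And>x j. x \<in> K \<Longrightarrow> \<bar>x $ j\<bar> \<le> R"
  shows "2 * (LINT x|lborel. \<phi> x * (V (u x) / \<epsilon>)) \<le> 5 * R * (LINT x|lborel. (\<Sum>i\<in>UNIV. \<bar>\<phi>' i x\<bar>) * e x)"
proof -
  have sub: "continuous_on K g" if "continuous_on \<Omega> g" for g :: "real^2 \<Rightarrow> real"
    using that K(2) by (rule continuous_on_subset)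
  have subU: "continuous_on K g" if "continuous_on UNIV g" for g :: "real^2 \<Rightarrow> real"
    using that by (rule continuous_on_subset) simp
  have ints: "integrable lborel (\<lambda>x. \<phi> x * stress_pd i x)" "integrable lborel (\<lambda>x. \<phi>' i x * stress i x)"
     "integrable lborel (\<lambda>x. \<bar>\<phi>' i x\<bar> * e x)" for i
    by (rule integrable_compact_support[OF K(1)];
        (intro continuous_intros subU[OF \<phi>(1)] subU[OF \<phi>(2)] sub continuous_stress continuous_energy | simp add: \<phi>))+
  have parts: "(LINT x|lborel. \<phi> x * stress_pd i x) = - (LINT x|lborel. \<phi>' i x * stress i x)" for i
    by (rule integral_by_parts[OF open_domain K])
      (use \<phi> has_pd_stress in \<open>auto intro: continuous_stress continuous_on_subset\<close>)
  have "2 * (LINT x|lborel. \<phi> x * (V (u x) / \<epsilon>)) = (LINT x|lborel. (\<Sum>i\<in>UNIV. \<phi> x * stress_pd i x))"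
  proof (subst integral_mult_right_zero[symmetric], rule Bochner_Integration.integral_cong[OF refl])
    fix x show "2 * (\<phi> x * (V (u x) / \<epsilon>)) = (\<Sum>i\<in>UNIV. \<phi> x * stress_pd i x)"
      using sum_stress_pd[of x] \<phi>(4)[of x] K(2) by (cases "x \<in> K") (auto simp: sum_distrib_left[symmetric])
  qed
  also have "\<dots> = (\<Sum>i\<in>UNIV. - (LINT x|lborel. \<phi>' i x * stress i x))"
    using ints by (simp add: Bochner_Integration.integral_sum parts)
  also have "\<dots> \<le> (\<Sum>i\<in>UNIV. 5 * R * (LINT x|lborel. \<bar>\<phi>' i x\<bar> * e x))"
  proof (rule sum_mono)
    fix i
    have "- (LINT x|lborel. \<phi>' i x * stress i x) = (LINT x|lborel. - (\<phi>' i x * stress i x))" by simp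
    also have "\<dots> \<le> (LINT x|lborel. 5 * R * (\<bar>\<phi>' i x\<bar> * e x))"
    proof (rule integral_mono)
      show "- (\<phi>' i x * stress i x) \<le> 5 * R * (\<bar>\<phi>' i x\<bar> * e x)" for x
      proof (cases "x \<in> K")
        case True
        have "- (\<phi>' i x * stress i x) \<le> \<bar>\<phi>' i x\<bar> * \<bar>stress i x\<bar>" by (metis abs_ge_minus_self abs_mult)
        also have "\<dots> \<le> \<bar>\<phi>' i x\<bar> * (5 * R * e x)" using abs_stress_le[OF R[OF True]] by (intro mult_left_mono) auto
        finally show ?thesis by (simp add: mult_ac)
      qed (simp add: \<phi>)
    qed (use ints in auto)
    finally show "- (LINT x|lborel. \<phi>' i x * stress i x) \<le> 5 * R * (LINT x|lborel. \<bar>\<phi>' i x\<bar> * e x)" by simp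
  qed
  also have "\<dots> = 5 * R * (LINT x|lborel. (\<Sum>i\<in>UNIV. \<bar>\<phi>' i x\<bar>) * e x)"
    using ints by (simp add: Bochner_Integration.integral_sum sum_distrib_left sum_distrib_right)
  finally show ?thesis .
qed

lemma has_pd_gradient_V_inner:
  assumes "x \<in> \<Omega>"
  shows "has_pd i (\<lambda>x. gradient V (u x) \<bullet> p i x) (p i x \<bullet> (hessian V (u x) *v p i x) + gradient V (u x) \<bullet> h i i x) x"
proof -
  have "has_pd i (\<lambda>x. \<Sum>b\<in>UNIV. partial_deriv b V (u x) * p i x $ b)
    (\<Sum>b\<in>UNIV. (\<Sum>c\<in>UNIV. partial_deriv c (partial_deriv b V) (u x) * p i x $ c) * p i x $ b
       + partial_deriv b V (u x) * h i i x $ b) x"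
    by (intro has_pd_sum has_pd_mult has_pd_compose has_pd_component differentiable assms differentiable_V)
  moreover have "(\<Sum>b\<in>UNIV. (\<Sum>c\<in>UNIV. partial_deriv c (partial_deriv b V) (u x) * p i x $ c) * p i x $ b)
     = p i x \<bullet> (hessian V (u x) *v p i x)"
    unfolding inner_vec_def matrix_vector_mult_def hessian_def inner_real_def
    by (simp add: sum_distrib_left sum_distrib_right mult_ac, subst sum.swap, simp add: mult_ac)
  ultimately show ?thesis by (simp add: gradient_def inner_vec_def sum.distrib)
qed

text \<open>Both derivatives in the Laplacian of \<open>V (u x)\<close> are moved onto
  \<open>\<phi>\<close>; the equation turns the term with the Laplacian of \<open>u\<close> into the
  squared gradient of \<open>V\<close>.\<close>

lemma hessian_identity:
  assumes K: "compact K" "K \<subseteq> \<Omega>"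
    and \<phi>: "continuous_on UNIV \<phi>" "\<And>i. continuous_on UNIV (\<phi>' i)" "\<And>i. continuous_on UNIV (\<phi>'' i)"
      "\<And>i x. has_pd i \<phi> (\<phi>' i x) x" "\<And>i x. has_pd i (\<phi>' i) (\<phi>'' i x) x"
      "\<And>x. x \<notin> K \<Longrightarrow> \<phi> x = 0" "\<And>i x. x \<notin> K \<Longrightarrow> \<phi>' i x = 0" "\<And>i x. x \<notin> K \<Longrightarrow> \<phi>'' i x = 0"
  shows "(LINT x|lborel. \<phi> x * ((\<Sum>i\<in>UNIV. p i x \<bullet> (hessian V (u x) *v p i x)) + (norm (gradient V (u x)))\<^sup>2 / \<epsilon>\<^sup>2))
    = (LINT x|lborel. (\<Sum>i\<in>UNIV. \<phi>'' i x) * V (u x))"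
proof -
  let ?q = "\<lambda>i x. p i x \<bullet> (hessian V (u x) *v p i x) + gradient V (u x) \<bullet> h i i x"
  have subU: "continuous_on S g" if "continuous_on UNIV g" for g :: "real^2 \<Rightarrow> real" and S
    using that by (rule continuous_on_subset) simp
  have cont: "continuous_on \<Omega> (\<lambda>x. gradient V (u x) \<bullet> p i x)" "continuous_on \<Omega> (?q i)" for i
    unfolding inner_vec_def matrix_vector_mult_def hessian_def gradient_def
    by (simp, intro continuous_intros continuous continuous_comp)+
  have ints: "integrable lborel (\<lambda>x. \<phi> x * ?q i x)" "integrable lborel (\<lambda>x. \<phi>'' i x * V (u x))" for i
    by (rule integrable_compact_support[OF K(1)];
        (intro continuous_intros subU[OF \<phi>(1)] subU[OF \<phi>(3)] continuous_on_subset[OF _ K(2)] cont continuous_comp | simp add: \<phi>))+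
  have parts: "(LINT x|lborel. \<phi> x * ?q i x) = (LINT x|lborel. \<phi>'' i x * V (u x))" for i
  proof -
    have "(LINT x|lborel. \<phi> x * ?q i x) = - (LINT x|lborel. \<phi>' i x * (gradient V (u x) \<bullet> p i x))"
      by (rule integral_by_parts[OF open_domain K]) (auto intro: subU \<phi> cont has_pd_gradient_V_inner)
    also have "(LINT x|lborel. \<phi>' i x * (gradient V (u x) \<bullet> p i x)) = - (LINT x|lborel. \<phi>'' i x * V (u x))"
      by (rule integral_by_parts[OF open_domain K]) (auto intro: subU \<phi> cont has_pd_V continuous_comp)
    finally show ?thesis by simp
  qed
  have "(\<Sum>i\<in>UNIV. ?q i x) = (\<Sum>i\<in>UNIV. p i x \<bullet> (hessian V (u x) *v p i x)) + (norm (gradient V (u x)))\<^sup>2 / \<epsilon>\<^sup>2"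
    if "x \<in> \<Omega>" for x
  proof -
    have "(\<Sum>i\<in>UNIV. gradient V (u x) \<bullet> h i i x) = gradient V (u x) \<bullet> laplacian u x"
      by (simp add: laplacian_def inner_sum_right)
    then show ?thesis using equation[OF that] by (simp add: sum.distrib power2_norm_eq_inner)
  qed
  note q = this
  have "(LINT x|lborel. \<phi> x * ((\<Sum>i\<in>UNIV. p i x \<bullet> (hessian V (u x) *v p i x)) + (norm (gradient V (u x)))\<^sup>2 / \<epsilon>\<^sup>2))
     = (LINT x|lborel. (\<Sum>i\<in>UNIV. \<phi> x * ?q i x))"
  proof (rule Bochner_Integration.integral_cong[OF refl])
    show "\<phi> x * ((\<Sum>i\<in>UNIV. p i x \<bullet> (hessian V (u x) *v p i x)) + (norm (gradient V (u x)))\<^sup>2 / \<epsilon>\<^sup>2)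
        = (\<Sum>i\<in>UNIV. \<phi> x * ?q i x)" for x
    proof (cases "x \<in> K")
      case True
      with K(2) have "x \<in> \<Omega>" by blast
      from q[OF this] show ?thesis by (simp only: sum_distrib_left[symmetric])
    qed (simp add: \<phi>(6))
  qed
  also have "\<dots> = (LINT x|lborel. (\<Sum>i\<in>UNIV. \<phi>'' i x) * V (u x))"
    using ints by (simp add: Bochner_Integration.integral_sum parts sum_distrib_right)
  finally show ?thesis .
qed

end

section \<open>A priori bounds\<close>

text \<open>A convex function of class \<open>C\<^sup>2\<close> that vanishes on the negative half-line and grows linearly:
  its second derivative is the hat function supported on \<open>[0, 2]\<close>.\<close>

definition ramp :: "real \<Rightarrow> real" where
  "ramp t = (max 0 t) ^ 3 - 2 * (max 0 (t - 1)) ^ 3 + (max 0 (t - 2)) ^ 3"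
definition ramp' :: "real \<Rightarrow> real" where
  "ramp' t = 3 * (max 0 t) ^ 2 - 2 * (3 * (max 0 (t - 1)) ^ 2) + 3 * (max 0 (t - 2)) ^ 2"
definition ramp'' :: "real \<Rightarrow> real" where
  "ramp'' t = 3 * (2 * max 0 t) - 2 * (3 * (2 * max 0 (t - 1))) + 3 * (2 * max 0 (t - 2))"

lemma has_real_derivative_pos_part_power_shift:
  "((\<lambda>t. (max 0 (t - a)) ^ Suc (Suc n)) has_real_derivative real (Suc (Suc n)) * (max 0 (t - a)) ^ Suc n) (at t)"
proof -
  have "((\<lambda>t. t - a) has_real_derivative 1) (at t)" by (auto intro!: derivative_eq_intros)
  from DERIV_chain2[where g = "\<lambda>t. t - a", OF has_real_derivative_pos_part_power this]
  show ?thesis by simp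
qed

lemma ramp_has_derivative: "(ramp has_real_derivative ramp' t) (at t)"
proof -
  note P = has_real_derivative_pos_part_power_shift[where n = 1, unfolded One_nat_def[symmetric]]
  have d: "((\<lambda>t. (max 0 (t - a)) ^ 3) has_real_derivative 3 * (max 0 (t - a)) ^ 2) (at t)" for a
    using P[of a t] by (simp add: numeral_3_eq_3 numeral_2_eq_2)
  show ?thesis unfolding ramp_def[abs_def] ramp'_def
    using DERIV_add[OF DERIV_diff[OF d[of 0] DERIV_cmult[OF d[of 1], of 2]] d[of 2]] by simp
qed

lemma ramp'_has_derivative: "(ramp' has_real_derivative ramp'' t) (at t)"
proof -
  have d: "((\<lambda>t. (max 0 (t - a)) ^ 2) has_real_derivative 2 * max 0 (t - a)) (at t)" for a
    using has_real_derivative_pos_part_power_shift[of a 0 t] by (simp add: numeral_2_eq_2)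
  show ?thesis unfolding ramp'_def[abs_def] ramp''_def
    using DERIV_add[OF DERIV_diff[OF DERIV_cmult[OF d[of 0], of 3] DERIV_cmult[OF DERIV_cmult[OF d[of 1], of 3], of 2]]
        DERIV_cmult[OF d[of 2], of 3]] by simp
qed

lemma ramp_nonpos: "t \<le> 0 \<Longrightarrow> ramp t = 0" "t \<le> 0 \<Longrightarrow> ramp' t = 0"
  by (simp_all add: ramp_def ramp'_def)

lemma ramp''_nonneg: "0 \<le> ramp'' t"
  unfolding ramp''_def by (auto simp: max_def)

lemma ramp_bounds: "0 \<le> ramp' t" "ramp t \<le> 6 * max 0 t" "6 * t - 6 \<le> ramp t"
proof -
  consider "t \<le> 0" | "0 < t" "t \<le> 1" | "1 < t" "t \<le> 2" | "2 < t" by linarith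
  then have "0 \<le> ramp' t \<and> ramp t \<le> 6 * max 0 t \<and> 6 * t - 6 \<le> ramp t"
  proof cases
    case 2
    have "t ^ 3 \<le> t" using 2 power_decreasing[of 1 3 t] by simp
    moreover have "6 * t - 6 \<le> t ^ 3" using 2 zero_le_power[of t 3] by linarith
    moreover have "ramp t = t ^ 3" "ramp' t = 3 * t ^ 2" using 2 by (simp_all add: ramp_def ramp'_def)
    ultimately show ?thesis using 2 by (simp add: max_def)
  next
    case 3
    have r: "ramp t = t ^ 3 - 2 * (t - 1) ^ 3" "ramp' t = 3 * t ^ 2 - 6 * (t - 1) ^ 2"
      using 3 by (simp_all add: ramp_def ramp'_def)
    \<comment> \<open>Measured from the line \<open>6 * t - 6\<close>, with which
      \<open>ramp\<close> coincides beyond 2, only the cube of \<open>2 - t\<close> is left.\<close>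
    have "ramp t = 6 * t - 6 + (2 - t) ^ 3"
      unfolding r by (simp add: power3_eq_cube algebra_simps)
    moreover have "0 \<le> (2 - t) ^ 3" using 3 by simp
    moreover have "(2 - t) ^ 3 \<le> 1" using 3 by (intro power_le_one) auto
    moreover have "ramp' t = 3 * (2 - (2 - t)\<^sup>2)"
      unfolding r by (simp add: power2_eq_square algebra_simps)
    moreover have "(2 - t)\<^sup>2 \<le> 1" using 3 by (intro power_le_one) auto
    ultimately show ?thesis using 3 by (simp add: max_def)
  next
    case 4
    have "ramp t = 6 * t - 6" "ramp' t = 6"
      using 4 by (simp_all add: ramp_def ramp'_def power3_eq_cube power2_eq_square algebra_simps)
    then show ?thesis using 4 by (simp add: max_def)
  qed (simp add: ramp_nonpos)
  then show "0 \<le> ramp' t" "ramp t \<le> 6 * max 0 t" "6 * t - 6 \<le> ramp t" by auto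
qed

text \<open>Along the ray through \<open>y\<close> the difference of \<open>V\<close> and
  \<open>\<alpha> / 2\<close> times the squared norm does not decrease once the ray has crossed the
  sphere of radius \<open>R\<close>, and at the crossing \<open>V\<close> is nonnegative.\<close>

lemma coercive_lower_bound:
  fixes V :: "real^'k \<Rightarrow> real"
  assumes V: "smooth_on UNIV V" "\<And>y. 0 \<le> V y" and \<alpha>: "0 < \<alpha>" "0 < R"
    and grow: "\<And>y. norm y > R \<Longrightarrow> y \<bullet> gradient V y \<ge> \<alpha> * (norm y)\<^sup>2"
  shows "\<alpha> / 2 * ((norm y)\<^sup>2 - R\<^sup>2) \<le> V y"
proof (cases "norm y \<le> R")
  case True
  then have "(norm y)\<^sup>2 \<le> R\<^sup>2" by (intro power_mono) auto
  then have "\<alpha> / 2 * ((norm y)\<^sup>2 - R\<^sup>2) \<le> 0" using \<alpha> by (simp add: mult_nonneg_nonpos)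
  with V(2)[of y] show ?thesis by linarith
next
  case False
  then have y: "0 < norm y" "R < norm y" using \<alpha> by linarith+
  define t0 where "t0 = R / norm y"
  have t0: "0 < t0" "t0 < 1" using y \<alpha> by (auto simp: t0_def)
  define \<psi> where "\<psi> t = V (t *\<^sub>R y) - \<alpha> / 2 * (norm y)\<^sup>2 * t\<^sup>2" for t
  have dV: "((\<lambda>t. V (t *\<^sub>R y)) has_real_derivative y \<bullet> gradient V (t *\<^sub>R y)) (at t)" for t
  proof -
    have "((\<lambda>t. t *\<^sub>R y) has_derivative (\<lambda>s. s *\<^sub>R y)) (at t)" by (auto intro!: derivative_eq_intros)
    note has_derivative_compose[OF this has_derivative_partial_deriv[OF smooth_on_imp_differentiable[OF V(1) UNIV_I]]]
    moreover have "(\<lambda>s. \<Sum>i\<in>UNIV. (s *\<^sub>R y) $ i *\<^sub>R partial_deriv i V (t *\<^sub>R y)) = (*) (y \<bullet> gradient V (t *\<^sub>R y))"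
      by (auto simp: fun_eq_iff inner_vec_def gradient_def sum_distrib_left sum_distrib_right mult_ac)
    ultimately show ?thesis unfolding has_field_derivative_def by (rule subst[rotated])
  qed
  have dpsi: "(\<psi> has_real_derivative (y \<bullet> gradient V (t *\<^sub>R y) - \<alpha> * (norm y)\<^sup>2 * t)) (at t)" for t
    unfolding \<psi>_def[abs_def] using DERIV_diff[OF dV DERIV_cmult[OF DERIV_pow[of 2 t], of "\<alpha> / 2 * (norm y)\<^sup>2"]]
    by (simp add: mult_ac)
  have "\<psi> t0 \<le> \<psi> 1"
  proof (rule DERIV_nonneg_imp_increasing_open[where f = \<psi>])
    show "t0 \<le> 1" using t0 by simp
    fix t assume t: "t0 < t" "t < 1"
    have "R < t * norm y" using t(1) y by (simp add: t0_def pos_divide_less_eq)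
    then have "R < norm (t *\<^sub>R y)" using t t0 by simp
    from grow[OF this] have "\<alpha> * (t * norm y)\<^sup>2 \<le> t * (y \<bullet> gradient V (t *\<^sub>R y))" using t t0 by simp
    then have "t * (\<alpha> * (norm y)\<^sup>2 * t) \<le> t * (y \<bullet> gradient V (t *\<^sub>R y))" by (simp add: power2_eq_square mult_ac)
    then have "\<alpha> * (norm y)\<^sup>2 * t \<le> y \<bullet> gradient V (t *\<^sub>R y)" using t t0 by simp
    then show "\<exists>D. (\<psi> has_real_derivative D) (at t) \<and> 0 \<le> D" using dpsi[of t] by force
  next
    show "continuous_on {t0..1} \<psi>" by (rule DERIV_continuous_on) (rule has_field_derivative_at_within[OF dpsi])
  qed
  moreover have "\<psi> t0 = V (t0 *\<^sub>R y) - \<alpha> / 2 * R\<^sup>2"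
    using y by (simp add: \<psi>_def t0_def power_divide)
  moreover have "\<psi> 1 = V y - \<alpha> / 2 * (norm y)\<^sup>2" by (simp add: \<psi>_def)
  ultimately have "V (t0 *\<^sub>R y) - \<alpha> / 2 * R\<^sup>2 \<le> V y - \<alpha> / 2 * (norm y)\<^sup>2" by (simp only:)
  with V(2)[of "t0 *\<^sub>R y"] show ?thesis by (simp add: right_diff_distrib)
qed

section \<open>Interior bounds on the solution and its gradient\<close>

context allen_cahn begin

lemma measurable_energy: "(\<lambda>y. ennreal (e y)) \<in> borel_measurable (restrict_space lborel \<Omega>)"
proof -
  have "e \<in> borel_measurable (restrict_space borel \<Omega>)"
    by (rule borel_measurable_continuous_on_restrict[OF continuous_energy])
  then have "e \<in> borel_measurable (restrict_space lborel \<Omega>)"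
    by (simp cong: measurable_cong_sets add: sets_restrict_space_cong[OF sets_lborel])
  then show ?thesis by simp
qed

lemma emeasure_energy:
  "emeasure (energy_measure V \<Omega> \<epsilon> u) \<Omega> = (\<integral>\<^sup>+y. ennreal (e y) * indicator \<Omega> y \<partial>lborel)"
proof -
  have \<Omega>: "\<Omega> \<in> sets (restrict_space lborel \<Omega>)" using open_domain by (simp add: sets_restrict_space_iff)
  have "emeasure (energy_measure V \<Omega> \<epsilon> u) \<Omega>
      = (\<integral>\<^sup>+y. ennreal (e y) * indicator \<Omega> y \<partial>restrict_space lborel \<Omega>)"
    unfolding energy_measure_def by (rule emeasure_density[OF measurable_energy \<Omega>])
  also have "\<dots> = (\<integral>\<^sup>+y. ennreal (e y) * indicator \<Omega> y * indicator \<Omega> y \<partial>lborel)"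
    using open_domain by (subst nn_integral_restrict_space) auto
  also have "\<dots> = (\<integral>\<^sup>+y. ennreal (e y) * indicator \<Omega> y \<partial>lborel)"
    by (intro nn_integral_cong) (simp add: indicator_def)
  finally show ?thesis .
qed

text \<open>Since \<open>kernel2\<close> is at most one, the mean is at most the total energy
  divided by the Jacobian \<open>d\<^sup>2\<close> of the dilation.\<close>

lemma weighted_mean_energy_le:
  assumes x: "cball x (2 * d) \<subseteq> \<Omega>" "0 < d"
    and M: "emeasure (energy_measure V \<Omega> \<epsilon> u) \<Omega> \<le> ennreal M" "0 \<le> M"
  shows "weighted_mean e x d \<le> M / d\<^sup>2"
proof -
  have d: "d \<in> {0..d}" using x by simp
  let ?F = "\<lambda>y. ennreal (e y) * indicator \<Omega> y"
  have F: "?F \<in> borel_measurable borel"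
    using measurable_energy open_domain borel_measurable_restrict_space_iff_ennreal[of \<Omega> lborel] by simp
  have "ennreal (weighted_mean e x d) = (\<integral>\<^sup>+z. ennreal (e (x + d *\<^sub>R z) * kernel2 z) \<partial>lborel)"
    unfolding weighted_mean_def
    by (intro nn_integral_eq_integral[symmetric] integrable_dilated[OF x(1) d continuous_energy] continuous_intros
        kernel_eq_0 AE_I2 mult_nonneg_nonneg energy_bounds kernel_bounds)
  also have "\<dots> \<le> (\<integral>\<^sup>+z. ?F (x + d *\<^sub>R z) \<partial>lborel)"
  proof (rule nn_integral_mono)
    fix z
    show "ennreal (e (x + d *\<^sub>R z) * kernel2 z) \<le> ?F (x + d *\<^sub>R z)"
    proof (cases "z \<in> cbox (- 1) 1")
      case True
      have "e (x + d *\<^sub>R z) * kernel2 z \<le> e (x + d *\<^sub>R z) * 1"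
        by (intro mult_left_mono kernel_bounds energy_bounds)
      then show ?thesis using cbox_image_subset[OF x(1) d True] by (simp add: ennreal_leI)
    qed (simp add: kernel_eq_0(2)[OF not_in_cbox_kernel])
  qed
  also have "\<dots> = (\<integral>\<^sup>+y. ?F y \<partial>lborel) / ennreal (d\<^sup>2)"
  proof -
    have "(\<integral>\<^sup>+y. ?F y \<partial>lborel)
       = (\<integral>\<^sup>+y. ?F y \<partial>density (distr lborel borel (\<lambda>z. x + d *\<^sub>R z)) (\<lambda>_. ennreal (\<bar>d\<bar> ^ DIM(real^2))))"
      using lborel_affine[of d x] x(2) by simp
    also have "\<dots> = (\<integral>\<^sup>+z. ennreal (d\<^sup>2) * ?F (x + d *\<^sub>R z) \<partial>lborel)"
      using F by (subst nn_integral_density, simp, simp, subst nn_integral_distr) simp_all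
    also have "\<dots> = ennreal (d\<^sup>2) * (\<integral>\<^sup>+z. ?F (x + d *\<^sub>R z) \<partial>lborel)"
      using measurable_compose[OF _ F, of "\<lambda>z. x + d *\<^sub>R z" lborel] by (intro nn_integral_cmult) simp
    finally show ?thesis using x(2) by (simp add: ennreal_mult_divide_eq mult.commute[of "ennreal _"])
  qed
  also have "\<dots> \<le> ennreal M / ennreal (d\<^sup>2)"
    using M(1) unfolding emeasure_energy by (rule divide_right_mono_ennreal)
  also have "\<dots> = ennreal (M / d\<^sup>2)" using x(2) M(2) by (simp add: divide_ennreal)
  finally show ?thesis using M(2) by (simp add: ennreal_le_iff)
qed

text \<open>The squared norm of \<open>u\<close> is subharmonic where it exceeds
  \<open>R\<^sup>2\<close>, because there the inner product of \<open>u\<close> with the gradient of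
  \<open>V\<close> is nonnegative; the convex nondecreasing \<open>ramp\<close> makes a globally
  subharmonic function out of it. The mean of that function is bounded by the energy, since
  \<open>V\<close> grows quadratically and \<open>\<epsilon> \<le> 1\<close>.\<close>

lemma sup_bound:
  assumes \<alpha>: "0 < \<alpha>" "0 < R" and grow: "\<And>y. norm y > R \<Longrightarrow> y \<bullet> gradient V y \<ge> \<alpha> * (norm y)\<^sup>2"
    and x: "cball x (2 * d) \<subseteq> \<Omega>" "0 < d" and \<epsilon>: "\<epsilon> \<le> 1"
    and M: "emeasure (energy_measure V \<Omega> \<epsilon> u) \<Omega> \<le> ennreal M" "0 \<le> M"
  shows "(norm (u x))\<^sup>2 \<le> R\<^sup>2 + 1 + 2 * M / (\<alpha> * d\<^sup>2 * (LINT z|lborel. kernel2 z))"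
proof -
  define c where "c = (LINT z|lborel. kernel2 z)"
  have c: "0 < c" using kernel2_mass_pos by (simp add: c_def)
  let ?w = "\<lambda>y. u y \<bullet> u y - R\<^sup>2"
  define f where "f y = ramp (?w y)" for y
  define fg where "fg i y = ramp' (?w y) * (2 * (u y \<bullet> p i y))" for i y
  define fl where "fl i y = (ramp'' (?w y) * (2 * (u y \<bullet> p i y))) * (2 * (u y \<bullet> p i y))
      + ramp' (?w y) * (2 * (p i y \<bullet> p i y + u y \<bullet> h i i y))" for i y
  have cw: "continuous_on \<Omega> ?w" by (intro continuous_intros continuous)
  have cr: "continuous_on UNIV ramp" "continuous_on UNIV ramp'" "continuous_on UNIV ramp''"
    unfolding ramp_def ramp'_def ramp''_def by (intro continuous_intros)+
  have cont: "continuous_on \<Omega> f" "continuous_on \<Omega> (fg i)" "continuous_on \<Omega> (fl i)" for i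
    unfolding f_def fg_def fl_def
    by (intro continuous_intros continuous continuous_on_compose2[OF cr(1) cw]
      continuous_on_compose2[OF cr(2) cw] continuous_on_compose2[OF cr(3) cw]; simp)+
  have "f x * c \<le> weighted_mean f x d"
    unfolding c_def
  proof (rule subharmonic_mean_value[OF open_domain x(1)])
    show "0 \<le> d" using x(2) by simp
    fix y assume y: "y \<in> \<Omega>"
    note dy = differentiable[OF y]
    show "(f has_derivative (\<lambda>v. \<Sum>i\<in>UNIV. v $ i * fg i y)) (at y)"
    proof -
      note du = has_derivative_partial_deriv[OF dy(1)]
      have "(?w has_derivative (\<lambda>v. \<Sum>i\<in>UNIV. v $ i * (2 * (u y \<bullet> p i y)))) (at y)"
        by (rule derivative_eq_intros du refl)+
          (auto simp: fun_eq_iff inner_sum_left inner_sum_right inner_commute sum.distrib[symmetric] intro!: sum.cong)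
      from has_derivative_compose[OF this ramp_has_derivative[of "?w y", unfolded has_field_derivative_def]]
      show ?thesis unfolding f_def[abs_def] fg_def by (simp add: sum_distrib_left mult_ac)
    qed
    show "has_pd i (fg i) (fl i y) y" for i
    proof -
      have w: "has_pd i ?w (2 * (u y \<bullet> p i y)) y"
        using has_pd_diff[OF has_pd_inner[OF dy(1,1)] has_pd_const] by (simp add: inner_commute)
      have "has_pd i (\<lambda>y. 2 * (u y \<bullet> p i y)) (2 * (p i y \<bullet> p i y + u y \<bullet> h i i y)) y"
        by (intro has_pd_cmult has_pd_inner dy)
      from has_pd_mult[OF has_pd_chain[OF ramp'_has_derivative w] this]
      show ?thesis unfolding fg_def[abs_def] fl_def .
    qed
    show "0 \<le> (\<Sum>i\<in>UNIV. fl i y)"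
    proof -
      have "fl i y \<ge> ramp' (?w y) * (2 * (u y \<bullet> h i i y))" for i
      proof -
        have "0 \<le> ramp'' (?w y) * (2 * (u y \<bullet> p i y))\<^sup>2"
          using ramp''_nonneg by simp
        moreover have "0 \<le> ramp' (?w y) * (2 * (p i y \<bullet> p i y))" using ramp_bounds(1) by simp
        ultimately show ?thesis
          unfolding fl_def by (simp add: power2_eq_square distrib_left mult_ac)
      qed
      then have "(\<Sum>i\<in>UNIV. fl i y) \<ge> (\<Sum>i\<in>UNIV. ramp' (?w y) * (2 * (u y \<bullet> h i i y)))"
        by (rule sum_mono)
      moreover have "(\<Sum>i\<in>UNIV. ramp' (?w y) * (2 * (u y \<bullet> h i i y))) = ramp' (?w y) * (2 * (u y \<bullet> laplacian u y))"
        by (simp add: laplacian_def inner_sum_right sum_distrib_left)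
      moreover have "0 \<le> ramp' (?w y) * (2 * (u y \<bullet> laplacian u y))"
      proof (cases "norm (u y) \<le> R")
        case True
        then have "(norm (u y))\<^sup>2 \<le> R\<^sup>2" by (intro power_mono) auto
        then show ?thesis by (simp add: ramp_nonpos power2_norm_eq_inner)
      next
        case False
        with grow have "\<alpha> * (norm (u y))\<^sup>2 \<le> u y \<bullet> gradient V (u y)" by simp
        moreover have "0 \<le> \<alpha> * (norm (u y))\<^sup>2" using \<alpha> by simp
        ultimately have "0 \<le> u y \<bullet> gradient V (u y)" by linarith
        then show ?thesis using ramp_bounds(1) by (simp add: equation[OF y])
      qed
      ultimately show ?thesis by linarith
    qed
  qed (rule cont)+
  \<comment> \<open>The constant is the slope 6 of \<open>ramp\<close> times the factor
    \<open>2 / \<alpha>\<close> from \<open>coercive_lower_bound\<close>.\<close>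
  also have "weighted_mean f x d \<le> 12 / \<alpha> * weighted_mean e x d"
  proof -
    have d: "d \<in> {0..d}" using x by simp
    have "weighted_mean f x d \<le> (LINT z|lborel. (12 / \<alpha>) * (e (x + d *\<^sub>R z) * kernel2 z))"
      unfolding weighted_mean_def
    proof (rule integral_mono)
      show "integrable lborel (\<lambda>z. f (x + d *\<^sub>R z) * kernel2 z)"
        by (intro integrable_dilated[OF x(1) d] cont continuous_intros kernel_eq_0)
      show "integrable lborel (\<lambda>z. (12 / \<alpha>) * (e (x + d *\<^sub>R z) * kernel2 z))"
        by (intro integrable_mult_right integrable_dilated[OF x(1) d] continuous_energy continuous_intros kernel_eq_0)
      fix z
      have "f y \<le> 12 / \<alpha> * e y" for y
      proof -
        have "max 0 (?w y) \<le> 2 / \<alpha> * V (u y)"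
          using coercive_lower_bound[OF smooth_V V_nonneg \<alpha> grow, of "u y"] V_nonneg[of "u y"] \<alpha>
          by (auto simp: power2_norm_eq_inner field_simps)
        also have "\<dots> \<le> 2 / \<alpha> * e y"
        proof (intro mult_left_mono)
          have "V (u y) \<le> V (u y) / \<epsilon>" using V_nonneg[of "u y"] eps_pos \<epsilon> by (simp add: le_divide_eq mult_left_le)
          then show "V (u y) \<le> e y" using energy_bounds(2)[of y] by linarith
        qed (use \<alpha> in simp)
        finally have "6 * max 0 (?w y) \<le> 6 * (2 / \<alpha> * e y)" by (rule mult_left_mono) simp
        with ramp_bounds(2)[of "?w y"] have "f y \<le> 6 * (2 / \<alpha> * e y)" unfolding f_def by (rule order_trans)
        then show ?thesis by simp
      qed
      from mult_right_mono[OF this kernel_bounds(2)]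
      show "f (x + d *\<^sub>R z) * kernel2 z \<le> (12 / \<alpha>) * (e (x + d *\<^sub>R z) * kernel2 z)"
        by (simp only: mult.assoc)
    qed
    then show ?thesis by (simp add: weighted_mean_def)
  qed
  also have "\<dots> \<le> 12 / \<alpha> * (M / d\<^sup>2)"
    using weighted_mean_energy_le[OF x M] \<alpha> by (intro mult_left_mono) auto
  finally have "f x \<le> 12 / \<alpha> * (M / d\<^sup>2) / c" unfolding pos_le_divide_eq[OF c] .
  then have "6 * (u x \<bullet> u x - R\<^sup>2) - 6 \<le> 12 / \<alpha> * (M / d\<^sup>2) / c"
    using ramp_bounds(3)[of "?w x"] by (simp add: f_def)
  then have "u x \<bullet> u x \<le> R\<^sup>2 + 1 + 2 / \<alpha> * (M / d\<^sup>2) / c" by simp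
  then show ?thesis by (simp add: power2_norm_eq_inner c_def)
qed

text \<open>The mean value estimate is used at radius \<open>\<epsilon> * s\<close>. The size of
  \<open>u\<close> divided by this radius, and the Laplacian, of order
  \<open>1 / \<epsilon>\<^sup>2\<close>, times this radius, are both of order
  \<open>1 / \<epsilon>\<close>; the factor \<open>\<epsilon>\<close> on the left compensates
  exactly.\<close>

lemma gradient_bound:
  assumes S: "open S" "S \<subseteq> \<Omega>" "cball x (2 * s) \<subseteq> S" "0 < s" and \<epsilon>: "\<epsilon> \<le> 1"
    and B: "\<And>y. y \<in> S \<Longrightarrow> norm (u y) \<le> B" and Q: "\<And>y. norm y \<le> B \<Longrightarrow> \<bar>partial_deriv a V y\<bar> \<le> Q"
  shows "\<epsilon> * \<bar>p j x $ a\<bar> * (LINT z|lborel. kernel2 z) \<le> 16 * (B / s + s * Q)"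
proof -
  have sub: "continuous_on S g" if "continuous_on \<Omega> g" for g :: "real^2 \<Rightarrow> real"
    using that S(2) by (rule continuous_on_subset)
  have y\<Omega>: "y \<in> \<Omega>" if "y \<in> S" for y using that S(2) by blast
  have "\<bar>p j x $ a\<bar> * (LINT z|lborel. kernel2 z) \<le> 16 * (B / (\<epsilon> * s) + \<epsilon> * s * (Q / \<epsilon>\<^sup>2))"
  proof (rule gradient_mean_value[OF S(1)])
    have "2 * (\<epsilon> * s) \<le> 2 * s" using \<epsilon> S(4) by (simp add: mult_right_le_one_le)
    then show "cball x (2 * (\<epsilon> * s)) \<subseteq> S" using S(3) by (meson order_trans subset_cball)
    show "0 < \<epsilon> * s" using eps_pos S(4) by simp
    fix y assume y: "y \<in> S"
    note dy = differentiable[OF y\<Omega>[OF y]]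
    show "((\<lambda>x. p j x $ a) has_derivative (\<lambda>v. \<Sum>i\<in>UNIV. v $ i * h i j y $ a)) (at y)"
      by (rule has_derivative_component[OF dy(2)])
    show "has_pd i (\<lambda>y. h i j y $ a) (partial_deriv i (h i j) y $ a) y" for i
      by (rule has_pd_component[OF dy(3)])
    show "has_pd j (\<lambda>y. u y $ a) (p j y $ a) y" by (rule has_pd_component[OF dy(1)])
    show "\<bar>u y $ a\<bar> \<le> B" using component_le_norm_cart[of "u y" a] B[OF y] by linarith
    show "has_pd j (\<lambda>y. laplacian u y $ a) (\<Sum>i\<in>UNIV. partial_deriv i (h i j) y $ a) y"
      using laplacian_partial_deriv_commute[OF smooth_u open_domain y\<Omega>[OF y], of j a]
      by (simp add: laplacian_def sum_component)
    have "laplacian u y $ a = partial_deriv a V (u y) / \<epsilon>\<^sup>2"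
      using equation[OF y\<Omega>[OF y]] by (simp add: gradient_def)
    then show "\<bar>laplacian u y $ a\<bar> \<le> Q / \<epsilon>\<^sup>2"
      using Q[OF B[OF y]] eps_pos by (simp add: divide_right_mono)
  next
    show "continuous_on S (\<lambda>y. h i j y $ a)" for i by (intro sub continuous_intros continuous)
    show "continuous_on S (\<lambda>y. partial_deriv i (h i j) y $ a)" for i
      by (intro sub continuous_intros smooth_on_imp_continuous_on smooth_on_partial_deriv smooth_u)
    show "continuous_on S (\<lambda>y. u y $ a)" by (intro sub continuous_intros continuous)
    show "continuous_on S (\<lambda>y. laplacian u y $ a)"
      unfolding laplacian_def sum_component by (intro sub continuous_intros continuous)
  qed
  from mult_left_mono[OF this, of \<epsilon>] eps_pos
  have "\<epsilon> * (\<bar>p j x $ a\<bar> * (LINT z|lborel. kernel2 z)) \<le> \<epsilon> * (16 * (B / (\<epsilon> * s) + \<epsilon> * s * (Q / \<epsilon>\<^sup>2)))"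
    by simp
  also have "\<dots> = 16 * (B / s + s * Q)" using eps_pos by (simp add: power2_eq_square distrib_left)
  finally show ?thesis by (simp only: mult.assoc)
qed

end

section \<open>Cutoffs and the energy estimate\<close>

text \<open>The cube is the smallest integer power of the positive part that is of class
  C^2.\<close>

definition bump :: "real \<Rightarrow> real^2 \<Rightarrow> real^2 \<Rightarrow> real" where
  "bump r q x = (max 0 (r\<^sup>2 - (x - q) \<bullet> (x - q))) ^ 3"
definition bump_pd :: "real \<Rightarrow> real^2 \<Rightarrow> 2 \<Rightarrow> real^2 \<Rightarrow> real" where
  "bump_pd r q i x = - 6 * ((max 0 (r\<^sup>2 - (x - q) \<bullet> (x - q))) ^ 2 * (x - q) $ i)"
definition bump_pd2 :: "real \<Rightarrow> real^2 \<Rightarrow> 2 \<Rightarrow> real^2 \<Rightarrow> real" where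
  "bump_pd2 r q i x = - 6 * ((2 * max 0 (r\<^sup>2 - (x - q) \<bullet> (x - q)) * (- 2 * (x - q) $ i)) * (x - q) $ i
     + (max 0 (r\<^sup>2 - (x - q) \<bullet> (x - q))) ^ 2)"

lemma has_pd_translate: "has_pd i f D (x - q) \<Longrightarrow> has_pd i (\<lambda>x. f (x - q)) D x"
  unfolding has_pd_def by (simp add: algebra_simps)

lemma bump_has_pd:
  "has_pd i (bump r q) (bump_pd r q i x) x" "has_pd i (bump_pd r q i) (bump_pd2 r q i x) x"
proof -
  have "has_pd i (\<lambda>x. r\<^sup>2 - (x - q) \<bullet> (x - q)) (0 - 2 * (x - q) $ i) x"
    by (intro has_pd_diff has_pd_const has_pd_translate[where f = "\<lambda>z. z \<bullet> z"] has_pd_inner_self)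
  then have w: "has_pd i (\<lambda>x. r\<^sup>2 - (x - q) \<bullet> (x - q)) (- 2 * (x - q) $ i) x" by simp
  have "has_pd i (bump r q) (3 * (max 0 (r\<^sup>2 - (x - q) \<bullet> (x - q))) ^ 2 * (- 2 * (x - q) $ i)) x"
    using has_pd_chain[OF has_real_derivative_pos_part_power[of 1] w]
    by (simp add: bump_def[abs_def] numeral_3_eq_3 numeral_2_eq_2)
  moreover have "3 * (max 0 (r\<^sup>2 - (x - q) \<bullet> (x - q))) ^ 2 * (- 2 * (x - q) $ i) = bump_pd r q i x"
    unfolding bump_pd_def by (simp only: mult_ac mult_minus_left mult_minus_right)
  ultimately show "has_pd i (bump r q) (bump_pd r q i x) x" by (simp only:)
  have c: "has_pd i (\<lambda>x. (x - q) $ i) 1 x"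
    using has_pd_translate[where f = "\<lambda>z. z $ i", OF has_pd_coord[of i i "x - q"]] by simp
  have "has_pd i (\<lambda>x. (max 0 (r\<^sup>2 - (x - q) \<bullet> (x - q))) ^ 2) (2 * max 0 (r\<^sup>2 - (x - q) \<bullet> (x - q)) * (- 2 * (x - q) $ i)) x"
    using has_pd_chain[OF has_real_derivative_pos_part_power[of 0] w] by (simp add: numeral_2_eq_2)
  from has_pd_cmult[OF has_pd_mult[OF this c], of "- 6"]
  show "has_pd i (bump_pd r q i) (bump_pd2 r q i x) x"
    unfolding bump_pd_def[abs_def] bump_pd2_def by simp
qed

lemma bump_continuous:
  "continuous_on S (bump r q)" "continuous_on S (bump_pd r q i)" "continuous_on S (bump_pd2 r q i)"
  unfolding bump_def bump_pd_def bump_pd2_def by (intro continuous_intros)+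

lemma bump_eq_0:
  assumes "x \<notin> cball q r" "0 < r"
  shows "bump r q x = 0" "bump_pd r q i x = 0" "bump_pd2 r q i x = 0"
proof -
  have "r < norm (x - q)" using assms by (simp add: dist_norm norm_minus_commute)
  then have "r\<^sup>2 < (norm (x - q))\<^sup>2" using assms(2) by (intro power_strict_mono) auto
  then have "r\<^sup>2 - (x - q) \<bullet> (x - q) < 0" by (simp add: power2_norm_eq_inner)
  then show "bump r q x = 0" "bump_pd r q i x = 0" "bump_pd2 r q i x = 0"
    by (simp_all add: bump_def bump_pd_def bump_pd2_def)
qed

lemma bump_nonneg: "0 \<le> bump r q x" by (simp add: bump_def)

lemma bump_pos:
  assumes "x \<in> ball q r" shows "0 < bump r q x"
proof -
  have "norm (x - q) < r" using assms by (simp add: dist_norm norm_minus_commute)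
  then have "(norm (x - q))\<^sup>2 < r\<^sup>2" by (intro power_strict_mono) auto
  then show ?thesis by (simp add: bump_def power2_norm_eq_inner)
qed

text \<open>The value 1 is demanded on \<open>K\<close> only, not near it, and \<open>K\<close> may
  have empty interior; so the vanishing of the first derivatives on \<open>K\<close> is demanded as
  well. It is what hides the Pohozaev error from a limit measure concentrated on
  \<open>K\<close>.\<close>

definition is_cutoff :: "(real^2) set \<Rightarrow> (real^2) set \<Rightarrow> (real^2) set \<Rightarrow> (real^2 \<Rightarrow> real)
    \<Rightarrow> (2 \<Rightarrow> real^2 \<Rightarrow> real) \<Rightarrow> (2 \<Rightarrow> real^2 \<Rightarrow> real) \<Rightarrow> bool" where
  "is_cutoff K W L \<phi> \<phi>' \<phi>'' \<longleftrightarrow> compact L \<and> L \<subseteq> W \<and>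
     continuous_on UNIV \<phi> \<and> (\<forall>i. continuous_on UNIV (\<phi>' i)) \<and> (\<forall>i. continuous_on UNIV (\<phi>'' i)) \<and>
     (\<forall>i x. has_pd i \<phi> (\<phi>' i x) x) \<and> (\<forall>i x. has_pd i (\<phi>' i) (\<phi>'' i x) x) \<and>
     (\<forall>x. x \<notin> L \<longrightarrow> \<phi> x = 0) \<and> (\<forall>i x. x \<notin> L \<longrightarrow> \<phi>' i x = 0) \<and> (\<forall>i x. x \<notin> L \<longrightarrow> \<phi>'' i x = 0) \<and>
     (\<forall>x. 0 \<le> \<phi> x \<and> \<phi> x \<le> 1) \<and> (\<forall>x\<in>K. \<phi> x = 1) \<and> (\<forall>i. \<forall>x\<in>K. \<phi>' i x = 0)"

text \<open>A finite sum \<open>s\<close> of bumps has a positive lower bound \<open>c\<close> on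
  the compact \<open>K\<close>. One minus the cube of the positive part of \<open>1 - s / c\<close>
  is then flat to first order wherever \<open>s\<close> is at least \<open>c\<close>, and zero
  wherever all bumps vanish.\<close>

lemma cutoff_exists:
  assumes K: "compact K" and W: "open W" "K \<subseteq> W"
  shows "\<exists>L \<phi> \<phi>' \<phi>''. is_cutoff K W L \<phi> \<phi>' \<phi>''"
proof -
  have "\<exists>r>0. cball q r \<subseteq> W" if "q \<in> K" for q using W that open_contains_cball by blast
  then obtain r where r: "\<And>q. q \<in> K \<Longrightarrow> 0 < r q" "\<And>q. q \<in> K \<Longrightarrow> cball q (r q) \<subseteq> W" by metis
  have "K \<subseteq> (\<Union>q\<in>K. ball q (r q))" using r(1) by force
  then obtain F where F: "F \<subseteq> K" "finite F" "K \<subseteq> (\<Union>q\<in>F. ball q (r q))"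
    using compactE_image[OF K, of K "\<lambda>q. ball q (r q)"] by auto
  define s where "s x = (\<Sum>q\<in>F. bump (r q) q x)" for x
  define s1 where "s1 i x = (\<Sum>q\<in>F. bump_pd (r q) q i x)" for i x
  define s2 where "s2 i x = (\<Sum>q\<in>F. bump_pd2 (r q) q i x)" for i x
  define L where "L = (\<Union>q\<in>F. cball q (r q))"
  have pd: "has_pd i s (s1 i x) x" "has_pd i (s1 i) (s2 i x) x" for i x
    unfolding s_def[abs_def] s1_def[abs_def] s2_def by (intro has_pd_sum bump_has_pd)+
  have cont: "continuous_on S s" "continuous_on S (s1 i)" "continuous_on S (s2 i)" for S i
    unfolding s_def s1_def s2_def by (intro continuous_intros bump_continuous)+
  have out: "s x = 0" "s1 i x = 0" "s2 i x = 0" if "x \<notin> L" for i x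
    unfolding s_def s1_def s2_def using that r(1) F(1)
    by (auto simp: L_def intro!: sum.neutral bump_eq_0)
  have pos: "0 < s x" if x: "x \<in> K" for x
  proof -
    obtain q where q: "q \<in> F" "x \<in> ball q (r q)" using F(3) x by blast
    have "0 < bump (r q) q x" by (rule bump_pos[OF q(2)])
    also have "\<dots> \<le> s x" unfolding s_def by (rule member_le_sum[OF q(1) bump_nonneg F(2)])
    finally show ?thesis .
  qed
  have s_nonneg: "0 \<le> s x" for x unfolding s_def by (intro sum_nonneg bump_nonneg)
  obtain c where c: "0 < c" "\<And>x. x \<in> K \<Longrightarrow> c \<le> s x"
  proof (cases "K = {}")
    case True then show ?thesis using that[of 1] by simp
  next
    case False
    obtain z where "z \<in> K" "\<And>x. x \<in> K \<Longrightarrow> s z \<le> s x"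
      using continuous_attains_inf[OF K False cont(1)] by blast
    then show ?thesis using that[of "s z"] pos by blast
  qed
  define m where "m x = max 0 (1 - s x / c)" for x
  define \<phi> where "\<phi> x = 1 - m x ^ 3" for x
  define \<phi>' where "\<phi>' i x = 3 / c * (m x ^ 2 * s1 i x)" for i x
  define \<phi>'' where "\<phi>'' i x = 3 / c * ((2 * m x * (- 1 / c * s1 i x)) * s1 i x + m x ^ 2 * s2 i x)" for i x
  have mK: "m x = 0" if "x \<in> K" for x using c that by (simp add: m_def)
  have cm: "continuous_on UNIV m" unfolding m_def by (intro continuous_intros cont) (use c in auto)
  have pdm: "has_pd i (\<lambda>x. 1 - s x / c) (- 1 / c * s1 i x) x" for i x
    using has_pd_diff[OF has_pd_const[of i 1 x] has_pd_cmult[OF pd(1), where c = "1/c"]] by simp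
  have m3: "has_pd i (\<lambda>x. m x ^ 3) (3 * m x ^ 2 * (- 1 / c * s1 i x)) x" for i x
    using has_pd_chain[OF has_real_derivative_pos_part_power[of 1] pdm]
    by (simp add: m_def[abs_def] numeral_3_eq_3 numeral_2_eq_2)
  have m2: "has_pd i (\<lambda>x. m x ^ 2) (2 * m x * (- 1 / c * s1 i x)) x" for i x
    using has_pd_chain[OF has_real_derivative_pos_part_power[of 0] pdm]
    by (simp add: m_def[abs_def] numeral_2_eq_2)
  have "is_cutoff K W L \<phi> \<phi>' \<phi>''"
    unfolding is_cutoff_def
  proof (intro conjI allI impI ballI)
    show "compact L" unfolding L_def using F(2) by (intro compact_UN) auto
    show "L \<subseteq> W" unfolding L_def using r(2) F(1) by blast
    show "continuous_on UNIV \<phi>" "continuous_on UNIV (\<phi>' i)" "continuous_on UNIV (\<phi>'' i)" for i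
      unfolding \<phi>_def \<phi>'_def \<phi>''_def by (intro continuous_intros cm cont)+
    show "has_pd i \<phi> (\<phi>' i x) x" for i x
      using has_pd_diff[OF has_pd_const[of i 1 x] m3[of i x]] by (simp add: \<phi>_def[abs_def] \<phi>'_def mult_ac)
    show "has_pd i (\<phi>' i) (\<phi>'' i x) x" for i x
      unfolding \<phi>'_def[abs_def] \<phi>''_def by (intro has_pd_cmult has_pd_mult m2 pd)
    show "\<phi> x = 0" "\<phi>' i x = 0" "\<phi>'' i x = 0" if "x \<notin> L" for i x
      using out[OF that] by (simp_all add: \<phi>_def \<phi>'_def \<phi>''_def m_def)
    have "0 \<le> m x \<and> m x \<le> 1" for x using s_nonneg[of x] c by (simp add: m_def)
    then show "0 \<le> \<phi> x" "\<phi> x \<le> 1" for x by (simp_all add: \<phi>_def power_le_one)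
    show "\<phi> x = 1" "\<phi>' i x = 0" if "x \<in> K" for i x using mK[OF that] by (simp_all add: \<phi>_def \<phi>'_def)
  qed
  then show ?thesis by blast
qed

text \<open>A compactness argument: if no constants worked, points and unit vectors violating the
  bound would accumulate at a zero of \<open>V\<close> where the Hessian is not positive definite.
  The term with \<open>C\<close> pays for negative curvature away from the wells.\<close>

lemma hessian_lower_bound:
  fixes V :: "real^'k \<Rightarrow> real"
  assumes V: "smooth_on UNIV V" "\<And>y. 0 \<le> V y" and pd: "\<And>y. V y = 0 \<Longrightarrow> positive_definite (hessian V y)"
  shows "\<exists>c>0. \<exists>C\<ge>0. \<forall>y v. norm y \<le> B \<longrightarrow> c * (norm v)\<^sup>2 \<le> v \<bullet> (hessian V y *v v) + C * V y * (norm v)\<^sup>2"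
proof -
  define H where "H z = snd z \<bullet> (hessian V (fst z) *v snd z)" for z :: "(real^'k) \<times> (real^'k)"
  have c2: "continuous_on UNIV (partial_deriv i (partial_deriv j V))" for i j
    by (intro smooth_on_imp_continuous_on smooth_on_partial_deriv V)
  have cH: "continuous_on UNIV H"
    unfolding H_def inner_vec_def matrix_vector_mult_def hessian_def
    by (simp, intro continuous_intros continuous_on_compose2[OF c2]) auto
  have cV: "continuous_on UNIV V" by (rule smooth_on_imp_continuous_on[OF V(1)])
  let ?X = "cball 0 B \<times> sphere 0 1 :: ((real^'k) \<times> (real^'k)) set"
  have X: "compact ?X" by (intro compact_Times) auto
  \<comment> \<open>One index serves for both constants, so that failure produces a single
    sequence.\<close>
  have "\<exists>n::nat. \<forall>z\<in>?X. 1 / (real n + 1) \<le> H z + real n * V (fst z)"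
  proof (rule ccontr)
    assume "\<not> ?thesis"
    then have "\<forall>n::nat. \<exists>z. z \<in> ?X \<and> H z + real n * V (fst z) < 1 / (real n + 1)" 
      by (simp only: not_ex ball_simps Bex_def not_le simp_thms)
    from choice[OF this] obtain z where z: "\<And>n. z n \<in> ?X"
      and lt: "\<And>n. H (z n) + real n * V (fst (z n)) < 1 / (real n + 1)" by blast
    obtain l k where l: "l \<in> ?X" and k: "strict_mono (k :: nat \<Rightarrow> nat)" and lim: "(z \<circ> k) \<longlonglongrightarrow> l"
      using X z unfolding compact_def by blast
    have limH: "(\<lambda>n. H (z (k n))) \<longlonglongrightarrow> H l"
      using continuous_on_tendsto_compose[OF cH lim] by (simp add: o_def)
    have limV: "(\<lambda>n. V (fst (z (k n)))) \<longlonglongrightarrow> V (fst l)"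
      using continuous_on_tendsto_compose[OF cV tendsto_fst[OF lim]] by (simp add: o_def)
    have lim0: "(\<lambda>n. 1 / (real (k n) + 1)) \<longlonglongrightarrow> 0"
    proof -
      have "(\<lambda>n. 1 / (real n + 1)) \<longlonglongrightarrow> 0" using LIMSEQ_Suc[OF lim_1_over_n] by (simp add: add.commute)
      from LIMSEQ_subseq_LIMSEQ[OF this k] show ?thesis by (simp add: o_def)
    qed
    have "H l \<le> 0"
    proof (rule LIMSEQ_le[OF limH lim0], intro exI[of _ 0] allI impI)
      fix n
      have "0 \<le> real (k n) * V (fst (z (k n)))" using V(2) by simp
      with lt[of "k n"] show "H (z (k n)) \<le> 1 / (real (k n) + 1)" by linarith
    qed
    moreover have "V (fst l) \<le> 0"
    proof (rule LIMSEQ_le[OF limV])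
      \<comment> \<open>One copy of \<open>V\<close> is added on both sides, so that the division is
        by \<open>real (k n) + 1\<close>, which is never zero.\<close>
      show "(\<lambda>n. (1 / (real (k n) + 1)) * (1 / (real (k n) + 1) - H (z (k n)) + V (fst (z (k n))))) \<longlonglongrightarrow> 0"
        using tendsto_mult[OF lim0 tendsto_add[OF tendsto_diff[OF lim0 limH] limV]] by simp
      show "\<exists>N. \<forall>n\<ge>N. V (fst (z (k n))) \<le> (1 / (real (k n) + 1)) * (1 / (real (k n) + 1) - H (z (k n)) + V (fst (z (k n))))"
      proof (intro exI[of _ 0] allI impI)
        fix n
        have "(real (k n) + 1) * V (fst (z (k n))) \<le> 1 / (real (k n) + 1) - H (z (k n)) + V (fst (z (k n)))"
          using lt[of "k n"] unfolding distrib_right by linarith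
        then show "V (fst (z (k n))) \<le> (1 / (real (k n) + 1)) * (1 / (real (k n) + 1) - H (z (k n)) + V (fst (z (k n))))"
          by (simp add: pos_le_divide_eq mult.commute)
      qed
    qed
    with V(2) have "V (fst l) = 0" by (meson order_antisym)
    from pd[OF this] have "positive_definite (hessian V (fst l))" .
    have "0 < H l" 
    proof -
      have "snd l \<noteq> 0" using l by (auto simp: mem_Times_iff)
      with \<open>positive_definite (hessian V (fst l))\<close> show ?thesis
        unfolding positive_definite_def H_def by blast
    qed
    ultimately show False by linarith
  qed
  then obtain n :: nat where n: "\<And>z. z \<in> ?X \<Longrightarrow> 1 / (real n + 1) \<le> H z + real n * V (fst z)" by blast
  have "1 / (real n + 1) * (norm v)\<^sup>2 \<le> v \<bullet> (hessian V y *v v) + real n * V y * (norm v)\<^sup>2" if y: "norm y \<le> B" for y v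
  proof (cases "v = 0")
    case False
    define w where "w = (1 / norm v) *\<^sub>R v"
    have v: "v = norm v *\<^sub>R w" using False by (simp add: w_def)
    have "(y, w) \<in> ?X" using y False by (simp add: w_def)
    from mult_right_mono[OF n[OF this] zero_le_power2[of "norm v"]]
    have "1 / (real n + 1) * (norm v)\<^sup>2 \<le> (norm v)\<^sup>2 * (w \<bullet> (hessian V y *v w)) + real n * V y * (norm v)\<^sup>2"
      unfolding H_def fst_conv snd_conv distrib_right by (simp only: mult.commute[of "w \<bullet> _"])
    also have "(norm v)\<^sup>2 * (w \<bullet> (hessian V y *v w)) = (norm v *\<^sub>R w) \<bullet> (hessian V y *v (norm v *\<^sub>R w))"
      by (simp add: matrix_vector_mult_scaleR power2_eq_square)
    finally show ?thesis using v by simp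
  qed simp
  then show ?thesis by (intro exI[of _ "1 / (real n + 1)"] exI[of _ "real n"] conjI allI impI) auto
qed

context allen_cahn begin

lemma integral_energy_measure:
  assumes L: "compact L" "L \<subseteq> \<Omega>" and \<psi>: "continuous_on UNIV \<psi>" "\<And>x. x \<notin> L \<Longrightarrow> \<psi> x = 0"
  shows "integral\<^sup>L (energy_measure V \<Omega> \<epsilon> u) \<psi> = (LINT x|lborel. \<psi> x * e x)"
proof -
  have e: "e \<in> borel_measurable (restrict_space lborel \<Omega>)"
    using borel_measurable_continuous_on_restrict[OF continuous_energy]
    by (simp cong: measurable_cong_sets add: sets_restrict_space_cong[OF sets_lborel])
  have "\<psi> \<in> borel_measurable (restrict_space lborel \<Omega>)"
    using borel_measurable_continuous_onI[OF \<psi>(1)] by (intro measurable_restrict_space1) simp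
  then have "integral\<^sup>L (energy_measure V \<Omega> \<epsilon> u) \<psi> = (LINT x|restrict_space lborel \<Omega>. e x *\<^sub>R \<psi> x)"
    unfolding energy_measure_def by (intro integral_density e AE_I2 energy_bounds)
  also have "\<dots> = (LINT x|lborel. indicator \<Omega> x *\<^sub>R (e x *\<^sub>R \<psi> x))"
    using open_domain by (intro integral_restrict_space) simp
  also have "\<dots> = (LINT x|lborel. \<psi> x * e x)"
  proof (rule Bochner_Integration.integral_cong[OF refl])
    show "indicator \<Omega> x *\<^sub>R (e x *\<^sub>R \<psi> x) = \<psi> x * e x" for x
      using L(2) \<psi>(2)[of x] by (cases "x \<in> L") (auto simp: mult.commute)
  qed
  finally show ?thesis .
qed

text \<open>The Hessian bound is applied to each partial derivative of \<open>u\<close>. Its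
  compensating term, multiplied by \<open>\<epsilon>\<close>, is at most \<open>C * G\<close> times
  \<open>V (u x) / \<epsilon>\<close> by the bound on the rescaled gradient. The Hessian term
  becomes, by \<open>hessian_identity\<close>, the integral of \<open>V\<close> against the
  Laplacian of the cutoff, and \<open>V (u x) \<le> \<epsilon> * e x\<close> provides the second
  power of \<open>\<epsilon>\<close>.\<close>

lemma cutoff_energy_estimate:
  assumes \<phi>: "is_cutoff K W L \<phi> \<phi>' \<phi>''" and W: "W \<subseteq> \<Omega>"
    and G: "\<And>x i. x \<in> L \<Longrightarrow> \<epsilon>\<^sup>2 * (norm (p i x))\<^sup>2 \<le> G"
    and B: "\<And>x. x \<in> L \<Longrightarrow> norm (u x) \<le> B"
    and c: "0 < c" "0 \<le> C" "\<And>y v. norm y \<le> B \<Longrightarrow> c * (norm v)\<^sup>2 \<le> v \<bullet> (hessian V y *v v) + C * V y * (norm v)\<^sup>2"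
  shows "c * (LINT x|lborel. \<phi> x * e x) \<le> \<epsilon>\<^sup>2 * (LINT x|lborel. \<bar>\<Sum>i\<in>UNIV. \<phi>'' i x\<bar> * e x)
      + (2 * C * G + c) * (LINT x|lborel. \<phi> x * (V (u x) / \<epsilon>))"
proof -
  from \<phi> have L: "compact L" "L \<subseteq> \<Omega>" and cont: "continuous_on UNIV \<phi>" "\<And>i. continuous_on UNIV (\<phi>' i)" "\<And>i. continuous_on UNIV (\<phi>'' i)"
    and pd: "\<And>i x. has_pd i \<phi> (\<phi>' i x) x" "\<And>i x. has_pd i (\<phi>' i) (\<phi>'' i x) x"
    and out: "\<And>x. x \<notin> L \<Longrightarrow> \<phi> x = 0" "\<And>i x. x \<notin> L \<Longrightarrow> \<phi>' i x = 0" "\<And>i x. x \<notin> L \<Longrightarrow> \<phi>'' i x = 0"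
    and nn: "\<And>x. 0 \<le> \<phi> x"
    using W unfolding is_cutoff_def by auto
  let ?A = "\<lambda>x. (\<Sum>i\<in>UNIV. p i x \<bullet> (hessian V (u x) *v p i x)) + (norm (gradient V (u x)))\<^sup>2 / \<epsilon>\<^sup>2"
  have sub: "continuous_on L g" if "continuous_on \<Omega> g" for g :: "real^2 \<Rightarrow> real"
    using that L(2) by (rule continuous_on_subset)
  have subU: "continuous_on L g" if "continuous_on UNIV g" for g :: "real^2 \<Rightarrow> real"
    using that by (rule continuous_on_subset) simp
  have cA: "continuous_on \<Omega> ?A"
    unfolding inner_vec_def matrix_vector_mult_def hessian_def
    by (simp, intro continuous_intros continuous continuous_comp) (use eps_pos in auto)
  have cVe: "continuous_on \<Omega> (\<lambda>x. V (u x) / \<epsilon>)" by (intro continuous_intros continuous_comp) (use eps_pos in auto)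
  have i1: "integrable lborel (\<lambda>x. \<phi> x * g x)" if "continuous_on \<Omega> g" for g
    by (intro integrable_compact_support[OF L(1)] continuous_on_mult subU[OF cont(1)] sub that) (simp add: out)
  have i2: "integrable lborel (\<lambda>x. \<bar>\<Sum>i\<in>UNIV. \<phi>'' i x\<bar> * g x)" "integrable lborel (\<lambda>x. (\<Sum>i\<in>UNIV. \<phi>'' i x) * g x)"
    if "continuous_on \<Omega> g" for g
    by (intro integrable_compact_support[OF L(1)] continuous_intros subU[OF cont(3)] sub that; simp add: out)+
  have point: "\<phi> x * (c * e x) \<le> \<epsilon> / 2 * (\<phi> x * ?A x) + (C * G + c) * (\<phi> x * (V (u x) / \<epsilon>))" for x
  proof (cases "x \<in> L")
    case True
    have V: "0 \<le> V (u x)" by (rule V_nonneg)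
    have "c * (\<epsilon> * (norm (p i x))\<^sup>2) \<le> \<epsilon> * (p i x \<bullet> (hessian V (u x) *v p i x)) + C * G * (V (u x) / \<epsilon>)" for i
    proof -
      have "\<epsilon> * (c * (norm (p i x))\<^sup>2) \<le> \<epsilon> * (p i x \<bullet> (hessian V (u x) *v p i x) + C * V (u x) * (norm (p i x))\<^sup>2)"
        using c(3)[OF B[OF True]] eps_pos by (intro mult_left_mono) auto
      moreover have "\<epsilon> * (C * V (u x) * (norm (p i x))\<^sup>2) = C * (V (u x) / \<epsilon>) * (\<epsilon>\<^sup>2 * (norm (p i x))\<^sup>2)"
        using eps_pos by (simp add: power2_eq_square)
      moreover have "\<dots> \<le> C * (V (u x) / \<epsilon>) * G"
        using G[OF True] c V eps_pos by (intro mult_left_mono) auto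
      ultimately show ?thesis by (simp add: algebra_simps)
    qed
    from this[of 1] this[of 2]
    have "c * (\<epsilon> * ((norm (p 1 x))\<^sup>2 + (norm (p 2 x))\<^sup>2))
        \<le> \<epsilon> * (\<Sum>i\<in>UNIV. p i x \<bullet> (hessian V (u x) *v p i x)) + 2 * (C * G * (V (u x) / \<epsilon>))"
      unfolding sum_2 distrib_left by linarith
    moreover have "0 \<le> \<epsilon> * ((norm (gradient V (u x)))\<^sup>2 / \<epsilon>\<^sup>2)" using eps_pos by simp
    ultimately have A: "c * (\<epsilon> * ((norm (p 1 x))\<^sup>2 + (norm (p 2 x))\<^sup>2)) \<le> \<epsilon> * ?A x + 2 * (C * G * (V (u x) / \<epsilon>))"
      unfolding distrib_left[of \<epsilon>] by linarith
    have "c * e x = c * (\<epsilon> * ((norm (p 1 x))\<^sup>2 + (norm (p 2 x))\<^sup>2)) / 2 + c * (V (u x) / \<epsilon>)"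
      by (simp add: energy_density_def sum_2 distrib_left)
    also have "\<dots> \<le> (\<epsilon> * ?A x + 2 * (C * G * (V (u x) / \<epsilon>))) / 2 + c * (V (u x) / \<epsilon>)"
      by (intro add_right_mono divide_right_mono A) simp
    also have "\<dots> = \<epsilon> / 2 * ?A x + (C * G + c) * (V (u x) / \<epsilon>)"
      by (simp only: add_divide_distrib distrib_right) simp
    finally have "c * e x \<le> \<epsilon> / 2 * ?A x + (C * G + c) * (V (u x) / \<epsilon>)" .
    from mult_left_mono[OF this nn[of x]] show ?thesis by (simp add: distrib_left mult_ac)
  qed (simp add: out)
  have "c * (LINT x|lborel. \<phi> x * e x) = (LINT x|lborel. \<phi> x * (c * e x))"
    by (subst integral_mult_right_zero[symmetric]) (simp add: mult_ac)
  also have "\<dots> \<le> (LINT x|lborel. \<epsilon> / 2 * (\<phi> x * ?A x) + (C * G + c) * (\<phi> x * (V (u x) / \<epsilon>)))"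
    by (rule integral_mono[OF _ _ point])
      (intro i1 continuous_intros continuous_energy Bochner_Integration.integrable_add integrable_mult_right cA cVe)+
  also have "\<dots> = \<epsilon> / 2 * (LINT x|lborel. \<phi> x * ?A x) + (C * G + c) * (LINT x|lborel. \<phi> x * (V (u x) / \<epsilon>))"
    by (subst Bochner_Integration.integral_add)
      (intro integrable_mult_right i1 cA cVe | simp only: integral_mult_right_zero)+
  also have "(LINT x|lborel. \<phi> x * ?A x) = (LINT x|lborel. (\<Sum>i\<in>UNIV. \<phi>'' i x) * V (u x))"
    by (rule hessian_identity[OF L cont pd out])
  also have "\<dots> \<le> (LINT x|lborel. \<epsilon> * (\<bar>\<Sum>i\<in>UNIV. \<phi>'' i x\<bar> * e x))"
  proof (rule integral_mono)
    show "(\<Sum>i\<in>UNIV. \<phi>'' i x) * V (u x) \<le> \<epsilon> * (\<bar>\<Sum>i\<in>UNIV. \<phi>'' i x\<bar> * e x)" for x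
    proof -
      have "V (u x) \<le> \<epsilon> * e x" using energy_bounds(2)[of x] eps_pos by (simp add: pos_divide_le_eq mult.commute)
      then have "\<bar>\<Sum>i\<in>UNIV. \<phi>'' i x\<bar> * V (u x) \<le> \<bar>\<Sum>i\<in>UNIV. \<phi>'' i x\<bar> * (\<epsilon> * e x)" by (intro mult_left_mono) auto
      moreover have "(\<Sum>i\<in>UNIV. \<phi>'' i x) * V (u x) \<le> \<bar>\<Sum>i\<in>UNIV. \<phi>'' i x\<bar> * V (u x)"
        using V_nonneg by (intro mult_right_mono) auto
      ultimately show ?thesis by (simp add: mult_ac)
    qed
  qed (intro i2 integrable_mult_right continuous_comp continuous_energy)+
  also have "\<dots> = \<epsilon> * (LINT x|lborel. \<bar>\<Sum>i\<in>UNIV. \<phi>'' i x\<bar> * e x)" by simp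
  finally have 1: "c * (LINT x|lborel. \<phi> x * e x)
      \<le> \<epsilon> / 2 * (\<epsilon> * (LINT x|lborel. \<bar>\<Sum>i\<in>UNIV. \<phi>'' i x\<bar> * e x)) + (C * G + c) * (LINT x|lborel. \<phi> x * (V (u x) / \<epsilon>))"
    using eps_pos by (simp add: mult_left_mono)
  have nnV: "0 \<le> (LINT x|lborel. \<phi> x * (V (u x) / \<epsilon>))"
    using nn V_nonneg eps_pos by (intro Bochner_Integration.integral_nonneg) simp
  have nne: "0 \<le> \<epsilon>\<^sup>2 * (LINT x|lborel. \<bar>\<Sum>i\<in>UNIV. \<phi>'' i x\<bar> * e x)"
    using energy_bounds by (intro mult_nonneg_nonneg Bochner_Integration.integral_nonneg) auto
  \<comment> \<open>Passing from \<open>C * G\<close> to \<open>2 * C * G\<close> needs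
    \<open>0 \<le> G\<close>, which the assumption on \<open>G\<close> yields only if
    \<open>L\<close> has a point.\<close>
  show ?thesis
  proof (cases "L = {}")
    case True
    then have "\<phi> = (\<lambda>_. 0)" "\<phi>'' i = (\<lambda>_. 0)" for i using out by auto
    then show ?thesis by simp
  next
    case False
    then obtain x where "x \<in> L" by blast
    from G[OF this] have "0 \<le> G" by (meson order_trans zero_le_mult_iff zero_le_power2)
    then have "0 \<le> C * G * (LINT x|lborel. \<phi> x * (V (u x) / \<epsilon>))"
      using c(2) nnV by (intro mult_nonneg_nonneg)
    moreover define I where "I = (LINT x|lborel. \<phi> x * (V (u x) / \<epsilon>))"
    moreover define J where "J = (LINT x|lborel. \<bar>\<Sum>i\<in>UNIV. \<phi>'' i x\<bar> * e x)"
    moreover have "\<epsilon> / 2 * (\<epsilon> * J) = \<epsilon>\<^sup>2 * J / 2" by (simp add: power2_eq_square)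
    moreover have "(2 * C * G + c) * I = (C * G + c) * I + C * G * I" by (simp add: distrib_right)
    ultimately show ?thesis using 1 nne by (simp only:)
  qed
qed

end

section \<open>Isolated pieces carry no mass\<close>

lemma potential_nonneg:
  assumes "potential V" shows "0 \<le> V y"
proof -
  have "(INF y. V y) \<le> V y" using assms by (intro cINF_lower) (auto simp: potential_def)
  then show ?thesis using assms by (simp add: potential_def)
qed

lemma setting_allen_cahn:
  assumes V: "potential V" and s: "limit_measure_setting V \<Omega> M \<epsilon> u \<nu>"
  shows "allen_cahn V \<Omega> (\<epsilon> n) (u n)"
proof
  show "open \<Omega>" "0 < \<epsilon> n" "smooth_on \<Omega> (u n)"
    using s by (auto simp: limit_measure_setting_def smooth_bounded_domain_def)
  show "smooth_on UNIV V" using V by (simp add: potential_def)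
  show "0 \<le> V y" for y by (rule potential_nonneg[OF V])
  fix x assume "x \<in> \<Omega>"
  then have "- laplacian (u n) x = - (1 / (\<epsilon> n)\<^sup>2) *\<^sub>R gradient V (u n x)"
    using s unfolding limit_measure_setting_def by blast
  then show "laplacian (u n) x = (1 / (\<epsilon> n)\<^sup>2) *\<^sub>R gradient V (u n x)"
    by (simp only: scaleR_minus_left neg_equal_iff_equal)
qed

lemma integral_energy_tendsto:
  assumes V: "potential V" and s: "limit_measure_setting V \<Omega> M \<epsilon> u \<nu>"
    and L: "compact L" "L \<subseteq> \<Omega>" and \<psi>: "continuous_on UNIV \<psi>" "\<And>x. x \<notin> L \<Longrightarrow> \<psi> x = 0"
  shows "(\<lambda>n. LINT x|lborel. \<psi> x * energy_density V (\<epsilon> n) (u n) x) \<longlonglongrightarrow> integral\<^sup>L \<nu> \<psi>"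
proof -
  have "{x. \<psi> x \<noteq> 0} \<subseteq> L" using \<psi>(2) by blast
  then have c: "closure {x. \<psi> x \<noteq> 0} \<subseteq> L" by (rule closure_minimal) (rule compact_imp_closed[OF L(1)])
  have "compact (closure {x. \<psi> x \<noteq> 0})"
    using compact_Int_closed[OF L(1) closed_closure] c by (metis Int_absorb1 closure_closure)
  moreover have "closure {x. \<psi> x \<noteq> 0} \<subseteq> \<Omega>" using c L(2) by (rule order_trans)
  moreover have "measures_converge_on \<Omega> (\<lambda>n. energy_measure V \<Omega> (\<epsilon> n) (u n)) \<nu>"
    using s by (simp add: limit_measure_setting_def)
  ultimately have "(\<lambda>n. integral\<^sup>L (energy_measure V \<Omega> (\<epsilon> n) (u n)) \<psi>) \<longlonglongrightarrow> integral\<^sup>L \<nu> \<psi>"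
    using \<psi>(1) unfolding measures_converge_on_def by blast
  moreover have "integral\<^sup>L (energy_measure V \<Omega> (\<epsilon> n) (u n)) \<psi> = (LINT x|lborel. \<psi> x * energy_density V (\<epsilon> n) (u n) x)" for n
    by (rule allen_cahn.integral_energy_measure[OF setting_allen_cahn[OF V s] L \<psi>])
  ultimately show ?thesis by simp
qed

lemma partial_derivs_bounded:
  fixes V :: "real^'k \<Rightarrow> real"
  assumes "smooth_on UNIV V"
  shows "\<exists>Q. \<forall>a y. norm y \<le> B \<longrightarrow> \<bar>partial_deriv a V y\<bar> \<le> Q"
proof -
  have "\<exists>q\<ge>0. \<forall>y. norm y \<le> B \<longrightarrow> \<bar>partial_deriv a V y\<bar> \<le> q" for a
  proof -
    have "continuous_on (cball 0 B) (partial_deriv a V)"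
      using smooth_on_imp_continuous_on[OF smooth_on_partial_deriv[OF assms]] by (rule continuous_on_subset) simp
    from compact_imp_bounded[OF compact_continuous_image[OF this compact_cball]]
    obtain q where "\<And>z. z \<in> partial_deriv a V ` cball 0 B \<Longrightarrow> norm z \<le> q" by (auto simp: bounded_iff)
    then show ?thesis by (intro exI[of _ "max 0 q"]) (auto simp: max.coboundedI2)
  qed
  then obtain q where q: "\<And>a. 0 \<le> q a" "\<And>a y. norm y \<le> B \<Longrightarrow> \<bar>partial_deriv a V y\<bar> \<le> q a" by metis
  have "q a \<le> (\<Sum>a\<in>UNIV. q a)" for a by (intro member_le_sum q) auto
  with q(2) show ?thesis by (meson order_trans)
qed

lemma uniform_bounds:
  assumes V: "potential V" and s: "limit_measure_setting V \<Omega> M \<epsilon> u \<nu>" and L: "compact L" "L \<subseteq> \<Omega>"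
  shows "\<exists>B G. \<forall>n i. \<forall>x\<in>L. norm (u n x) \<le> B \<and> (\<epsilon> n)\<^sup>2 * (norm (partial_deriv i (u n) x))\<^sup>2 \<le> G"
proof -
  have \<Omega>: "open \<Omega>" and M: "0 < M" and \<epsilon>: "\<And>n. \<epsilon> n \<le> 1" and E: "\<And>n. emeasure (energy_measure V \<Omega> (\<epsilon> n) (u n)) \<Omega> \<le> ennreal M"
    using s by (auto simp: limit_measure_setting_def smooth_bounded_domain_def)
  note ac = setting_allen_cahn[OF V s]
  obtain \<alpha> R where \<alpha>: "0 < \<alpha>" "0 < R" and grow: "\<And>y. norm y > R \<Longrightarrow> y \<bullet> gradient V y \<ge> \<alpha> * (norm y)\<^sup>2"
    using V unfolding potential_def by blast
  obtain s0 where s0: "0 < s0" "(\<Union>x\<in>L. ball x s0) \<subseteq> \<Omega>"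
    by (rule compact_subset_open_imp_ball_epsilon_subset[OF L(1) \<Omega> L(2)])
  \<comment> \<open>Each point of \<open>ball x (3 * s)\<close> needs its own disc of radius
    \<open>2 * s\<close> for \<open>sup_bound\<close>, and \<open>gradient_bound\<close> needs
    \<open>cball x (2 * s)\<close> inside \<open>ball x (3 * s)\<close>; radius \<open>6 * s\<close>
    leaves room for both.\<close>
  define s where "s = s0 / 6"
  have sp: "0 < s" using s0 by (simp add: s_def)
  have in\<Omega>: "ball x (6 * s) \<subseteq> \<Omega>" if "x \<in> L" for x using s0(2) that by (auto simp: s_def)
  define c where "c = (LINT z|lborel. kernel2 z)"
  have c: "0 < c" using kernel2_mass_pos by (simp add: c_def)
  define B where "B = sqrt (R\<^sup>2 + 1 + 2 * M / (\<alpha> * s\<^sup>2 * c))"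
  have uB: "norm (u n y) \<le> B" if x: "x \<in> L" and y: "y \<in> ball x (3 * s)" for n x y
  proof -
    have "cball y (2 * s) \<subseteq> ball x (6 * s)"
    proof
      fix z assume "z \<in> cball y (2 * s)"
      then show "z \<in> ball x (6 * s)" using y sp dist_triangle[of x z y] by auto
    qed
    then have "cball y (2 * s) \<subseteq> \<Omega>" using in\<Omega>[OF x] by (rule order_trans)
    from allen_cahn.sup_bound[OF ac \<alpha> grow this sp \<epsilon> E] M
    show ?thesis unfolding B_def by (intro real_le_rsqrt) (simp add: c_def)
  qed
  obtain Q where Q: "\<And>a y. norm y \<le> B \<Longrightarrow> \<bar>partial_deriv a V y\<bar> \<le> Q"
    using partial_derivs_bounded[of V B] V by (auto simp: potential_def)
  define D where "D = 16 * (B / s + s * Q) / c"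
  have D: "\<epsilon> n * \<bar>partial_deriv i (u n) x $ a\<bar> \<le> D" if x: "x \<in> L" for n i x a
  proof -
    have "ball x (3 * s) \<subseteq> ball x (6 * s)" "cball x (2 * s) \<subseteq> ball x (3 * s)" using sp by auto
    then have "ball x (3 * s) \<subseteq> \<Omega>" using in\<Omega>[OF x] by blast
    from allen_cahn.gradient_bound[OF ac open_ball this \<open>cball x (2 * s) \<subseteq> ball x (3 * s)\<close> sp \<epsilon> uB[OF x] Q]
    show ?thesis unfolding D_def c_def[symmetric] pos_le_divide_eq[OF c] .
  qed
  have "(\<epsilon> n)\<^sup>2 * (norm (partial_deriv i (u n) x))\<^sup>2 \<le> (\<Sum>a\<in>(UNIV::'a set). D\<^sup>2)" if x: "x \<in> L" for n i x
  proof -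
    have "(\<epsilon> n)\<^sup>2 * (norm (partial_deriv i (u n) x))\<^sup>2 = (\<Sum>a\<in>UNIV. (\<epsilon> n * \<bar>partial_deriv i (u n) x $ a\<bar>)\<^sup>2)"
      unfolding power2_norm_eq_inner inner_vec_def sum_distrib_left
      by (intro sum.cong refl) (simp add: power_mult_distrib power2_eq_square[symmetric])
    also have "\<dots> \<le> (\<Sum>a\<in>(UNIV::'a set). D\<^sup>2)"
      using D[OF x] allen_cahn.eps_pos[OF ac] by (intro sum_mono power_mono mult_nonneg_nonneg) (auto intro: less_imp_le)
    finally show ?thesis .
  qed
  moreover have "norm (u n x) \<le> B" if "x \<in> L" for n x using uB[OF that, of x] sp by simp
  ultimately show ?thesis by blast
qed

text \<open>The cutoff has its gradient where the limit measure vanishes, so the right-hand side of the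
  Pohozaev identity tends to zero and with it the potential part of the energy.\<close>

lemma isolated_piece_null:
  assumes V: "potential V" and s: "limit_measure_setting V \<Omega> M \<epsilon> u \<nu>"
    and K: "compact K" and W: "open W" "K \<subseteq> W" "W \<subseteq> \<Omega>" and null: "emeasure \<nu> (W - K) = 0"
  shows "emeasure \<nu> K = 0"
proof -
  note ac = setting_allen_cahn[OF V s]
  let ?e = "\<lambda>n. energy_density V (\<epsilon> n) (u n)"
  have \<Omega>: "open \<Omega>" and \<epsilon>: "\<epsilon> \<longlonglongrightarrow> 0" "\<And>n. 0 < \<epsilon> n" and rad: "radon_measure_on \<Omega> \<nu>"
    using s by (auto simp: limit_measure_setting_def smooth_bounded_domain_def)
  have sets: "sets \<nu> = sets (restrict_space borel \<Omega>)" using rad by (simp add: radon_measure_on_def)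
  have space: "space \<nu> = \<Omega>" using sets_eq_imp_space_eq[OF sets] by (simp add: space_restrict_space)
  have inS: "A \<in> sets \<nu>" if "A \<in> sets borel" "A \<subseteq> \<Omega>" for A
    using that \<Omega> unfolding sets by (simp add: sets_restrict_space_iff)
  obtain L \<phi> \<phi>' \<phi>'' where cut: "is_cutoff K W L \<phi> \<phi>' \<phi>''" using cutoff_exists[OF K W(1,2)] by blast
  from cut have L: "compact L" "L \<subseteq> W" and cont: "continuous_on UNIV \<phi>" "\<And>i. continuous_on UNIV (\<phi>' i)" "\<And>i. continuous_on UNIV (\<phi>'' i)"
    and pd: "\<And>i x. has_pd i \<phi> (\<phi>' i x) x" "\<And>i x. has_pd i (\<phi>' i) (\<phi>'' i x) x"
    and out: "\<And>x. x \<notin> L \<Longrightarrow> \<phi> x = 0" "\<And>i x. x \<notin> L \<Longrightarrow> \<phi>' i x = 0" "\<And>i x. x \<notin> L \<Longrightarrow> \<phi>'' i x = 0"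
    and range: "\<And>x. 0 \<le> \<phi> x" "\<And>x. \<phi> x \<le> 1" and onK: "\<And>x. x \<in> K \<Longrightarrow> \<phi> x = 1" "\<And>i x. x \<in> K \<Longrightarrow> \<phi>' i x = 0"
    unfolding is_cutoff_def by auto
  have L\<Omega>: "L \<subseteq> \<Omega>" using L(2) W(3) by (rule order_trans)
  note lim = integral_energy_tendsto[OF V s L(1) L\<Omega>]
  have lim1: "(\<lambda>n. LINT x|lborel. (\<Sum>i\<in>UNIV. \<bar>\<phi>' i x\<bar>) * ?e n x) \<longlonglongrightarrow> 0"
  proof -
    have "(\<lambda>n. LINT x|lborel. (\<Sum>i\<in>UNIV. \<bar>\<phi>' i x\<bar>) * ?e n x) \<longlonglongrightarrow> integral\<^sup>L \<nu> (\<lambda>x. \<Sum>i\<in>UNIV. \<bar>\<phi>' i x\<bar>)"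
      by (intro lim continuous_intros cont) (simp add: out)
    moreover have "integral\<^sup>L \<nu> (\<lambda>x. \<Sum>i\<in>UNIV. \<bar>\<phi>' i x\<bar>) = 0"
    proof (rule integral_eq_zero_AE, rule AE_I)
      show "{x \<in> space \<nu>. (\<Sum>i\<in>UNIV. \<bar>\<phi>' i x\<bar>) \<noteq> 0} \<subseteq> W - K"
      proof
        fix x assume x: "x \<in> {x \<in> space \<nu>. (\<Sum>i\<in>UNIV. \<bar>\<phi>' i x\<bar>) \<noteq> 0}"
        then have "x \<in> L" using out(2)[of x] by (cases "x \<in> L") simp_all
        moreover have "x \<notin> K" using x onK(2)[of x] by auto
        ultimately show "x \<in> W - K" using L(2) by blast
      qed
      show "W - K \<in> sets \<nu>" using W K by (intro inS) (auto dest: compact_imp_closed)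
    qed (rule null)
    ultimately show ?thesis by simp
  qed
  obtain r where r: "\<And>x. x \<in> L \<Longrightarrow> norm x \<le> r" using compact_imp_bounded[OF L(1)] by (auto simp: bounded_iff)
  have coord: "\<bar>x $ j\<bar> \<le> r" if "x \<in> L" for x and j :: 2
    using component_le_norm_cart[of x j] r[OF that] by linarith
  let ?P = "\<lambda>n. LINT x|lborel. \<phi> x * (V (u n x) / \<epsilon> n)"
  have lim2: "?P \<longlonglongrightarrow> 0"
  proof (rule tendsto_sandwich)
    show "\<forall>\<^sub>F n in sequentially. 0 \<le> ?P n"
      using range(1) potential_nonneg[OF V] \<epsilon>(2)
      by (intro always_eventually allI Bochner_Integration.integral_nonneg) (simp add: less_imp_le)
    show "\<forall>\<^sub>F n in sequentially. ?P n \<le> 5 * r / 2 * (LINT x|lborel. (\<Sum>i\<in>UNIV. \<bar>\<phi>' i x\<bar>) * ?e n x)"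
    proof (intro always_eventually allI)
      fix n
      have half: "a \<le> 5 * r / 2 * b" if "2 * a \<le> 5 * r * b" for a b :: real using that by simp
      have "2 * ?P n \<le> 5 * r * (LINT x|lborel. (\<Sum>i\<in>UNIV. \<bar>\<phi>' i x\<bar>) * ?e n x)"
        by (rule allen_cahn.pohozaev[OF ac L(1) L\<Omega> cont(1,2) pd(1) out(1,2) coord])
      then show "?P n \<le> 5 * r / 2 * (LINT x|lborel. (\<Sum>i\<in>UNIV. \<bar>\<phi>' i x\<bar>) * ?e n x)" by (rule half)
    qed
    show "(\<lambda>n. 5 * r / 2 * (LINT x|lborel. (\<Sum>i\<in>UNIV. \<bar>\<phi>' i x\<bar>) * ?e n x)) \<longlonglongrightarrow> 0"
      using tendsto_mult_left[OF lim1, of "5 * r / 2"] by simp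
  qed simp
  obtain B G where B: "\<And>n x. x \<in> L \<Longrightarrow> norm (u n x) \<le> B"
    and G: "\<And>n x i. x \<in> L \<Longrightarrow> (\<epsilon> n)\<^sup>2 * (norm (partial_deriv i (u n) x))\<^sup>2 \<le> G"
    using uniform_bounds[OF V s L(1) L\<Omega>] by blast
  obtain c C where c: "0 < c" "0 \<le> C"
    "\<And>y v. norm y \<le> B \<Longrightarrow> c * (norm v)\<^sup>2 \<le> v \<bullet> (hessian V y *v v) + C * V y * (norm v)\<^sup>2"
    using hessian_lower_bound[of V B] V potential_nonneg[OF V] by (auto simp: potential_def)
  let ?J = "\<lambda>n. LINT x|lborel. \<bar>\<Sum>i\<in>UNIV. \<phi>'' i x\<bar> * ?e n x"
  have lim3: "?J \<longlonglongrightarrow> integral\<^sup>L \<nu> (\<lambda>x. \<bar>\<Sum>i\<in>UNIV. \<phi>'' i x\<bar>)"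
    by (intro lim continuous_intros cont) (simp add: out)
  have lim4: "(\<lambda>n. c * (LINT x|lborel. \<phi> x * ?e n x)) \<longlonglongrightarrow> c * integral\<^sup>L \<nu> \<phi>"
    by (intro tendsto_mult_left lim cont out)
  \<comment> \<open>The integrals \<open>?J\<close> of the second derivatives do not tend to zero in
    general, but they converge, so the factor \<open>(\<epsilon> n)\<^sup>2\<close> removes
    them.\<close>
  have lim5: "(\<lambda>n. (\<epsilon> n)\<^sup>2 * ?J n + (2 * C * G + c) * ?P n) \<longlonglongrightarrow> 0"
    using tendsto_add[OF tendsto_mult[OF tendsto_power[OF \<epsilon>(1), of 2] lim3] tendsto_mult_left[OF lim2, of "2 * C * G + c"]]
    by simp
  have "c * integral\<^sup>L \<nu> \<phi> \<le> 0"
  proof (rule LIMSEQ_le[OF lim4 lim5], intro exI[of _ 0] allI impI)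
    fix n
    show "c * (LINT x|lborel. \<phi> x * ?e n x) \<le> (\<epsilon> n)\<^sup>2 * ?J n + (2 * C * G + c) * ?P n"
      by (rule allen_cahn.cutoff_energy_estimate[OF ac cut W(3) G B c])
  qed
  then have "integral\<^sup>L \<nu> \<phi> \<le> 0" using c(1) by (simp add: mult_le_0_iff)
  moreover have "0 \<le> integral\<^sup>L \<nu> \<phi>" by (rule Bochner_Integration.integral_nonneg[OF range(1)])
  ultimately have int0: "integral\<^sup>L \<nu> \<phi> = 0" by linarith
  have Ls: "L \<in> sets \<nu>" using L(1) L\<Omega> by (intro inS) (auto dest: compact_imp_closed)
  \<comment> \<open>The integral of a non-integrable function is zero by convention, so
    \<open>int0\<close> is informative only together with integrability.\<close>
  have "integrable \<nu> \<phi>"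
  proof (rule Bochner_Integration.integrable_bound)
    have "emeasure \<nu> L < \<infinity>" using rad L(1) L\<Omega> unfolding radon_measure_on_def by blast
    then show "integrable \<nu> (indicat_real L)" using Ls by (rule integrable_real_indicator[rotated])
    have "\<phi> \<in> borel_measurable (restrict_space borel \<Omega>)"
      by (intro measurable_restrict_space1 borel_measurable_continuous_onI cont)
    then show "\<phi> \<in> borel_measurable \<nu>" by (simp cong: measurable_cong_sets add: sets)
    show "AE x in \<nu>. norm (\<phi> x) \<le> norm (indicat_real L x)"
      using range out(1) by (intro AE_I2) (auto simp: indicator_def)
  qed
  with int0 range(1) have "AE x in \<nu>. \<phi> x = 0" by (subst (asm) integral_nonneg_eq_0_iff_AE) auto
  then have "AE x in \<nu>. x \<notin> K" by eventually_elim (use onK(1) in auto)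
  moreover have "K \<in> sets \<nu>" using K W by (intro inS) (auto dest: compact_imp_closed)
  ultimately have "K \<in> null_sets \<nu>" using AE_iff_null_sets by blast
  then show ?thesis by (rule null_setsD1)
qed

section \<open>The concentration set\<close>

text \<open>Compactness first gives a finite cover, hence bounded radii. The fivefold enlargements
  of the disjoint intervals selected from it still cover, and each has length
  \<open>10 * \<rho> t\<close>.\<close>

lemma Vitali_disjoint_radii:
  fixes \<rho> :: "real \<Rightarrow> real"
  assumes ab: "a < b" and \<rho>: "\<And>t. t \<in> {a..b} \<Longrightarrow> 0 < \<rho> t"
  shows "\<exists>C. finite C \<and> C \<subseteq> {a..b} \<and>
    pairwise (\<lambda>s t. disjnt (cball s (\<rho> s)) (cball t (\<rho> t))) C \<and> b - a \<le> (\<Sum>t\<in>C. 10 * \<rho> t)"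
proof -
  have "{a..b} \<subseteq> (\<Union>t\<in>{a..b}. ball t (\<rho> t))" using \<rho> by force
  then obtain I where I: "I \<subseteq> {a..b}" "finite I" "{a..b} \<subseteq> (\<Union>t\<in>I. ball t (\<rho> t))"
    using compactE_image[OF compact_Icc, of "{a..b}" "\<lambda>t. ball t (\<rho> t)" a b] by auto
  have cov: "{a..b} \<subseteq> (\<Union>t\<in>I. cball t (\<rho> t))" 
    by (rule order_trans[OF I(3)], rule UN_mono[OF order_refl ball_subset_cball])
  have bound: "0 < \<rho> t \<and> \<rho> t \<le> Max (\<rho> ` I)" if "t \<in> I" for t

  proof
    show "0 < \<rho> t" using that I(1) \<rho> by blast
    show "\<rho> t \<le> Max (\<rho> ` I)" using that I(2) by (intro Max_ge) auto
  qed
  obtain C where C: "C \<subseteq> I" "pairwise (\<lambda>s t. disjnt (cball s (\<rho> s)) (cball t (\<rho> t))) C"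
      "{a..b} \<subseteq> (\<Union>t\<in>C. cball t (5 * \<rho> t))"
    by (rule Vitali_covering_lemma_cballs[OF cov bound])
  have fC: "finite C" using C(1) I(2) by (rule finite_subset)
  have "ennreal (b - a) = emeasure lborel {a..b}" using ab by simp
  also have "\<dots> \<le> emeasure lborel (\<Union>t\<in>C. cball t (5 * \<rho> t))"
    using C(3) fC by (intro emeasure_mono) auto
  also have "\<dots> \<le> (\<Sum>t\<in>C. emeasure lborel (cball t (5 * \<rho> t)))"
    using fC by (intro emeasure_subadditive_finite) auto
  also have "\<dots> = (\<Sum>t\<in>C. ennreal (10 * \<rho> t))"
  proof (rule sum.cong[OF refl])
    fix t assume "t \<in> C"
    then have "0 < \<rho> t" using C(1) I(1) \<rho> by blast
    then show "emeasure lborel (cball t (5 * \<rho> t)) = ennreal (10 * \<rho> t)"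
      by (simp add: cball_eq_atLeastAtMost)
  qed
  also have "\<dots> = ennreal (\<Sum>t\<in>C. 10 * \<rho> t)"
    using C(1) I(1) \<rho> by (intro sum_ennreal) (auto intro!: less_imp_le)
  finally have le: "ennreal (b - a) \<le> ennreal (\<Sum>t\<in>C. 10 * \<rho> t)" .
  have "0 \<le> 10 * \<rho> t" if "t \<in> C" for t using \<rho>[of t] that C(1) I(1) by force
  then have "0 \<le> (\<Sum>t\<in>C. 10 * \<rho> t)" by (rule sum_nonneg)
  with le have "b - a \<le> (\<Sum>t\<in>C. 10 * \<rho> t)" by (simp only: ennreal_le_iff)
  moreover have "C \<subseteq> {a..b}" using C(1) I(1) by (rule order_trans)
  ultimately show ?thesis using fC C(2) by blast
qed

lemma finite_separation:
  fixes F :: "'a::metric_space set"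
  assumes "finite F"
  shows "\<exists>d>0. \<forall>x\<in>F. \<forall>y\<in>F. x \<noteq> y \<longrightarrow> d \<le> dist x y"
proof -
  let ?D = "insert 1 ((\<lambda>(x, y). dist x y) ` {z\<in>F \<times> F. fst z \<noteq> snd z})"
  have fin: "finite ?D" using assms by auto
  have "0 < Min ?D" using fin by (subst Min_gr_iff) auto
  moreover have "Min ?D \<le> dist x y" if "x \<in> F" "y \<in> F" "x \<noteq> y" for x y
    using fin that by (intro Min_le) force+
  ultimately show ?thesis by blast
qed

locale concentration =
  fixes V :: "real^'k \<Rightarrow> real" and \<Omega> :: "(real^2) set" and M :: real and \<epsilon> :: "nat \<Rightarrow> real"
    and u :: "nat \<Rightarrow> real^2 \<Rightarrow> real^'k" and \<nu> :: "(real^2) measure" and \<eta> :: real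
  assumes potential: "potential V" and setting: "limit_measure_setting V \<Omega> M \<epsilon> u \<nu>"
    and clearing_out: "clearing_out_constant V \<eta>"
begin

abbreviation S :: "(real^2) set" where "S \<equiv> concentration_set \<Omega> \<nu> \<eta>"

lemma open_domain: "open \<Omega>"
  using setting by (simp add: limit_measure_setting_def smooth_bounded_domain_def)

lemma eta_pos: "0 < \<eta>"
  using clearing_out by (simp add: clearing_out_constant_def)

lemma radon: "radon_measure_on \<Omega> \<nu>"
  using setting by (simp add: limit_measure_setting_def)

lemma sets_nu: "sets \<nu> = sets (restrict_space borel \<Omega>)"
  using radon by (simp add: radon_measure_on_def)

lemma finite_on_compact: "compact K \<Longrightarrow> K \<subseteq> \<Omega> \<Longrightarrow> emeasure \<nu> K < \<infinity>"
  using radon by (simp add: radon_measure_on_def)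

lemma in_sets: "A \<in> sets borel \<Longrightarrow> A \<subseteq> \<Omega> \<Longrightarrow> A \<in> sets \<nu>"
  using open_domain unfolding sets_nu by (simp add: sets_restrict_space_iff)

lemma clear:
  assumes "0 < r" "ball x r \<subseteq> \<Omega>" "emeasure \<nu> (cball x r \<inter> \<Omega>) < ennreal (\<eta> * r)"
  shows "emeasure \<nu> (cball x (r/2) \<inter> \<Omega>) = 0"
  using clearing_out[unfolded clearing_out_constant_def, THEN conjunct2, rule_format, OF setting] assms by simp

lemma cball_sets: "cball x r \<inter> \<Omega> \<in> sets \<nu>"
  using open_domain by (intro in_sets) auto

text \<open>Clearing-out passes smallness at one radius on to all small ones: if the bound failed at
  \<open>r\<close>, the disc of radius \<open>r/2\<close> would be null and the lower density at its
  centre zero.\<close>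

lemma density_lower_bound:
  assumes x: "x \<in> S" and r: "0 < r" "ball x r \<subseteq> \<Omega>"
  shows "ennreal (\<eta> * r) \<le> emeasure \<nu> (cball x r \<inter> \<Omega>)"
proof (rule ccontr)
  assume "\<not> ?thesis"
  with clear[OF r] have null: "emeasure \<nu> (cball x (r/2) \<inter> \<Omega>) = 0" by (simp add: not_le)
  have "\<forall>\<^sub>F t in at_right 0. emeasure \<nu> (cball x t \<inter> \<Omega>) / ennreal t = 0"
  proof (rule eventually_mono)
    show "\<forall>\<^sub>F t in at_right 0. t \<in> {0<..<r/2}" using r(1) by (intro eventually_at_right_real) simp
    fix t assume t: "t \<in> {0<..<r/2}"
    have "emeasure \<nu> (cball x t \<inter> \<Omega>) \<le> emeasure \<nu> (cball x (r/2) \<inter> \<Omega>)"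
      using t by (intro emeasure_mono cball_sets) auto
    with null show "emeasure \<nu> (cball x t \<inter> \<Omega>) / ennreal t = 0" by simp
  qed
  then have "Liminf (at_right 0) (\<lambda>t. emeasure \<nu> (cball x t \<inter> \<Omega>) / ennreal t) = Liminf (at_right (0::real)) (\<lambda>_. 0::ennreal)"
    by (rule Liminf_eq)
  then have "lower_density \<Omega> \<nu> x = 0" by (simp add: lower_density_def Liminf_const)
  with x eta_pos show False by (simp add: concentration_set_def)
qed

text \<open>A lower density below \<open>\<eta>\<close> provides a small radius at which
  clearing-out applies. The resulting null disc contains no point of \<open>S\<close> in its
  interior, since such a point would charge a smaller disc by
  \<open>density_lower_bound\<close>.\<close>

lemma null_disc_outside:
  assumes x: "x \<in> \<Omega>" "x \<notin> S"
  shows "\<exists>r>0. ball x r \<subseteq> \<Omega> \<and> emeasure \<nu> (ball x r) = 0 \<and> ball x r \<inter> S = {}"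
proof -
  let ?f = "\<lambda>r. emeasure \<nu> (cball x r \<inter> \<Omega>) / ennreal r"
  obtain r0 where r0: "0 < r0" "ball x r0 \<subseteq> \<Omega>" using open_domain x(1) openE by blast
  have "\<not> (\<forall>\<^sub>F r in at_right 0. ennreal \<eta> \<le> ?f r)"
    using x Liminf_bounded[of "ennreal \<eta>" ?f "at_right 0"] by (auto simp: concentration_set_def lower_density_def)
  moreover have "\<forall>\<^sub>F r in at_right 0. r \<in> {0<..<r0}" using eventually_at_right_real[OF r0(1)] .
  ultimately have "\<exists>r\<in>{0<..<r0}. \<not> ennreal \<eta> \<le> ?f r"
    by (metis (mono_tags, lifting) eventually_mono)
  then obtain r where r: "0 < r" "r < r0" "?f r < ennreal \<eta>" by (auto simp: not_le)
  have "emeasure \<nu> (cball x r \<inter> \<Omega>) < ennreal (\<eta> * r)"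
  proof (rule ccontr)
    assume "\<not> ?thesis"
    then have "ennreal (\<eta> * r) / ennreal r \<le> ?f r" by (intro divide_right_mono_ennreal) (simp add: not_less)
    moreover have "ennreal (\<eta> * r) / ennreal r = ennreal \<eta>" using r(1) eta_pos by (simp add: divide_ennreal)
    ultimately show False using r(3) by simp
  qed
  moreover have b: "ball x r \<subseteq> \<Omega>" using r0(2) r(2) by (auto simp: subset_iff)
  ultimately have null: "emeasure \<nu> (cball x (r/2) \<inter> \<Omega>) = 0" using clear r(1) by blast
  have sub: "ball x (r/2) \<subseteq> cball x (r/2) \<inter> \<Omega>" using b r(1) by (auto simp: subset_iff)
  have "y \<notin> S" if y: "y \<in> ball x (r/2)" for y
  proof
    assume yS: "y \<in> S"
    define t where "t = r/2 - dist x y"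
    have t: "0 < t" "cball y t \<subseteq> cball x (r/2)" "ball y t \<subseteq> ball x (r/2)"
    proof -
      show "0 < t" using y by (simp add: t_def)
      show "cball y t \<subseteq> cball x (r/2)" "ball y t \<subseteq> ball x (r/2)"
      proof safe
        fix z assume "z \<in> cball y t"
        then show "z \<in> cball x (r/2)" using dist_triangle[of x z y] by (simp add: t_def)
      next
        fix z assume "z \<in> ball y t"
        then show "z \<in> ball x (r/2)" using dist_triangle[of x z y] by (simp add: t_def)
      qed
    qed
    have "ennreal (\<eta> * t) \<le> emeasure \<nu> (cball y t \<inter> \<Omega>)"
      using t(3) sub by (intro density_lower_bound yS t(1)) blast
    also have "\<dots> \<le> emeasure \<nu> (cball x (r/2) \<inter> \<Omega>)" using t(2) by (intro emeasure_mono cball_sets) auto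
    finally show False using null t(1) eta_pos by (simp add: ennreal_eq_0_iff mult_le_0_iff)
  qed
  moreover have "emeasure \<nu> (ball x (r/2)) = 0"
    using emeasure_mono[OF sub cball_sets] null by simp
  ultimately show ?thesis using r(1) sub by (intro exI[of _ "r/2"]) auto
qed

lemma closed_Int_S:
  assumes "closed A" "A \<subseteq> \<Omega>" shows "closed (A \<inter> S)"
proof -
  have "open (- (A \<inter> S))"
    unfolding open_contains_ball
  proof
    fix x assume x: "x \<in> - (A \<inter> S)"
    show "\<exists>e>0. ball x e \<subseteq> - (A \<inter> S)"
    proof (cases "x \<in> A")
      case True
      then show ?thesis using null_disc_outside[of x] x assms(2) by blast
    next
      case False
      then obtain e where "0 < e" "ball x e \<subseteq> - A" using assms(1) open_contains_ball[of "- A"] by (auto simp: closed_def)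
      then show ?thesis by blast
    qed
  qed
  then show ?thesis by (simp add: closed_def)
qed

text \<open>An uncountable union of null discs need not be null, hence the passage to a countable
  subcover by Lindelof.\<close>

lemma null_outside:
  assumes A: "A \<subseteq> \<Omega> - S"
  shows "emeasure \<nu> A = 0"
proof -
  obtain r where r: "\<And>x. x \<in> \<Omega> - S \<Longrightarrow> 0 < r x \<and> ball x (r x) \<subseteq> \<Omega> \<and> emeasure \<nu> (ball x (r x)) = 0"
    using null_disc_outside by (metis DiffE)
  let ?F = "(\<lambda>x. ball x (r x)) ` (\<Omega> - S)"
  obtain F where F: "F \<subseteq> ?F" "countable F" "\<Union>F = \<Union>?F"
    using Lindelof[of ?F] by (metis (no_types, lifting) image_iff open_ball)
  have "B \<in> null_sets \<nu>" if "B \<in> F" for B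
    using that F(1) r by (auto simp: null_sets_def intro!: in_sets)
  then have "(\<Union>B\<in>F. B) \<in> null_sets \<nu>" by (intro null_sets_UN' F(2))
  then have "\<Union>F \<in> null_sets \<nu>" by simp
  moreover have "A \<subseteq> \<Union>F" using A r unfolding F(3) by force
  ultimately show ?thesis using emeasure_eq_0[of "\<Union>F" \<nu> A] by (simp add: null_sets_def)
qed

text \<open>Centres more than \<open>2 * h\<close> apart have disjoint closed discs of radius
  \<open>h\<close>, each of mass at least \<open>\<eta> * h\<close>.\<close>

lemma packing_bound:
  assumes F: "finite F" "F \<subseteq> S" and h: "0 < h" and sep: "\<And>x y. x \<in> F \<Longrightarrow> y \<in> F \<Longrightarrow> x \<noteq> y \<Longrightarrow> 2 * h < dist x y"
    and T: "T \<in> sets borel" "T \<subseteq> \<Omega>" "\<And>x. x \<in> F \<Longrightarrow> cball x h \<subseteq> T"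
  shows "ennreal (real (card F) * (\<eta> * h)) \<le> emeasure \<nu> T"
proof -
  have disj: "disjoint_family_on (\<lambda>x. cball x h) F"
    unfolding disjoint_family_on_def
  proof (intro ballI impI)
    fix x y assume xy: "x \<in> F" "y \<in> F" "x \<noteq> y"
    show "cball x h \<inter> cball y h = {}"
    proof (rule ccontr)
      assume "cball x h \<inter> cball y h \<noteq> {}"
      then obtain z where "dist x z \<le> h" "dist y z \<le> h" by auto
      then show False using sep[OF xy] dist_triangle2[of x y z] by linarith
    qed
  qed
  have s: "cball x h \<in> sets \<nu>" if "x \<in> F" for x using T(2) T(3)[OF that] by (intro in_sets) auto
  have "ennreal (real (card F) * (\<eta> * h)) = (\<Sum>x\<in>F. ennreal (\<eta> * h))"
    using eta_pos h by (simp add: ennreal_mult ennreal_of_nat_eq_real_of_nat)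
  also have "\<dots> \<le> (\<Sum>x\<in>F. emeasure \<nu> (cball x h))"
  proof (rule sum_mono)
    fix x assume x: "x \<in> F"
    have c: "cball x h \<subseteq> \<Omega>" using T(2) T(3)[OF x] by blast
    then have "ball x h \<subseteq> \<Omega>" using ball_subset_cball by blast
    from density_lower_bound[OF _ h this] F(2) x c
    show "ennreal (\<eta> * h) \<le> emeasure \<nu> (cball x h)" by (simp add: Int_absorb2 subsetD)
  qed
  also have "\<dots> = emeasure \<nu> (\<Union>x\<in>F. cball x h)"
    using s by (intro sum_emeasure disj F(1)) auto
  also have "\<dots> \<le> emeasure \<nu> T" using T by (intro emeasure_mono in_sets) auto
  finally show ?thesis .
qed

text \<open>If every circle met the concentration set in infinitely many points, then thin annuli would
  carry arbitrarily large mass per unit of width, and a Vitali covering of an interval of radii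
  would give infinite mass.\<close>

lemma good_radius:
  assumes r: "0 < r" "ball x\<^sub>0 (2 * r) \<subseteq> \<Omega>"
  shows "\<exists>t. r < t \<and> t < 2 * r \<and> finite (S \<inter> sphere x\<^sub>0 t)"
proof (rule ccontr)
  assume neg: "\<not> ?thesis"
  \<comment> \<open>Any annulus of half-width at most \<open>r/4\<close> around a radius in
    \<open>{a..b}\<close> stays in the closed disc of radius \<open>7/4 * r\<close>, which is
    compact in the domain and so has finite mass.\<close>
  define a where "a = 5/4 * r"
  define b where "b = 3/2 * r"
  have ab: "r < a" "a < b" "b + r/4 < 2 * r" using r by (auto simp: a_def b_def)
  let ?T = "cball x\<^sub>0 (b + r/4)"
  have T: "?T \<subseteq> \<Omega>" using r(2) ab by (auto simp: subset_iff)
  have "emeasure \<nu> ?T < \<infinity>" using T by (intro finite_on_compact) auto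
  then obtain m where m: "0 \<le> m" "emeasure \<nu> ?T = ennreal m" by (cases "emeasure \<nu> ?T") auto
  have inf: "infinite (S \<inter> sphere x\<^sub>0 t)" if "t \<in> {a..b}" for t
    using neg that ab r by auto
  \<comment> \<open>\<open>L\<close> counts the points chosen on each circle and is arbitrary, while
    \<open>m\<close> is fixed; 10 is the loss in the Vitali covering.\<close>
  have "real L * (\<eta> * (b - a)) \<le> 10 * m" for L :: nat
  proof -
    let ?A = "\<lambda>t h. {x. \<bar>dist x\<^sub>0 x - t\<bar> \<le> h}"
    have A: "closed (?A t h)" for t h
      by (intro closed_Collect_le continuous_intros)
    have "\<exists>h>0. h \<le> r/4 \<and> ennreal (real L * (\<eta> * h)) \<le> emeasure \<nu> (?A t h \<inter> ?T)" if t: "t \<in> {a..b}" for t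
    proof -
      obtain F where F: "F \<subseteq> S \<inter> sphere x\<^sub>0 t" "finite F" "card F = L"
        using infinite_arbitrarily_large[OF inf[OF t]] by metis
      obtain d where d: "0 < d" "\<And>x y. x \<in> F \<Longrightarrow> y \<in> F \<Longrightarrow> x \<noteq> y \<Longrightarrow> d \<le> dist x y"
        using finite_separation[OF F(2)] by blast
      \<comment> \<open>The first entry makes the discs around the points of \<open>F\<close>
        disjoint, the second keeps them inside \<open>?T\<close>.\<close>
      define h where "h = min (d / 3) (r / 4)"
      have h: "0 < h" "h \<le> r/4" "2 * h < d" using d(1) r(1) by (auto simp: h_def)
      have "ennreal (real (card F) * (\<eta> * h)) \<le> emeasure \<nu> (?A t h \<inter> ?T)"
      proof (rule packing_bound[OF F(2) _ h(1)])
        show "2 * h < dist x y" if "x \<in> F" "y \<in> F" "x \<noteq> y" for x y using d(2)[OF that] h(3) by linarith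
        show "?A t h \<inter> ?T \<in> sets borel" using A by (intro sets.Int borel_closed) auto
        show "cball x h \<subseteq> ?A t h \<inter> ?T" if "x \<in> F" for x
        proof
          fix y assume y: "y \<in> cball x h"
          have "dist x\<^sub>0 x = t" using that F(1) by auto
          then have "\<bar>dist x\<^sub>0 y - t\<bar> \<le> h" using y dist_triangle[of x\<^sub>0 y x] dist_triangle2[of x\<^sub>0 x y] by auto
          then show "y \<in> ?A t h \<inter> ?T" using t h(2) by auto
        qed
      qed (use F T in auto)
      then show ?thesis using h F(3) by blast
    qed
    then obtain \<rho> where \<rho>: "\<And>t. t \<in> {a..b} \<Longrightarrow> 0 < \<rho> t"
      and mass: "\<And>t. t \<in> {a..b} \<Longrightarrow> ennreal (real L * (\<eta> * \<rho> t)) \<le> emeasure \<nu> (?A t (\<rho> t) \<inter> ?T)" by metis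
    obtain C where C: "finite C" "C \<subseteq> {a..b}" "pairwise (\<lambda>s t. disjnt (cball s (\<rho> s)) (cball t (\<rho> t))) C"
        "b - a \<le> (\<Sum>t\<in>C. 10 * \<rho> t)"
    proof -
      have "\<exists>C. finite C \<and> C \<subseteq> {a..b} \<and>
        pairwise (\<lambda>s t. disjnt (cball s (\<rho> s)) (cball t (\<rho> t))) C \<and> b - a \<le> (\<Sum>t\<in>C. 10 * \<rho> t)"
        by (rule Vitali_disjoint_radii[OF ab(2) \<rho>])
      then show ?thesis using that by (elim exE conjE)
    qed
    have disj: "disjoint_family_on (\<lambda>t. ?A t (\<rho> t) \<inter> ?T) C"
      unfolding disjoint_family_on_def
    proof (intro ballI impI)
      fix s t assume st: "s \<in> C" "t \<in> C" "s \<noteq> t"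
      then have d: "disjnt (cball s (\<rho> s)) (cball t (\<rho> t))" using C(3) by (auto simp: pairwise_def)
      show "(?A s (\<rho> s) \<inter> ?T) \<inter> (?A t (\<rho> t) \<inter> ?T) = {}"
      proof (rule ccontr)
        assume "\<not> ?thesis"
        then obtain x where "\<bar>dist x\<^sub>0 x - s\<bar> \<le> \<rho> s" "\<bar>dist x\<^sub>0 x - t\<bar> \<le> \<rho> t" by auto
        then have "dist x\<^sub>0 x \<in> cball s (\<rho> s)" "dist x\<^sub>0 x \<in> cball t (\<rho> t)" by (auto simp: dist_real_def)
        with d show False by (auto simp: disjnt_def)
      qed
    qed
    have "ennreal (\<Sum>t\<in>C. real L * (\<eta> * \<rho> t)) = (\<Sum>t\<in>C. ennreal (real L * (\<eta> * \<rho> t)))"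
    proof (rule sum_ennreal[symmetric])
      fix t assume "t \<in> C"
      then have "0 < \<rho> t" using C(2) \<rho> by blast
      then show "0 \<le> real L * (\<eta> * \<rho> t)" using eta_pos by simp
    qed
    also have "\<dots> \<le> (\<Sum>t\<in>C. emeasure \<nu> (?A t (\<rho> t) \<inter> ?T))" using C(2) by (intro sum_mono mass) auto
    also have "\<dots> = emeasure \<nu> (\<Union>t\<in>C. ?A t (\<rho> t) \<inter> ?T)"
    proof (rule sum_emeasure[OF _ disj C(1)])
      have "?A t (\<rho> t) \<inter> ?T \<in> sets \<nu>" for t
        by (intro in_sets sets.Int borel_closed A closed_cball) (use T in blast)
      then show "(\<lambda>t. ?A t (\<rho> t) \<inter> ?T) ` C \<subseteq> sets \<nu>" by blast
    qed
    also have "\<dots> \<le> emeasure \<nu> ?T" using T by (intro emeasure_mono in_sets) auto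
    finally have "(\<Sum>t\<in>C. real L * (\<eta> * \<rho> t)) \<le> m" using m by simp
    moreover have "real L * \<eta> * (\<Sum>t\<in>C. 10 * \<rho> t) = 10 * (\<Sum>t\<in>C. real L * (\<eta> * \<rho> t))"
      by (simp add: sum_distrib_left mult_ac)
    ultimately have "real L * \<eta> * (\<Sum>t\<in>C. 10 * \<rho> t) \<le> 10 * m" by simp
    moreover have "real L * \<eta> * (b - a) \<le> real L * \<eta> * (\<Sum>t\<in>C. 10 * \<rho> t)"
      using C(4) eta_pos by (intro mult_left_mono) auto
    ultimately show ?thesis by (simp add: mult.assoc)
  qed
  moreover obtain L :: nat where "10 * m / (\<eta> * (b - a)) < real L" using reals_Archimedean2 by blast
  ultimately show False using ab eta_pos by (simp add: pos_divide_less_eq not_less[symmetric])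
qed

text \<open>The Sura-Bura theorem encloses a component that misses the circle in a compact,
  relatively open \<open>K\<close> inside the open disc. Such a \<open>K\<close> is null, whereas
  the mass around each point of the concentration set is positive.\<close>

lemma component_meets_circle:
  assumes B: "cball x\<^sub>0 t \<subseteq> \<Omega>" and C: "C \<in> components (S \<inter> cball x\<^sub>0 t)"
  shows "C \<inter> sphere x\<^sub>0 t \<noteq> {}"
proof
  assume disj: "C \<inter> sphere x\<^sub>0 t = {}"
  let ?S = "S \<inter> cball x\<^sub>0 t"
  have "closed ?S" using closed_Int_S[OF closed_cball B] by (simp add: Int_commute)
  then have comp: "compact ?S" by (simp add: compact_eq_bounded_closed bounded_Int)
  have Csub: "C \<subseteq> ball x\<^sub>0 t" using disj in_components_subset[OF C] by (force simp: sphere_def)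
  obtain K where K: "openin (top_of_set ?S) K" "compact K" "C \<subseteq> K" "K \<subseteq> ball x\<^sub>0 t"
    by (rule Sura_Bura_clopen_subset[OF closed_imp_locally_compact[OF compact_imp_closed[OF comp]] C
        compact_components[OF comp C] open_ball Csub])
  obtain O' where O': "open O'" "K = ?S \<inter> O'" using K(1) by (auto simp: openin_open)
  \<comment> \<open>Inside \<open>W\<close> the concentration set is exactly \<open>K\<close>, so
    the rest of \<open>W\<close> is null.\<close>
  define W where "W = O' \<inter> ball x\<^sub>0 t"
  have W: "open W" "K \<subseteq> W" "W \<subseteq> \<Omega>" using O' K(4) B ball_subset_cball by (auto simp: W_def)
  have "W - K \<subseteq> \<Omega> - S" using W(3) O'(2) by (auto simp: W_def)
  then have null: "emeasure \<nu> (W - K) = 0" by (rule null_outside)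
  have "emeasure \<nu> K = 0" by (rule isolated_piece_null[OF potential setting K(2) W null])
  moreover have s: "K \<in> sets \<nu>" "W - K \<in> sets \<nu>" "W \<in> sets \<nu>"
    using W K(2) by (auto intro!: in_sets dest: compact_imp_closed)
  ultimately have W0: "emeasure \<nu> W = 0"
    using emeasure_subadditive[OF s(1,2)] null W(2) by (simp add: Un_absorb1)
  obtain x where x: "x \<in> C" using in_components_nonempty[OF C] by blast
  then have "x \<in> W" using K(3) W(2) by blast
  then obtain h where h: "0 < h" "cball x h \<subseteq> W" using W(1) open_contains_cball by blast
  have "x \<in> S" using x in_components_subset[OF C] by blast
  moreover have "ball x h \<subseteq> \<Omega>" using h(2) W(3) ball_subset_cball by blast
  ultimately have "ennreal (\<eta> * h) \<le> emeasure \<nu> (cball x h \<inter> \<Omega>)" using h(1) by (intro density_lower_bound)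
  also have "\<dots> \<le> emeasure \<nu> W" using h(2) by (intro emeasure_mono s) auto
  finally show False using W0 h(1) eta_pos by (simp add: ennreal_eq_0_iff mult_le_0_iff)
qed

text \<open>The gap between \<open>t\<close> and \<open>t'\<close> makes room for discs centred in
  \<open>C\<close>, so that the finite mass of the larger disc bounds every packing.\<close>

lemma path_connected_component_S:
  assumes t: "0 < t" "t < t'" "cball x\<^sub>0 t' \<subseteq> \<Omega>" and C: "C \<in> components (S \<inter> cball x\<^sub>0 t)"
  shows "path_connected C"
proof -
  let ?S = "S \<inter> cball x\<^sub>0 t"
  have "cball x\<^sub>0 t \<subseteq> \<Omega>" using t(2,3) by (auto simp: subset_iff)
  then have "closed ?S" using closed_Int_S[OF closed_cball] by (simp add: Int_commute)
  then have comp: "compact ?S" by (simp add: compact_eq_bounded_closed bounded_Int)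
  have "emeasure \<nu> (cball x\<^sub>0 t') < \<infinity>" using t(3) by (intro finite_on_compact) auto
  then obtain m where m: "0 \<le> m" "emeasure \<nu> (cball x\<^sub>0 t') = ennreal m" by (cases "emeasure \<nu> (cball x\<^sub>0 t')") auto
  show ?thesis
  proof (rule path_connected_if_packing_bound)
    show "compact C" by (rule compact_components[OF comp C])
    show "connected C" by (rule in_components_connected[OF C])
    show "0 < t' - t" using t by simp
    fix \<delta> F assume \<delta>: "0 < \<delta>" "\<delta> < t' - t" and F: "F \<subseteq> C" "finite F"
      and sep: "\<And>a b. a \<in> F \<Longrightarrow> b \<in> F \<Longrightarrow> a \<noteq> b \<Longrightarrow> \<delta> \<le> dist a b"
    have FS: "F \<subseteq> ?S" using F(1) in_components_subset[OF C] by blast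
    have "ennreal (real (card F) * (\<eta> * (\<delta> / 3))) \<le> emeasure \<nu> (cball x\<^sub>0 t')"
    proof (rule packing_bound[OF F(2)])
      show "F \<subseteq> S" using FS by blast
      show "0 < \<delta> / 3" using \<delta> by simp
      \<comment> \<open>The separation is only \<open>\<delta> \<le> dist x y\<close> while
        \<open>packing_bound\<close> asks for a strict inequality; a third instead of a half
        provides it.\<close>
      show "2 * (\<delta> / 3) < dist x y" if "x \<in> F" "y \<in> F" "x \<noteq> y" for x y using sep[OF that] \<delta>(1) by linarith
      show "cball x (\<delta> / 3) \<subseteq> cball x\<^sub>0 t'" if "x \<in> F" for x
      proof
        fix y assume "y \<in> cball x (\<delta> / 3)"
        moreover have "dist x\<^sub>0 x \<le> t" using FS that by auto
        ultimately show "y \<in> cball x\<^sub>0 t'" using \<delta> dist_triangle[of x\<^sub>0 y x] by auto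
      qed
    qed (use t(3) in auto)
    then have "real (card F) * (\<eta> * (\<delta> / 3)) \<le> m" using m by simp
    then show "real (card F) * \<delta> \<le> 3 * m / \<eta>" using eta_pos by (simp add: field_simps)
  qed
qed

text \<open>The connected component of any point is path-connected and reaches the circle, so every
  path component is represented by one of the finitely many points on the circle.\<close>

lemma finite_path_components:
  assumes t: "0 < t" "t < t'" "cball x\<^sub>0 t' \<subseteq> \<Omega>" and fin: "finite (S \<inter> sphere x\<^sub>0 t)"
  shows "finite (path_components_of (top_of_set (S \<inter> cball x\<^sub>0 t)))"
proof -
  let ?S = "S \<inter> cball x\<^sub>0 t"
  let ?c = "path_component_of_set (top_of_set ?S)"
  have "path_components_of (top_of_set ?S) \<subseteq> ?c ` (S \<inter> sphere x\<^sub>0 t)"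
  proof
    fix P assume "P \<in> path_components_of (top_of_set ?S)"
    then obtain x where x: "x \<in> ?S" "P = ?c x" by (auto simp: path_components_of_def)
    define C where "C = connected_component_set ?S x"
    have C: "C \<in> components ?S" using x(1) by (auto simp: C_def components_def)
    have "cball x\<^sub>0 t \<subseteq> \<Omega>" using t(2,3) by (auto simp: subset_iff)
    then obtain z where z: "z \<in> C" "z \<in> sphere x\<^sub>0 t" using component_meets_circle[OF _ C] by blast
    have "path_connected C" by (rule path_connected_component_S[OF t C])
    then have "path_connectedin (top_of_set ?S) C"
      using in_components_subset[OF C] by (simp add: path_connectedin_subtopology)
    moreover have "x \<in> C" using x(1) by (simp add: C_def)
    ultimately have "path_component_of (top_of_set ?S) x z" using z(1) by (auto simp: path_component_of)
    then have "P = ?c z" using x(2) by (simp add: path_component_of_equiv)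
    moreover have "z \<in> S" using z(1) in_components_subset[OF C] by blast
    ultimately show "P \<in> ?c ` (S \<inter> sphere x\<^sub>0 t)" using z(2) by blast
  qed
  then show ?thesis using fin by (rule finite_surj[rotated])
qed

end

theorem proposition2:
  fixes V :: "real^'k \<Rightarrow> real"
    and \<Omega> :: "(real^2) set"
    and M\<^sub>0 :: real
    and \<epsilon> :: "nat \<Rightarrow> real"
    and u :: "nat \<Rightarrow> real^2 \<Rightarrow> real^'k"
    and \<nu> :: "(real^2) measure"
    and \<eta>\<^sub>0 r :: real
    and x\<^sub>0 :: "real^2"
  assumes "potential V"
    and "limit_measure_setting V \<Omega> M\<^sub>0 \<epsilon> u \<nu>"
    and "clearing_out_constant V \<eta>\<^sub>0"
    and "x\<^sub>0 \<in> \<Omega>" and "r > 0" and "ball x\<^sub>0 (2 * r) \<subseteq> \<Omega>"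
  shows "\<exists>r\<^sub>0. r < r\<^sub>0 \<and> r\<^sub>0 < 2 * r \<and>
    finite (path_components_of (top_of_set (concentration_set \<Omega> \<nu> \<eta>\<^sub>0 \<inter> cball x\<^sub>0 r\<^sub>0)))"
proof -
  interpret concentration V \<Omega> M\<^sub>0 \<epsilon> u \<nu> \<eta>\<^sub>0 using assms(1-3) by unfold_locales
  obtain t where t: "r < t" "t < 2 * r" "finite (S \<inter> sphere x\<^sub>0 t)"
    using good_radius[OF assms(5,6)] by blast
  \<comment> \<open>The midpoint of \<open>t\<close> and \<open>2 * r\<close> leaves a margin around
    the disc of radius \<open>t\<close> while its closed disc still lies in the domain.\<close>
  have "cball x\<^sub>0 ((t + 2 * r) / 2) \<subseteq> ball x\<^sub>0 (2 * r)" using t(2) by (auto simp: subset_iff)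
  then have "cball x\<^sub>0 ((t + 2 * r) / 2) \<subseteq> \<Omega>" using assms(6) by (rule order_trans)
  then have "finite (path_components_of (top_of_set (S \<inter> cball x\<^sub>0 t)))"
    using t assms(5) by (intro finite_path_components[of t "(t + 2 * r) / 2"]) auto
  with t show ?thesis by blast
qed

end
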